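(* Let $1\le p,q,q_1,q_2\le\infty$ and $\alpha_1,\alpha_2\in\mathbb{R}$ with $\alpha_1<0$. Suppose that $\frac1s=\frac1{q_1}+\frac1q$ and $\frac{\alpha_1}{Q}+\frac1{q_1}=\frac{\alpha_2}{Q}+\frac1{q_2}$. Let $w\in A_1(\mathbb{H}^n)$ with critical index $r_w$ for the reverse Hölder condition, and suppose $s>q_2\,r_w/(r_w-1)$. Let $\Phi$ be a locally integrable function on $\mathbb{H}^n$ and let $A(y)$ be a $(2n+1)\times(2n+1)$ matrix-valued function on $\mathbb{H}^n$ with $\det A(y)\neq 0$ for almost every $y$ in the support of $\Phi$. (i) If $\frac{1}{q_1}+\frac{\alpha_1}{Q}\ge 0$, then for any $1<\delta<r_w$ there is a constant $C>0$, independent of $f$, $b$, $\Phi$ and $A$, such that for all $b\in C\dot{M}O^q(\mathbb{H}^n;w)$ and $f\in\dot K^{\alpha_1,p}_{q_1}(\mathbb{H}^n;w)$ $$\|T^b_{\Phi,A}f\|_{\dot K^{\alpha_2,p}_{q_2}(\mathbb{H}^n;w)}\le C\,K_1\,\|b\|_{C\dot{M}O^q(\mathbb{H}^n;w)}\,\|f\|_{\dot K^{\alpha_1,p}_{q_1}(\mathbb{H}^n;w)},$$ where $$\begin{aligned}K_1&=\int_{\|A(y)\|<1}\frac{|\Phi(y)|}{|y|_h^Q}\left(1+|\det A^{-1}(y)|^{1/q}\|A(y)\|^{Q/q}\right)|\det A^{-1}(y)|^{1/q_1}\|A(y)\|^{-\alpha_1}\log\frac{2}{\|A(y)\|}\,dy\\&\quad+\int_{\|A(y)\|\ge1}\frac{|\Phi(y)|}{|y|_h^Q}\left(1+|\det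 A^{-1}(y)|^{1/q}\|A(y)\|^{Q/q}\right)|\det A^{-1}(y)|^{1/q_1}\\&\qquad\qquad\times\|A(y)\|^{Q/q_1-(\alpha_1+Q/q_1)(\delta-1)/\delta}\log\big(2\|A(y)\|\big)\,dy.\end{aligned}$$ (ii) If $\frac{1}{q_1}+\frac{\alpha_1}{Q}<0$, then for any $1<\delta<r_w$ there is a constant $C>0$, independent of $f$, $b$, $\Phi$ and $A$, such that for all $b\in C\dot{M}O^q(\mathbb{H}^n;w)$ and $f\in\dot K^{\alpha_1,p}_{q_1}(\mathbb{H}^n;w)$ $$\|T^b_{\Phi,A}f\|_{\dot K^{\alpha_2,p}_{q_2}(\mathbb{H}^n;w)}\le C\,K_2\,\|b\|_{C\dot{M}O^q(\mathbb{H}^n;w)}\,\|f\|_{\dot K^{\alpha_1,p}_{q_1}(\mathbb{H}^n;w)},$$ where $$\begin{aligned}K_2&=\int_{\|A(y)\|\ge1}\frac{|\Phi(y)|}{|y|_h^Q}\left(1+|\det A^{-1}(y)|^{1/q}\|A(y)\|^{Q/q}\right)|\det A^{-1}(y)|^{1/q_1}\|A(y)\|^{-\alpha_1}\log\big(2\|A(y)\|\big)\,dy\\&\quad+\int_{\|A(y)\|<1}\frac{|\Phi(y)|}{|y|_h^Q}\left(1+|\det A^{-1}(y)|^{1/q}\|A(y)\|^{Q/q}\right)|\det A^{-1}(y)|^{1/q_1}\\&\qquad\qquad\times\|A(y)\|^{Q/q_1-(\alpha_1+Q/q_1)(\delta-1)/\delta}\log\frac{2}{\|A(y)\|}\,d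y.\end{aligned}$$
   Context: The Heisenberg group $\mathbb{H}^n$ is $\mathbb{R}^{2n}\times\mathbb{R}$ with the product $$x\cdot y=\Big(x_1+y_1,\dots,x_{2n}+y_{2n},\,x_{2n+1}+y_{2n+1}+2\sum_{j=1}^n(y_jx_{n+j}-x_jy_{n+j})\Big);$$ the identity is $0$ and $x^{-1}=-x$. Haar measure is Lebesgue measure on $\mathbb{R}^{2n+1}$, denoted $dx$, and $|E|$ is the measure of $E$. The homogeneous dimension is $Q=2n+2$. The homogeneous norm is $|x|_h=\big[(\sum_{i=1}^{2n}x_i^2)^2+x_{2n+1}^2\big]^{1/4}$, the distance is $d(x,y)=|y^{-1}x|_h$, and $B(x,r)=\{y: d(x,y)<r\}$. For a $(2n+1)\times(2n+1)$ matrix $M$ acting linearly on $\mathbb{R}^{2n+1}=\mathbb{H}^n$, put $\|M\|=\sup_{x\ne0}|Mx|_h/|x|_h$. $A^{-1}(y)$ denotes the inverse matrix of $A(y)$. The matrix Hausdorff operator is $T_{\Phi,A}f(x)=\int_{\mathbb{H}^n}\frac{\Phi(y)}{|y|_h^Q}f(A(y)x)\,dy$, and its commutator with a locally integrable function $b$ is $T^b_{\Phi,A}f=b\,T_{\Phi,A}f-T_{\Phi,A}(bf)$, that is, $$T^b_{\Phi,A}f(x)=\int_{\mathbb{H}^n}\frac{\Phi(y)}{|y|_h^Q}\big(b(x)-b(A(y)x)\big)f(A(y)x)\,dy.$$ A weight is a non-negative locally integrable function $w$ on $\mathbb{H}^n$ (not a.e. zero), and $w(E)=\int_E w(x)\,dx$.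 $w\in A_1(\mathbb{H}^n)$ means there is $C>0$ with $\frac1{|B|}\int_B w\,dx\le C\operatorname{ess\,inf}_{x\in B}w(x)$ for every ball $B$. For $r>1$, $w\in RH_r(\mathbb{H}^n)$ means there is $C>0$ with $\big(\frac1{|B|}\int_B w^r\,dx\big)^{1/r}\le\frac{C}{|B|}\int_B w\,dx$ for every ball $B$. The critical index is $r_w=\sup\{r>1: w\in RH_r(\mathbb{H}^n)\}\in(1,\infty]$, with $r_w/(r_w-1)=1$ if $r_w=\infty$. $\|f\|_{L^q(E;w)}=\big(\int_E|f|^qw\,dx\big)^{1/q}$ for $q<\infty$, and $L^\infty(E;w)=L^\infty(E)$. Let $B_k=\{x\in\mathbb{H}^n:|x|_h<2^k\}$ and $E_k=B_k\setminus B_{k-1}$ for $k\in\mathbb{Z}$. The homogeneous weighted Herz space $\dot K^{\alpha,p}_q(\mathbb{H}^n;w)$ is the set of $f\in L^q_{\rm loc}(\mathbb{H}^n\setminus\{0\};w)$ with $$\|f\|_{\dot K^{\alpha,p}_q(\mathbb{H}^n;w)}=\Big\{\sum_{k=-\infty}^\infty w(B_k)^{\alpha p/Q}\|f\|_{L^q(E_k;w)}^p\Big\}^{1/p}<\infty$$ (with $\sup_k w(B_k)^{\alpha/Q}\|f\|_{L^q(E_k;w)}$ if $p=\infty$). The weighted central BMO space $C\dot MO^q(\mathbb{H}^n;w)$ consists of the locally integrable $f\in L^q_{\rm loc}(\mathbb{H}^n;w)$ with $$\|f\|_{C\dot MO^q(\mathbb{H}^n;w)}=\sup_{R>0}\Big(\frac1{w(B(0,R))}\int_{B(0,R)}|f(x)-f_{B(0,R)}|^qw(x)\,dx\Big)^{1/q}<\infty,\qquad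 f_{B(0,R)}=\frac1{|B(0,R)|}\int_{B(0,R)}f(x)\,dx$$ (with the usual essential-supremum modification if $q=\infty$). Convention: $1/\infty=0$. The stated inequalities have content only when $K_1$, respectively $K_2$, is finite. *)

theory Defs
  imports "HOL-Analysis.Analysis" "HOL-Probability.Essential_Supremum"
begin

section \<open>The Heisenberg group\<close>

text \<open>
  For a finite index type \<open>'n\<close> with \<open>n\<close> elements, the \<open>2n+1\<close> coordinates are indexed by
  \<open>'n + 'n + unit\<close>: \<open>Inl j\<close> stands for \<open>j\<close>, \<open>Inr (Inl j)\<close> for \<open>n+j\<close>, and
  \<open>Inr (Inr ())\<close> for \<open>2n+1\<close>.
\<close>

type_synonym 'n heis = "real ^ ('n + 'n + unit)"

definition hmul :: "'n::finite heis \<Rightarrow> 'n heis \<Rightarrow> 'n heis" where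
  "hmul x y = (\<chi> i. case i of
       Inr (Inr u) \<Rightarrow> x $ i + y $ i
         + 2 * (\<Sum>j\<in>UNIV. y $ Inl j * x $ Inr (Inl j) - x $ Inl j * y $ Inr (Inl j))
     | _ \<Rightarrow> x $ i + y $ i)"

lemma hmul_nth [simp]:
  "hmul x y $ Inl j = x $ Inl j + y $ Inl j"
  "hmul x y $ Inr (Inl j) = x $ Inr (Inl j) + y $ Inr (Inl j)"
  "hmul x y $ Inr (Inr u) = x $ Inr (Inr u) + y $ Inr (Inr u)
     + 2 * (\<Sum>j\<in>UNIV. y $ Inl j * x $ Inr (Inl j) - x $ Inl j * y $ Inr (Inl j))"
  by (simp_all add: hmul_def)

lemma heis_eqI:
  fixes x y :: "'n::finite heis"
  assumes "\<And>j. x $ Inl j = y $ Inl j" "\<And>j. x $ Inr (Inl j) = y $ Inr (Inl j)"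
    "x $ Inr (Inr ()) = y $ Inr (Inr ())"
  shows "x = y"
  unfolding vec_eq_iff
proof
  fix i :: "'n + 'n + unit"
  show "x $ i = y $ i"
  proof (cases i)
    case (Inr i')
    then show ?thesis
      using assms by (cases i') auto
  qed (use assms in auto)
qed

lemma hmul_assoc: "hmul (hmul x y) z = hmul x (hmul y z)"
  by (rule heis_eqI)
     (simp_all add: algebra_simps sum.distrib sum_subtractf)

lemma hmul_zero: "hmul 0 x = x" "hmul x 0 = x"
  by (rule heis_eqI; simp)+

lemma hmul_inverse: "hmul (- x) x = 0" "hmul x (- x) = 0"
  by (rule heis_eqI; simp add: algebra_simps)+

definition hom_dim :: "'n::finite itself \<Rightarrow> nat" where
  "hom_dim _ = 2 * CARD('n) + 2"

definition hnorm :: "'n::finite heis \<Rightarrow> real" where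
  "hnorm x = root 4 ((\<Sum>j\<in>UNIV. (x $ Inl j)\<^sup>2 + (x $ Inr (Inl j))\<^sup>2)\<^sup>2 + (x $ Inr (Inr ()))\<^sup>2)"

text \<open>The inverse of \<open>y\<close> in the group is \<open>- y\<close>.\<close>

definition hdist :: "'n::finite heis \<Rightarrow> 'n heis \<Rightarrow> real" where
  "hdist x y = hnorm (hmul (- y) x)"

definition hball :: "'n::finite heis \<Rightarrow> real \<Rightarrow> 'n heis set" where
  "hball x r = {y. hdist x y < r}"

section \<open>Extended non-negative arithmetic\<close>

text \<open>
  Norms, exponents and the constants of the estimates live in \<^typ>\<open>ennreal\<close>; real powers and the
  logarithm are extended to it by continuity, with \<open>0\<close>-th powers equal to \<open>1\<close>.
\<close>

definition epowr :: "ennreal \<Rightarrow> real \<Rightarrow> ennreal" where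
  "epowr x a =
     (if a = 0 then 1
      else if x = \<infinity> then (if 0 < a then \<infinity> else 0)
      else if x = 0 then (if 0 < a then 0 else \<infinity>)
      else ennreal (enn2real x powr a))"

text \<open>Logarithm for arguments in \<open>[1,\<infinity>]\<close>; it is never applied to smaller ones.\<close>

definition eln :: "ennreal \<Rightarrow> ennreal" where
  "eln x = (if x = \<infinity> then \<infinity> else ennreal (ln (enn2real x)))"

text \<open>The real number \<open>1/q\<close> for an exponent \<open>1 \<le> q \<le> \<infinity>\<close>, with \<open>1/\<infinity> = 0\<close>.\<close>

definition recip :: "ennreal \<Rightarrow> real" where
  "recip q = enn2real (1 / q)"

lemma recip_infinity: "recip \<infinity> = 0"
  by (simp add: recip_def)

text \<open>
  The operator norm is extended-valued: \<^const>\<open>hnorm\<close> is homogeneous for the group dilations but not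
  for scalar multiplication, and the supremum is infinite for every matrix which mixes horizontal
  and central coordinates.
\<close>

definition mat_hnorm :: "real ^ ('n + 'n + unit) ^ ('n::finite + 'n + unit) \<Rightarrow> ennreal" where
  "mat_hnorm M = (SUP x\<in>- {0}. ennreal (hnorm (M *v x) / hnorm x))"

section \<open>Weights\<close>

definition loc_integrable :: "('n::finite heis \<Rightarrow> 'b::euclidean_space) \<Rightarrow> bool" where
  "loc_integrable f \<longleftrightarrow> (\<forall>S. compact S \<longrightarrow> set_integrable lebesgue S f)"

definition weight :: "('n::finite heis \<Rightarrow> real) \<Rightarrow> bool" where
  "weight w \<longleftrightarrow> (\<forall>x. 0 \<le> w x) \<and> loc_integrable w \<and> \<not> (AE x in lebesgue. w x = 0)"

definition wmeas :: "('n::finite heis \<Rightarrow> real) \<Rightarrow> 'n heis set \<Rightarrow> ennreal" where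
  "wmeas w E = (\<integral>\<^sup>+x\<in>E. ennreal (w x) \<partial>lebesgue)"

definition essinf_on :: "'n::finite heis set \<Rightarrow> ('n heis \<Rightarrow> real) \<Rightarrow> ennreal" where
  "essinf_on E w = Sup {c. AE x in lebesgue. x \<in> E \<longrightarrow> c \<le> ennreal (w x)}"

definition A1_weight :: "('n::finite heis \<Rightarrow> real) \<Rightarrow> bool" where
  "A1_weight w \<longleftrightarrow> weight w \<and>
     (\<exists>C>0. \<forall>x. \<forall>r>0.
        wmeas w (hball x r) / emeasure lebesgue (hball x r) \<le> ennreal C * essinf_on (hball x r) w)"

definition reverse_Hoelder :: "real \<Rightarrow> ('n::finite heis \<Rightarrow> real) \<Rightarrow> bool" where
  "reverse_Hoelder r w \<longleftrightarrow>
     (\<exists>C>0. \<forall>x. \<forall>\<rho>>0.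
        epowr ((\<integral>\<^sup>+z\<in>hball x \<rho>. ennreal (w z powr r) \<partial>lebesgue)
                 / emeasure lebesgue (hball x \<rho>)) (1 / r)
          \<le> ennreal C * (wmeas w (hball x \<rho>) / emeasure lebesgue (hball x \<rho>)))"

definition critical_index :: "('n::finite heis \<Rightarrow> real) \<Rightarrow> ennreal" where
  "critical_index w = (SUP r\<in>{r. 1 < r \<and> reverse_Hoelder r w}. ennreal r)"

definition conj_exponent :: "ennreal \<Rightarrow> ennreal" where
  "conj_exponent r = (if r = \<infinity> then 1 else r / (r - 1))"

section \<open>Function spaces\<close>

definition Lq_norm ::
    "ennreal \<Rightarrow> 'n::finite heis set \<Rightarrow> ('n heis \<Rightarrow> real) \<Rightarrow> ('n heis \<Rightarrow> complex) \<Rightarrow> ennreal" where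
  "Lq_norm q E w f =
     (if q = \<infinity> then esssup lebesgue (\<lambda>x. ennreal (norm (f x)) * indicator E x)
      else epowr (\<integral>\<^sup>+x\<in>E. ennreal (norm (f x) powr enn2real q * w x) \<partial>lebesgue)
             (1 / enn2real q))"

definition Lq_loc ::
    "ennreal \<Rightarrow> 'n::finite heis set \<Rightarrow> ('n heis \<Rightarrow> real) \<Rightarrow> ('n heis \<Rightarrow> complex) set" where
  "Lq_loc q U w =
     {f \<in> borel_measurable lebesgue. \<forall>S. compact S \<and> S \<subseteq> U \<longrightarrow> Lq_norm q S w f < \<infinity>}"

definition dball :: "int \<Rightarrow> 'n::finite heis set" where
  "dball k = {x. hnorm x < 2 powi k}"

definition dshell :: "int \<Rightarrow> 'n::finite heis set" where
  "dshell k = dball k - dball (k - 1)"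

definition herz_norm ::
    "real \<Rightarrow> ennreal \<Rightarrow> ennreal \<Rightarrow> ('n::finite heis \<Rightarrow> real) \<Rightarrow> ('n heis \<Rightarrow> complex) \<Rightarrow> ennreal" where
  "herz_norm \<alpha> p q w f =
     (if p = \<infinity>
      then (SUP k. epowr (wmeas w (dball k)) (\<alpha> / real (hom_dim TYPE('n))) * Lq_norm q (dshell k) w f)
      else epowr (\<Sum>\<^sub>\<infinity>k\<in>UNIV.
               epowr (wmeas w (dball k)) (\<alpha> * enn2real p / real (hom_dim TYPE('n)))
                 * epowr (Lq_norm q (dshell k) w f) (enn2real p))
             (1 / enn2real p))"

definition herz ::
    "real \<Rightarrow> ennreal \<Rightarrow> ennreal \<Rightarrow> ('n::finite heis \<Rightarrow> real) \<Rightarrow> ('n heis \<Rightarrow> complex) set" where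
  "herz \<alpha> p q w = {f \<in> Lq_loc q (- {0}) w. herz_norm \<alpha> p q w f < \<infinity>}"

definition mean :: "'n::finite heis set \<Rightarrow> ('n heis \<Rightarrow> complex) \<Rightarrow> complex" where
  "mean E f = (1 / measure lebesgue E) *\<^sub>R (LINT x:E|lebesgue. f x)"

definition cmo_norm ::
    "ennreal \<Rightarrow> ('n::finite heis \<Rightarrow> real) \<Rightarrow> ('n heis \<Rightarrow> complex) \<Rightarrow> ennreal" where
  "cmo_norm q w f =
     (SUP R\<in>{0<..}.
        if q = \<infinity>
        then esssup lebesgue (\<lambda>x. ennreal (norm (f x - mean (hball 0 R) f)) * indicator (hball 0 R) x)
        else epowr
          ((\<integral>\<^sup>+x\<in>hball 0 R. ennreal (norm (f x - mean (hball 0 R) f) powr enn2real q * w x) \<partial>lebesgue)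
             / wmeas w (hball 0 R))
          (1 / enn2real q))"

definition cmo ::
    "ennreal \<Rightarrow> ('n::finite heis \<Rightarrow> real) \<Rightarrow> ('n heis \<Rightarrow> complex) set" where
  "cmo q w = {f \<in> Lq_loc q UNIV w. loc_integrable f \<and> cmo_norm q w f < \<infinity>}"

section \<open>The commutator of the matrix Hausdorff operator\<close>

definition commutator_integrand ::
    "('n::finite heis \<Rightarrow> complex) \<Rightarrow> ('n heis \<Rightarrow> real ^ ('n + 'n + unit) ^ ('n + 'n + unit))
      \<Rightarrow> ('n heis \<Rightarrow> complex) \<Rightarrow> ('n heis \<Rightarrow> complex) \<Rightarrow> 'n heis \<Rightarrow> 'n heis \<Rightarrow> complex" where
  "commutator_integrand \<Phi> A b f x y =
     \<Phi> y / of_real (hnorm y ^ hom_dim TYPE('n)) * (b x - b (A y *v x)) * f (A y *v x)"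

definition commutator ::
    "('n::finite heis \<Rightarrow> complex) \<Rightarrow> ('n heis \<Rightarrow> real ^ ('n + 'n + unit) ^ ('n + 'n + unit))
      \<Rightarrow> ('n heis \<Rightarrow> complex) \<Rightarrow> ('n heis \<Rightarrow> complex) \<Rightarrow> 'n heis \<Rightarrow> complex" where
  "commutator \<Phi> A b f x = (LINT y|lebesgue. commutator_integrand \<Phi> A b f x y)"

text \<open>
  The factor
  \<open>|\<Phi>(y)| / |y|\<^sup>Q * (1 + |det A\<inverse>(y)| ^ (1/q) * \<parallel>A(y)\<parallel> ^ (Q/q)) * |det A\<inverse>(y)| ^ (1/q1)\<close>
  shared by all the integrals in the two constants.
\<close>

definition K_factor ::
    "ennreal \<Rightarrow> ennreal \<Rightarrow> ('n::finite heis \<Rightarrow> complex)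
      \<Rightarrow> ('n heis \<Rightarrow> real ^ ('n + 'n + unit) ^ ('n + 'n + unit)) \<Rightarrow> 'n heis \<Rightarrow> ennreal" where
  "K_factor q q1 \<Phi> A y =
     ennreal (norm (\<Phi> y) / hnorm y ^ hom_dim TYPE('n))
     * (1 + ennreal (\<bar>det (matrix_inv (A y))\<bar> powr recip q)
            * epowr (mat_hnorm (A y)) (real (hom_dim TYPE('n)) * recip q))
     * ennreal (\<bar>det (matrix_inv (A y))\<bar> powr recip q1)"

text \<open>The exponent \<open>Q/q1 - (\<alpha> + Q/q1) (\<delta> - 1)/\<delta>\<close>.\<close>

definition K_exponent :: "nat \<Rightarrow> real \<Rightarrow> real \<Rightarrow> ennreal \<Rightarrow> real" where
  "K_exponent Q \<delta> \<alpha> q1 = real Q * recip q1 - (\<alpha> + real Q * recip q1) * (\<delta> - 1) / \<delta>"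

definition K1 ::
    "real \<Rightarrow> real \<Rightarrow> ennreal \<Rightarrow> ennreal \<Rightarrow> ('n::finite heis \<Rightarrow> complex)
      \<Rightarrow> ('n heis \<Rightarrow> real ^ ('n + 'n + unit) ^ ('n + 'n + unit)) \<Rightarrow> ennreal" where
  "K1 \<delta> \<alpha> q q1 \<Phi> A =
     (\<integral>\<^sup>+y\<in>{y. mat_hnorm (A y) < 1}. K_factor q q1 \<Phi> A y
         * epowr (mat_hnorm (A y)) (- \<alpha>) * eln (2 / mat_hnorm (A y)) \<partial>lebesgue)
   + (\<integral>\<^sup>+y\<in>{y. 1 \<le> mat_hnorm (A y)}. K_factor q q1 \<Phi> A y
         * epowr (mat_hnorm (A y)) (K_exponent (hom_dim TYPE('n)) \<delta> \<alpha> q1)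
         * eln (2 * mat_hnorm (A y)) \<partial>lebesgue)"

definition K2 ::
    "real \<Rightarrow> real \<Rightarrow> ennreal \<Rightarrow> ennreal \<Rightarrow> ('n::finite heis \<Rightarrow> complex)
      \<Rightarrow> ('n heis \<Rightarrow> real ^ ('n + 'n + unit) ^ ('n + 'n + unit)) \<Rightarrow> ennreal" where
  "K2 \<delta> \<alpha> q q1 \<Phi> A =
     (\<integral>\<^sup>+y\<in>{y. 1 \<le> mat_hnorm (A y)}. K_factor q q1 \<Phi> A y
         * epowr (mat_hnorm (A y)) (- \<alpha>) * eln (2 * mat_hnorm (A y)) \<partial>lebesgue)
   + (\<integral>\<^sup>+y\<in>{y. mat_hnorm (A y) < 1}. K_factor q q1 \<Phi> A y
         * epowr (mat_hnorm (A y)) (K_exponent (hom_dim TYPE('n)) \<delta> \<alpha> q1)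
         * eln (2 / mat_hnorm (A y)) \<partial>lebesgue)"

text \<open>
  Standing assumptions on \<open>\<Phi>\<close> and \<open>A\<close>; the support of \<open>\<Phi>\<close> is taken to be \<open>{y. \<Phi> y \<noteq> 0}\<close>.
\<close>

definition admissible ::
    "('n::finite heis \<Rightarrow> complex) \<Rightarrow> ('n heis \<Rightarrow> real ^ ('n + 'n + unit) ^ ('n + 'n + unit)) \<Rightarrow> bool" where
  "admissible \<Phi> A \<longleftrightarrow> loc_integrable \<Phi> \<and> A \<in> borel_measurable lebesgue \<and>
     (AE y in lebesgue. \<Phi> y \<noteq> 0 \<longrightarrow> det (A y) \<noteq> 0)"

end

theory Submission
  imports Defs
begin

text \<open>Everything is decided on the dyadic balls \<open>B\<^sub>k\<close>. Write \<open>|B\<^sub>k|\<close> for the volume, \<open>W\<^sub>k\<close> for the weighted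
  volume and \<open>\<beta> = \<alpha>1/Q + 1/q1 = \<alpha>2/Q + 1/q2\<close>. The \<open>A\<^sub>1\<close> condition and the reverse Hoelder condition with
  one exponent \<open>r \<ge> \<delta>\<close> enter only through the axioms of the locale \<open>dyadic_weight\<close>: \<open>w\<close> is bounded below
  on \<open>B\<^sub>k\<close> by a multiple of its mean, and its \<open>r\<close>-th mean is at most a multiple of its mean. They give
  the two-sided growth \<open>2^{(1-1/r)mQ} \<lesssim> W\<^sub>k / W\<^sub>k\<^sub>-\<^sub>m \<lesssim> 2^{mQ}\<close> (\<open>wvol_doubling\<close>, \<open>wvol_reverse_doubling\<close>).

  Fix \<open>y\<close>, put \<open>A = A(y)\<close>, and let \<open>j\<close> satisfy \<open>2^{j-1} \<le> \<parallel>A\<parallel> < 2^j\<close>, so that \<open>A\<close> maps \<open>B\<^sub>k\<close> into \<open>B\<^sub>k\<^sub>+\<^sub>j\<close>. The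
  hypothesis on \<open>s\<close> leaves room for \<open>r\<close> with \<open>q2/q + q2/q1 + 1/r \<le> 1\<close>, and Hoelder's inequality with the
  three factors \<open>b - b \<circ> A\<close>, \<open>f \<circ> A\<close> and \<open>w\<close> turns the weighted \<open>q2\<close>-mean of
  \<open>(b - b \<circ> A) (f \<circ> A)\<close> over \<open>B\<^sub>k\<close> into unweighted means. A linear change of variables and the lower bound on
  \<open>w\<close> lead back to weighted means over \<open>B\<^sub>k\<^sub>+\<^sub>j\<close>. The factor with \<open>b\<close> is split at the means of \<open>b\<close> over \<open>B\<^sub>k\<close>
  and \<open>B\<^sub>k\<^sub>+\<^sub>j\<close>; these differ by at most \<open>O(|j|)\<close> times the central oscillation norm, whence the logarithm in the
  constants (\<open>lp_bound_oscillation\<close>). Since \<open>A\<close> may contract some directions strongly, \<open>A E\<^sub>k\<close> may meet every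
  shell \<open>E\<^sub>l\<close> with \<open>l \<le> k + j\<close>; because \<open>\<alpha>1 < 0\<close>, the reverse doubling makes the contribution of \<open>E\<^sub>l\<close> decay
  geometrically in \<open>k + j - l\<close>.

  What is left of the weight is \<open>(W\<^sub>k / W\<^sub>k\<^sub>+\<^sub>j)^\<beta>\<close>. It is bounded by the upper or by the lower growth
  according to the signs of \<open>j\<close> and \<open>\<beta>\<close>, and the four combinations are the four exponents of \<open>\<parallel>A(y)\<parallel>\<close> in
  the two constants (\<open>wvol_growth\<close>). Minkowski's inequality is used three times: for the sum over
  the shells, for the integral over \<open>y\<close> in the sequence space \<open>l\<^sup>p\<close>, and for the integral over \<open>y\<close> in
  \<open>L^{q2}(B\<^sub>k; w)\<close>. The constant is not tracked, so Hoelder and Minkowski are proved with a loss of a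
  constant factor, which makes their proofs elementary.

  For functions that are merely Lebesgue measurable, \<open>f (A(y) x)\<close> need not be jointly measurable in
  \<open>(x, y)\<close>. Hence \<open>b\<close>, \<open>f\<close>, \<open>\<Phi>\<close> and \<open>A\<close> are first replaced by Borel functions equal to them almost everywhere;
  invertibility of \<open>A(y)\<close> ensures that the commutator changes on a null set only
  (\<open>AE_commutator_integrand_eq\<close>).\<close>

section \<open>Linear changes of variables\<close>

text \<open>Integrating over the sheared coordinate first, the shear is a translation of the line.\<close>

lemma nn_integral_shear:
  fixes g :: "real ^ 'n \<Rightarrow> ennreal" and m k :: 'n
  assumes [measurable]: "g \<in> borel_measurable borel" and mk: "m \<noteq> k"
  shows "(\<integral>\<^sup>+x. g (x + (c * x $ k) *\<^sub>R axis m 1) \<partial>lborel) = (\<integral>\<^sup>+x. g x \<partial>lborel)"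
proof -
  interpret product_sigma_finite "\<lambda>_::real ^ 'n. lborel :: real measure" ..
  let ?e = "axis m 1 :: real ^ 'n" and ?d = "axis k 1 :: real ^ 'n"
  let ?I = "Basis - {?e}"
  let ?S = "\<lambda>f. \<Sum>b\<in>Basis. f b *\<^sub>R b :: real ^ 'n"
  have e: "?e \<in> Basis" and d: "?d \<in> ?I"
    using mk by (auto simp: axis_eq_axis)
  have ins: "insert ?e ?I = Basis" using e by auto
  have nth: "?S f $ k = f ?d" for f
  proof -
    have "?S f $ k = ?S f \<bullet> ?d" by (simp add: inner_axis)
    also have "\<dots> = f ?d" using d by (simp add: inner_sum_left_Basis)
    finally show ?thesis .
  qed
  have meas[measurable]: "?S \<in> (\<Pi>\<^sub>M b\<in>Basis. lborel) \<rightarrow>\<^sub>M borel" by measurable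
  have S_upd: "?S (f(?e := y)) = y *\<^sub>R ?e + (\<Sum>b\<in>?I. f b *\<^sub>R b)" for f y
    using e by (subst sum.remove[of _ ?e]) (auto intro!: sum.cong)
  have *: "(\<integral>\<^sup>+x. h x \<partial>lborel) = (\<integral>\<^sup>+f. \<integral>\<^sup>+y. h (?S (f(?e := y))) \<partial>lborel \<partial>(\<Pi>\<^sub>M b\<in>?I. lborel))"
    if [measurable]: "h \<in> borel_measurable borel" for h :: "real ^ 'n \<Rightarrow> ennreal"
  proof -
    have "(\<integral>\<^sup>+x. h x \<partial>lborel) = (\<integral>\<^sup>+f. h (?S f) \<partial>(\<Pi>\<^sub>M b\<in>insert ?e ?I. lborel))"
      unfolding ins by (subst lborel_eq, subst nn_integral_distr) auto
    also have "\<dots> = (\<integral>\<^sup>+f. \<integral>\<^sup>+y. h (?S (f(?e := y))) \<partial>lborel \<partial>(\<Pi>\<^sub>M b\<in>?I. lborel))"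
      using ins by (intro product_nn_integral_insert) auto
    finally show ?thesis .
  qed
  have "(\<integral>\<^sup>+x. g (x + (c * x $ k) *\<^sub>R ?e) \<partial>lborel)
      = (\<integral>\<^sup>+f. \<integral>\<^sup>+y. g (?S (f(?e := y)) + (c * ?S (f(?e := y)) $ k) *\<^sub>R ?e) \<partial>lborel \<partial>(\<Pi>\<^sub>M b\<in>?I. lborel))"
    by (rule *) measurable
  also have "\<dots> = (\<integral>\<^sup>+f. \<integral>\<^sup>+y. g (?S (f(?e := y))) \<partial>lborel \<partial>(\<Pi>\<^sub>M b\<in>?I. lborel))"
  proof (rule nn_integral_cong)
    fix f :: "real ^ 'n \<Rightarrow> real"
    let ?r = "\<Sum>b\<in>?I. f b *\<^sub>R b"
    have "(\<integral>\<^sup>+y. g (?S (f(?e := y))) \<partial>lborel) = (\<integral>\<^sup>+y. g (y *\<^sub>R ?e + ?r) \<partial>lborel)"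
      unfolding S_upd ..
    also have "\<dots> = (\<integral>\<^sup>+y. g ((c * f ?d + 1 * y) *\<^sub>R ?e + ?r) \<partial>lborel)"
      by (subst nn_integral_real_affine[where c=1 and t="c * f ?d"]) auto
    also have "\<dots> = (\<integral>\<^sup>+y. g (?S (f(?e := y)) + (c * ?S (f(?e := y)) $ k) *\<^sub>R ?e) \<partial>lborel)"
      unfolding nth unfolding S_upd using d by (simp add: algebra_simps)
    finally show "(\<integral>\<^sup>+y. g (?S (f(?e := y)) + (c * ?S (f(?e := y)) $ k) *\<^sub>R ?e) \<partial>lborel)
      = (\<integral>\<^sup>+y. g (?S (f(?e := y))) \<partial>lborel)" by simp
  qed
  also have "\<dots> = (\<integral>\<^sup>+x. g x \<partial>lborel)" by (rule *[symmetric]) measurable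
  finally show ?thesis .
qed

lemma prod_Basis_vec:
  fixes h :: "real ^ 'n \<Rightarrow> 'b::comm_monoid_mult"
  shows "(\<Prod>b\<in>Basis. h b) = (\<Prod>i\<in>UNIV. h (axis i (1::real)))"
proof -
  have B: "Basis = (\<lambda>i::'n. axis i (1::real)) ` UNIV" by (auto simp: Basis_vec_def)
  have I: "inj (\<lambda>i::'n. axis i (1::real))" by (auto intro!: injI simp: axis_eq_axis)
  show ?thesis by (subst B, subst prod.reindex[OF I]) (simp add: o_def)
qed

lemma nn_integral_permute_coords:
  fixes g :: "real ^ 'n \<Rightarrow> ennreal" and \<pi> :: "'n \<Rightarrow> 'n"
  assumes [measurable]: "g \<in> borel_measurable borel" and \<pi>: "\<And>i. \<pi> (\<pi> i) = i"
  shows "(\<integral>\<^sup>+x. g (\<chi> i. x $ \<pi> i) \<partial>lborel) = (\<integral>\<^sup>+x. g x \<partial>lborel)"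
proof -
  let ?T = "\<lambda>x::real ^ 'n. (\<chi> i. x $ \<pi> i) :: real ^ 'n"
  have bij: "bij \<pi>" using \<pi> by (metis bijI')
  have [measurable]: "?T \<in> borel_measurable borel"
    by (intro borel_measurable_continuous_onI continuous_intros)
  have "lborel = distr lborel borel ?T"
  proof (rule lborel_eqI)
    fix l u :: "real ^ 'n" assume "\<And>b. b \<in> Basis \<Longrightarrow> l \<bullet> b \<le> u \<bullet> b"
    then have le: "l $ i \<le> u $ i" for i
      by (metis axis_in_Basis_iff cart_eq_inner_axis Basis_real_def insertI1)
    have vim: "?T -` box l u = box (?T l) (?T u)"
      unfolding set_eq_iff vimage_eq mem_box_cart
    proof (intro allI iffI)
      fix x i
      assume "\<forall>i. l $ i < ?T x $ i \<and> ?T x $ i < u $ i"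
      then show "?T l $ i < x $ i \<and> x $ i < ?T u $ i" using \<pi> by (simp, metis)
    next
      fix x i
      assume "\<forall>i. ?T l $ i < x $ i \<and> x $ i < ?T u $ i"
      then show "l $ i < ?T x $ i \<and> ?T x $ i < u $ i" using \<pi> by (simp, metis)
    qed
    have "emeasure (distr lborel borel ?T) (box l u) = emeasure lborel (box (?T l) (?T u))"
      by (subst emeasure_distr) (auto simp: vim)
    also have "\<dots> = ennreal (\<Prod>b\<in>Basis. (?T u - ?T l) \<bullet> b)"
      using le by (intro emeasure_lborel_box) (auto simp: Basis_vec_def inner_axis)
    also have "(\<Prod>b\<in>Basis. (?T u - ?T l) \<bullet> b) = (\<Prod>i\<in>UNIV. (u - l) $ \<pi> i)"
      unfolding prod_Basis_vec by (simp add: inner_axis)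
    also have "\<dots> = (\<Prod>i\<in>UNIV. (u - l) $ i)"
      by (rule prod.reindex_bij_betw[OF bij])
    also have "\<dots> = (\<Prod>b\<in>Basis. (u - l) \<bullet> b)"
      unfolding prod_Basis_vec by (simp add: inner_axis)
    finally show "emeasure (distr lborel borel ?T) (box l u) = ennreal (\<Prod>b\<in>Basis. (u - l) \<bullet> b)" .
  qed simp
  then have "(\<integral>\<^sup>+x. g x \<partial>lborel) = (\<integral>\<^sup>+x. g x \<partial>distr lborel borel ?T)" by simp
  also have "\<dots> = (\<integral>\<^sup>+x. g (?T x) \<partial>lborel)" by (rule nn_integral_distr) auto
  finally show ?thesis by simp
qed

lemma nn_integral_diagonal:
  fixes g :: "real ^ 'n \<Rightarrow> ennreal" and D :: "real ^ 'n ^ 'n"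
  assumes [measurable]: "g \<in> borel_measurable borel"
    and D: "\<And>i j. i \<noteq> j \<Longrightarrow> D $ i $ j = 0" and "det D \<noteq> 0"
  shows "(\<integral>\<^sup>+x. g x \<partial>lborel) = ennreal \<bar>det D\<bar> * (\<integral>\<^sup>+x. g (D *v x) \<partial>lborel)"
proof -
  define c where "c b = (\<Sum>i\<in>UNIV. b $ i * D $ i $ i)" for b :: "real ^ 'n"
  have c: "c (axis i 1) = D $ i $ i" for i
    by (simp add: c_def axis_def if_distrib[of "\<lambda>t. t * _"] cong: if_cong)
  have det: "det D = (\<Prod>i\<in>UNIV. D $ i $ i)" using D by (rule det_diagonal)
  have nz: "c b \<noteq> 0" if "b \<in> Basis" for b
    using that \<open>det D \<noteq> 0\<close> c by (auto simp: Basis_vec_def det)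
  have T: "0 + (\<Sum>j\<in>Basis. (c j * (x \<bullet> j)) *\<^sub>R j) = D *v x" for x
  proof -
    have "(\<Sum>j\<in>Basis. (c j * (x \<bullet> j)) *\<^sub>R j) = (\<Sum>i\<in>UNIV. (D $ i $ i * x $ i) *\<^sub>R axis i 1)"
    proof -
      have B: "Basis = (\<lambda>i::'n. axis i (1::real)) ` UNIV" by (auto simp: Basis_vec_def)
      have I: "inj (\<lambda>i::'n. axis i (1::real))" by (auto intro!: injI simp: axis_eq_axis)
      show ?thesis by (subst B, subst sum.reindex[OF I]) (simp add: o_def c inner_axis)
    qed
    also have "\<dots> = D *v x"
    proof (subst vec_eq_iff, rule allI)
      fix i
      have "(D *v x) $ i = (\<Sum>j\<in>UNIV. if j = i then D $ i $ i * x $ i else 0)"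
        by (subst matrix_vector_mul_component, subst inner_vec_def, rule sum.cong) (use D in auto)
      then show "(\<Sum>i\<in>UNIV. (D $ i $ i * x $ i) *\<^sub>R axis i 1) $ i = (D *v x) $ i"
        by (simp add: axis_def if_distrib[of "\<lambda>t. _ * t"] cong: if_cong)
    qed
    finally show ?thesis by simp
  qed
  have [measurable]: "(*v) D \<in> borel_measurable borel"
    by (intro borel_measurable_continuous_onI) (simp add: continuous_on_eq_continuous_at matrix_vector_mul_linear linear_continuous_at)
  have "(\<integral>\<^sup>+x. g x \<partial>lborel) = (\<integral>\<^sup>+x. g x \<partial>density (distr lborel borel ((*v) D)) (\<lambda>_. (\<Prod>j\<in>Basis. \<bar>c j\<bar>)))"
    by (subst lborel_affine_euclidean[of c 0, unfolded T]) (use nz in auto)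
  also have "(\<Prod>j\<in>Basis. \<bar>c j\<bar>) = \<bar>det D\<bar>"
    unfolding prod_Basis_vec c det by (simp add: abs_prod)
  finally show ?thesis
    by (simp add: nn_integral_density nn_integral_distr nn_integral_cmult)
qed

text \<open>Row reduction gives the formula over every finite index type: the integral is invariant under
  shears and permutations of the coordinates, it scales under diagonal maps, and both sides are
  multiplicative in the matrix.\<close>

proposition nn_integral_matrix:
  fixes g :: "real ^ 'n \<Rightarrow> ennreal" and A :: "real ^ 'n ^ 'n"
  assumes "g \<in> borel_measurable borel" and "det A \<noteq> 0"
  shows "(\<integral>\<^sup>+x. g x \<partial>lborel) = ennreal \<bar>det A\<bar> * (\<integral>\<^sup>+x. g (A *v x) \<partial>lborel)"
  using assms
proof (induction A arbitrary: g rule: induct_matrix_elementary[case_names mult zero_row diagonal swap1 idplus])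
  case (mult A B)
  have [measurable]: "(\<lambda>x. g (A *v x)) \<in> borel_measurable borel"
  proof -
    have [measurable]: "(*v) A \<in> borel_measurable borel"
      by (intro borel_measurable_continuous_onI) (simp add: continuous_on_eq_continuous_at matrix_vector_mul_linear linear_continuous_at)
    show ?thesis using mult.prems(1) by measurable
  qed
  have nz: "det A \<noteq> 0" "det B \<noteq> 0" using mult.prems(2) by (auto simp: det_mul)
  have "(\<integral>\<^sup>+x. g x \<partial>lborel) = ennreal \<bar>det A\<bar> * (\<integral>\<^sup>+x. g (A *v x) \<partial>lborel)"
    using mult nz by blast
  also have "\<dots> = ennreal \<bar>det A\<bar> * (ennreal \<bar>det B\<bar> * (\<integral>\<^sup>+x. g (A *v (B *v x)) \<partial>lborel))"
    by (subst mult.IH(2)) (auto simp: nz)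
  finally show ?case
    by (simp add: det_mul abs_mult ennreal_mult matrix_vector_mul_assoc mult.assoc)
next
  case (zero_row A i)
  then show ?case using det_zero_row(1)[of i A] by (simp add: row_def vec_eq_iff det_zero_row)
next
  case (diagonal A)
  then show ?case by (intro nn_integral_diagonal) auto
next
  case (swap1 m n)
  let ?M = "(\<chi> i j. mat 1 $ i $ Transposition.transpose m n j) :: real ^ 'n ^ 'n"
  have app: "?M *v x = (\<chi> i. x $ Transposition.transpose m n i)" for x
  proof (subst vec_eq_iff, rule allI)
    fix i
    have eq: "i = Transposition.transpose m n j \<longleftrightarrow> j = Transposition.transpose m n i" for j
      by (metis transpose_involutory)
    have "(?M *v x) $ i = (\<Sum>j\<in>UNIV. if j = Transposition.transpose m n i then x $ j else 0)"
      by (subst matrix_vector_mul_component, subst inner_vec_def, rule sum.cong)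
        (auto simp: mat_def eq)
    then show "(?M *v x) $ i = (\<chi> i. x $ Transposition.transpose m n i) $ i" by simp
  qed
  have "\<bar>det ?M\<bar> = 1"
  proof -
    have "det ?M = of_int (sign (Transposition.transpose m n)) * det (mat 1 :: real ^ 'n ^ 'n)"
      by (rule det_permute_columns) (simp add: permutes_swap_id)
    then show ?thesis by (simp add: abs_mult sign_swap_id)
  qed
  then show ?case unfolding app using swap1 by (simp add: nn_integral_permute_coords)
next
  case (idplus m n c)
  let ?M = "(\<chi> i j. if i = m \<and> j = n then c else of_bool (i = j)) :: real ^ 'n ^ 'n"
  have app: "?M *v x = x + (c * x $ n) *\<^sub>R axis m 1" for x
  proof (subst vec_eq_iff, rule allI)
    fix i
    have "(?M *v x) $ i = (\<Sum>j\<in>UNIV. (if j = n then (if i = m then c * x $ n else 0) else 0) + (if j = i then x $ i else 0))"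
      unfolding matrix_vector_mult_def using idplus(1) by (auto intro!: sum.cong)
    then show "(?M *v x) $ i = (x + (c * x $ n) *\<^sub>R axis m 1) $ i"
      by (simp add: sum.distrib axis_def)
  qed
  have row: "?M = (\<chi> i. if i = m then row m (mat 1) + c *s row n (mat 1) else row i (mat 1))"
    using idplus(1) by (auto simp: vec_eq_iff row_def mat_def)
  have "det ?M = det (mat 1 :: real ^ 'n ^ 'n)"
    unfolding row using idplus(1) by (rule det_row_operation)
  then show ?case unfolding app using idplus by (simp add: nn_integral_shear)
qed

section \<open>Norm bounds, and the inequalities of Hoelder and Minkowski\<close>

lemma enn2real_exponent:
  assumes "1 \<le> q" "q \<noteq> \<infinity>"
  shows "1 \<le> enn2real q" "recip q = 1 / enn2real q" "ennreal (enn2real q) = q"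
proof -
  obtain r where r: "q = ennreal r" "1 \<le> r"
    using assms by (cases q) (auto simp: top_ennreal_def[symmetric] simp flip: ennreal_1)
  then show "1 \<le> enn2real q" "ennreal (enn2real q) = q" by auto
  have "1 / q = ennreal (1 / r)"
    unfolding r ennreal_1[symmetric] by (rule divide_ennreal) (use r in auto)
  then show "recip q = 1 / enn2real q" using r by (simp add: recip_def)
qed

lemma recip_nonneg: "0 \<le> recip q"
  by (simp add: recip_def)

lemma recip_le_1: "1 \<le> q \<Longrightarrow> recip q \<le> 1"
  using enn2real_exponent[of q] by (cases "q = \<infinity>") (auto simp: recip_infinity[unfolded infinity_ennreal_def])

text \<open>Splitting at the level \<open>l\<close>: a number is at most \<open>l\<close>, or dominated by its \<open>t\<close>-th power. This replaces
  convexity wherever a constant factor may be lost.\<close>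

lemma truncation_le:
  fixes a l t :: real
  assumes "0 \<le> a" "0 < l" "1 \<le> t"
  shows "a \<le> l + l powr (1 - t) * a powr t"
proof (cases "a \<le> l")
  case True
  then show ?thesis by (simp add: add_increasing2)
next
  case False
  then have "a / l \<le> (a / l) powr t" using assms powr_mono[of 1 t "a / l"] by simp
  then have "a \<le> l * (a / l) powr t" using assms by (simp add: field_simps)
  also have "\<dots> = l powr (1 - t) * a powr t" using assms by (simp add: powr_divide powr_diff)
  finally show ?thesis using assms by linarith
qed

text \<open>The statement \<open>\<parallel>g\<parallel>\<^sub>q \<le> U\<close> in \<open>L\<^sup>q(M)\<close>, for all \<open>q\<close> including \<open>\<infinity>\<close>. Bounds by a real number, unlike the norms
  themselves, need no case distinction for infinite or vanishing norms.\<close>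

definition lp_bound :: "ennreal \<Rightarrow> 'a measure \<Rightarrow> ('a \<Rightarrow> real) \<Rightarrow> real \<Rightarrow> bool" where
  "lp_bound q M g U \<longleftrightarrow> 0 \<le> U \<and> g \<in> borel_measurable M \<and>
     (if q = \<infinity> then AE x in M. \<bar>g x\<bar> \<le> U
      else (\<integral>\<^sup>+x. ennreal (\<bar>g x\<bar> powr enn2real q) \<partial>M) \<le> ennreal (U powr enn2real q))"

lemma lp_bound_measurable: "lp_bound q M g U \<Longrightarrow> g \<in> borel_measurable M"
  and lp_bound_nonneg: "lp_bound q M g U \<Longrightarrow> 0 \<le> U"
  by (auto simp: lp_bound_def)

lemma lp_bound_mono:
  assumes "lp_bound q M g U" "U \<le> V" "h \<in> borel_measurable M" "AE x in M. \<bar>h x\<bar> \<le> \<bar>g x\<bar>"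
  shows "lp_bound q M h V"
proof (cases "q = \<infinity>")
  case True
  have "AE x in M. \<bar>h x\<bar> \<le> V"
    using assms True by (auto simp: lp_bound_def)
  then show ?thesis using assms True by (auto simp: lp_bound_def)
next
  case False
  have "(\<integral>\<^sup>+x. ennreal (\<bar>h x\<bar> powr enn2real q) \<partial>M) \<le> (\<integral>\<^sup>+x. ennreal (\<bar>g x\<bar> powr enn2real q) \<partial>M)"
    by (intro nn_integral_mono_AE) (use assms(4) in \<open>auto intro!: ennreal_leI powr_mono2\<close>)
  also have "\<dots> \<le> ennreal (U powr enn2real q)" using assms(1) False by (simp add: lp_bound_def)
  also have "\<dots> \<le> ennreal (V powr enn2real q)"
    using assms by (auto intro!: ennreal_leI powr_mono2 simp: lp_bound_def)
  finally show ?thesis using assms False by (auto simp: lp_bound_def)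
qed

lemma lp_bound_cmult:
  assumes "lp_bound q M g U"
  shows "lp_bound q M (\<lambda>x. c * g x) (\<bar>c\<bar> * U)"
proof (cases "q = \<infinity>")
  case True
  then show ?thesis using assms
    by (auto simp: lp_bound_def abs_mult intro!: mult_left_mono elim!: AE_mp)
next
  case False
  have [measurable]: "g \<in> borel_measurable M" using assms by (rule lp_bound_measurable)
  have "(\<integral>\<^sup>+x. ennreal (\<bar>c * g x\<bar> powr enn2real q) \<partial>M)
      = ennreal (\<bar>c\<bar> powr enn2real q) * (\<integral>\<^sup>+x. ennreal (\<bar>g x\<bar> powr enn2real q) \<partial>M)"
    by (subst nn_integral_cmult[symmetric]) (auto simp: abs_mult powr_mult ennreal_mult)
  also have "\<dots> \<le> ennreal (\<bar>c\<bar> powr enn2real q) * ennreal (U powr enn2real q)"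
    using assms False by (intro mult_left_mono) (auto simp: lp_bound_def)
  also have "\<dots> = ennreal ((\<bar>c\<bar> * U) powr enn2real q)"
    using assms by (simp add: powr_mult ennreal_mult lp_bound_def)
  finally show ?thesis using assms False by (auto simp: lp_bound_def)
qed

lemma lp_bound_zeroD:
  assumes "lp_bound q M g 0" "1 \<le> q"
  shows "AE x in M. g x = 0"
proof (cases "q = \<infinity>")
  case True
  then show ?thesis using assms by (auto simp: lp_bound_def)
next
  case False
  have [measurable]: "g \<in> borel_measurable M" using assms by (auto simp: lp_bound_def)
  have "(\<integral>\<^sup>+x. ennreal (\<bar>g x\<bar> powr enn2real q) \<partial>M) = 0"
    using assms False by (simp add: lp_bound_def)
  then have "AE x in M. ennreal (\<bar>g x\<bar> powr enn2real q) = 0"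
    by (subst (asm) nn_integral_0_iff_AE) auto
  then show ?thesis by eventually_elim auto
qed

lemma lp_bound_add3:
  assumes "lp_bound q M g1 U" "lp_bound q M g2 U" "lp_bound q M g3 U"
    and q: "1 \<le> q" and [measurable]: "g \<in> borel_measurable M"
    and le: "AE x in M. \<bar>g x\<bar> \<le> \<bar>g1 x\<bar> + \<bar>g2 x\<bar> + \<bar>g3 x\<bar>"
  shows "lp_bound q M g (9 * U)"
proof (cases "q = \<infinity>")
  case True
  have "AE x in M. \<bar>g1 x\<bar> \<le> U" "AE x in M. \<bar>g2 x\<bar> \<le> U" "AE x in M. \<bar>g3 x\<bar> \<le> U"
    using assms True by (auto simp: lp_bound_def)
  then have "AE x in M. \<bar>g x\<bar> \<le> 9 * U" using le by eventually_elim auto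
  then show ?thesis using True assms by (auto simp: lp_bound_def)
next
  case False
  note [measurable] = lp_bound_measurable[OF assms(1)] lp_bound_measurable[OF assms(2)]
    lp_bound_measurable[OF assms(3)]
  define t where "t = enn2real q"
  have t: "1 \<le> t" using enn2real_exponent[OF q False] by (simp add: t_def)
  have U: "0 \<le> U" using assms(1) by (rule lp_bound_nonneg)
  have pw: "\<bar>a\<bar> powr t \<le> 3 powr t * (\<bar>b\<bar> powr t + \<bar>c\<bar> powr t + \<bar>d\<bar> powr t)"
    if "\<bar>a\<bar> \<le> \<bar>b\<bar> + \<bar>c\<bar> + \<bar>d\<bar>" for a b c d :: real
  proof -
    define m where "m = max \<bar>b\<bar> (max \<bar>c\<bar> \<bar>d\<bar>)"
    have "\<bar>a\<bar> \<le> 3 * m" using that unfolding m_def by (simp add: max_def split: if_splits)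
    then have "\<bar>a\<bar> powr t \<le> (3 * m) powr t" using t by (intro powr_mono2) auto
    also have "\<dots> = 3 powr t * m powr t" by (simp add: powr_mult m_def)
    also have "m powr t \<le> \<bar>b\<bar> powr t + \<bar>c\<bar> powr t + \<bar>d\<bar> powr t"
      unfolding m_def max_def by (auto simp: add_nonneg_nonneg)
    finally show ?thesis by simp
  qed
  have "(\<integral>\<^sup>+x. ennreal (\<bar>g x\<bar> powr t) \<partial>M)
     \<le> (\<integral>\<^sup>+x. ennreal (3 powr t) * (ennreal (\<bar>g1 x\<bar> powr t) + ennreal (\<bar>g2 x\<bar> powr t) + ennreal (\<bar>g3 x\<bar> powr t)) \<partial>M)"
  proof (intro nn_integral_mono_AE, use le in eventually_elim)
    fix x assume "\<bar>g x\<bar> \<le> \<bar>g1 x\<bar> + \<bar>g2 x\<bar> + \<bar>g3 x\<bar>"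
    from ennreal_leI[OF pw[OF this]]
    show "ennreal (\<bar>g x\<bar> powr t) \<le> ennreal (3 powr t) * (ennreal (\<bar>g1 x\<bar> powr t) + ennreal (\<bar>g2 x\<bar> powr t) + ennreal (\<bar>g3 x\<bar> powr t))"
      by (simp flip: ennreal_plus ennreal_mult)
  qed
  also have "\<dots> = ennreal (3 powr t) * ((\<integral>\<^sup>+x. ennreal (\<bar>g1 x\<bar> powr t) \<partial>M)
      + (\<integral>\<^sup>+x. ennreal (\<bar>g2 x\<bar> powr t) \<partial>M) + (\<integral>\<^sup>+x. ennreal (\<bar>g3 x\<bar> powr t) \<partial>M))"
    by (simp add: nn_integral_cmult nn_integral_add)
  also have "\<dots> \<le> ennreal (3 powr t) * (ennreal (U powr t) + ennreal (U powr t) + ennreal (U powr t))"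
    using assms(1-3) False by (intro mult_left_mono add_mono) (auto simp: lp_bound_def t_def)
  also have "\<dots> = ennreal (3 * (3 powr t * U powr t))"
    by (simp flip: ennreal_plus ennreal_mult)
  also have "\<dots> \<le> ennreal (3 powr t * (3 powr t * U powr t))"
  proof (intro ennreal_leI mult_right_mono)
    show "3 \<le> 3 powr t" using powr_mono[of 1 t 3] t by simp
  qed simp
  also have "3 powr t * (3 powr t * U powr t) = (9 * U) powr t"
  proof -
    have "(9 * U) powr t = (3 * (3 * U)) powr t" by simp
    also have "\<dots> = 3 powr t * (3 powr t * U powr t)" using U by (simp only: powr_mult mult_nonneg_nonneg)
    finally show ?thesis by simp
  qed
  finally show ?thesis using False U by (auto simp: lp_bound_def t_def)
qed

lemma lp_bound_const:
  assumes "emeasure M (space M) \<le> 1"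
  shows "lp_bound q M (\<lambda>_. c) \<bar>c\<bar>"
  using mult_left_mono[OF assms, of "ennreal (\<bar>c\<bar> powr enn2real q)"] by (auto simp: lp_bound_def)

lemma lp_bound_integral_le:
  assumes M: "emeasure M (space M) \<le> 1" and "lp_bound q M g U" and q: "1 \<le> q"
  shows "(\<integral>\<^sup>+x. ennreal \<bar>g x\<bar> \<partial>M) \<le> ennreal (2 * U)"
proof (cases "q = \<infinity> \<or> U = 0")
  case True
  then have "AE x in M. \<bar>g x\<bar> \<le> U"
    using assms lp_bound_zeroD[of q M g] by (auto simp: lp_bound_def split: if_splits)
  then have "(\<integral>\<^sup>+x. ennreal \<bar>g x\<bar> \<partial>M) \<le> (\<integral>\<^sup>+x. ennreal U \<partial>M)"
    by (intro nn_integral_mono_AE) (auto intro!: ennreal_leI elim!: AE_mp)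
  also have "\<dots> \<le> ennreal U" using mult_left_mono[OF M, of "ennreal U"] by simp
  also have "\<dots> \<le> ennreal (2 * U)" using assms(2) by (auto simp: lp_bound_def intro!: ennreal_leI)
  finally show ?thesis .
next
  case False
  define t where "t = enn2real q"
  have t: "1 \<le> t" using enn2real_exponent[OF q] False by (simp add: t_def)
  have U: "0 < U" using False assms(2) by (auto simp: lp_bound_def)
  note [measurable] = lp_bound_measurable[OF assms(2)]
  have pw: "a \<le> U + U powr (1 - t) * a powr t" if "0 \<le> a" for a
    using truncation_le[OF that U t] .
  have "(\<integral>\<^sup>+x. ennreal \<bar>g x\<bar> \<partial>M) \<le> (\<integral>\<^sup>+x. ennreal U + ennreal (U powr (1 - t)) * ennreal (\<bar>g x\<bar> powr t) \<partial>M)"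
    using U pw by (intro nn_integral_mono) (auto simp flip: ennreal_plus ennreal_mult intro!: ennreal_leI)
  also have "\<dots> = ennreal U * emeasure M (space M) + ennreal (U powr (1 - t)) * (\<integral>\<^sup>+x. ennreal (\<bar>g x\<bar> powr t) \<partial>M)"
    by (simp add: nn_integral_add nn_integral_cmult)
  also have "\<dots> \<le> ennreal U * 1 + ennreal (U powr (1 - t)) * ennreal (U powr t)"
    using M assms(2) False by (intro add_mono mult_left_mono) (auto simp: lp_bound_def t_def)
  also have "\<dots> = ennreal (2 * U)"
    using U by (simp flip: ennreal_plus ennreal_mult powr_add)
  finally show ?thesis .
qed

text \<open>For \<open>q = \<infinity>\<close> the witness is constant and the exponent \<open>t * recip q\<close> vanishes, so that finite and infinite
  exponents can be treated alike in Hoelder's inequality.\<close>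

lemma lp_bound_normalize:
  assumes M: "emeasure M (space M) \<le> 1" and u: "lp_bound q M u U" and U: "0 < U" and q: "1 \<le> q" and t: "0 < t"
  obtains X where "X \<in> borel_measurable M" "\<And>x. 1 \<le> X x"
    "(\<integral>\<^sup>+x. ennreal (X x) \<partial>M) \<le> 2"
    "AE x in M. \<bar>u x\<bar> powr t \<le> U powr t * X x powr (t * recip q)"
proof (cases "q = \<infinity>")
  case True
  have "AE x in M. \<bar>u x\<bar> \<le> U" using u True by (simp add: lp_bound_def)
  then have "AE x in M. \<bar>u x\<bar> powr t \<le> U powr t" by eventually_elim (use t in \<open>auto intro!: powr_mono2\<close>)
  moreover have "emeasure M (space M) \<le> 2" by (rule order_trans[OF M]) simp
  ultimately show ?thesis using M by (intro that[of "\<lambda>_. 1"]) auto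
next
  case False
  define s where "s = enn2real q"
  have s: "1 \<le> s" "recip q = 1 / s" using enn2real_exponent[OF q False] by (auto simp: s_def)
  note [measurable] = lp_bound_measurable[OF u]
  let ?X = "\<lambda>x. max 1 ((\<bar>u x\<bar> / U) powr s)"
  show ?thesis
  proof (rule that[of ?X])
    have "(\<integral>\<^sup>+x. ennreal (?X x) \<partial>M) \<le> (\<integral>\<^sup>+x. 1 + ennreal (U powr (-s)) * ennreal (\<bar>u x\<bar> powr s) \<partial>M)"
      using U by (intro nn_integral_mono)
        (auto simp: max_def powr_divide powr_minus divide_simps simp flip: ennreal_plus ennreal_mult ennreal_1 intro!: ennreal_leI)
    also have "\<dots> = emeasure M (space M) + ennreal (U powr (-s)) * (\<integral>\<^sup>+x. ennreal (\<bar>u x\<bar> powr s) \<partial>M)"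
      by (simp add: nn_integral_add nn_integral_cmult)
    also have "\<dots> \<le> 1 + ennreal (U powr (-s)) * ennreal (U powr s)"
      using M u False by (intro add_mono mult_left_mono) (auto simp: lp_bound_def s_def)
    also have "\<dots> = 2" using U by (simp flip: ennreal_mult powr_add)
    finally show "(\<integral>\<^sup>+x. ennreal (?X x) \<partial>M) \<le> 2" .
    show "AE x in M. \<bar>u x\<bar> powr t \<le> U powr t * ?X x powr (t * recip q)"
    proof (rule AE_I2)
      fix x
      have "(\<bar>u x\<bar> / U) powr t = ((\<bar>u x\<bar> / U) powr s) powr (t * recip q)"
        using s by (simp add: powr_powr)
      also have "\<dots> \<le> ?X x powr (t * recip q)" using t recip_nonneg[of q] by (intro powr_mono2) auto
      finally show "\<bar>u x\<bar> powr t \<le> U powr t * ?X x powr (t * recip q)"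
        using U by (simp add: powr_divide divide_simps mult.commute)
    qed
  qed auto
qed

text \<open>After normalization the product is at most \<open>X^a Y^b Z^c\<close> with \<open>X, Y, Z \<ge> 1\<close> and \<open>a + b + c \<le> 1\<close>, hence at
  most the largest of the three, hence at most their sum.\<close>

lemma lp_bound_Hoelder3:
  assumes M: "emeasure M (space M) \<le> 1" and u: "lp_bound q M u U" and v: "lp_bound q' M v V"
    and \<omega>: "lp_bound (ennreal r) M \<omega> C" and \<omega>0: "\<And>x. 0 \<le> \<omega> x"
    and q: "1 \<le> q" "1 \<le> q'" and r: "1 \<le> r" and t: "0 < t"
    and exps: "t * recip q + t * recip q' + 1 / r \<le> 1"
  shows "(\<integral>\<^sup>+x. ennreal (\<bar>u x * v x\<bar> powr t * \<omega> x) \<partial>M) \<le> ennreal (6 * C * (U * V) powr t)"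
proof (cases "U = 0 \<or> V = 0 \<or> C = 0")
  case True
  have r1: "1 \<le> ennreal r" using r by (simp flip: ennreal_1)
  have "AE x in M. u x = 0 \<or> v x = 0 \<or> \<omega> x = 0"
    using True
  proof (elim disjE)
    assume "U = 0" then show ?thesis using lp_bound_zeroD[of q M u] u q by (auto elim!: AE_mp)
  next
    assume "V = 0" then show ?thesis using lp_bound_zeroD[of q' M v] v q by (auto elim!: AE_mp)
  next
    assume "C = 0" then show ?thesis using lp_bound_zeroD[of "ennreal r" M \<omega>] \<omega> r1 by (auto elim!: AE_mp)
  qed
  then have "(\<integral>\<^sup>+x. ennreal (\<bar>u x * v x\<bar> powr t * \<omega> x) \<partial>M) \<le> (\<integral>\<^sup>+x. 0 \<partial>M)"
    by (intro nn_integral_mono_AE) (auto elim!: AE_mp)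
  then show ?thesis by simp
next
  case False
  then have pos: "0 < U" "0 < V" "0 < C" using lp_bound_nonneg[OF u] lp_bound_nonneg[OF v] lp_bound_nonneg[OF \<omega>] by auto
  have r1: "1 \<le> ennreal r" using r by (simp flip: ennreal_1)
  have rr: "recip (ennreal r) = 1 / r" using enn2real_exponent(2)[OF r1] r by simp
  obtain X where X: "X \<in> borel_measurable M" "\<And>x. 1 \<le> X x" "(\<integral>\<^sup>+x. ennreal (X x) \<partial>M) \<le> 2"
    "AE x in M. \<bar>u x\<bar> powr t \<le> U powr t * X x powr (t * recip q)"
    using lp_bound_normalize[OF M u pos(1) q(1) t] by blast
  obtain Y where Y: "Y \<in> borel_measurable M" "\<And>x. 1 \<le> Y x" "(\<integral>\<^sup>+x. ennreal (Y x) \<partial>M) \<le> 2"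
    "AE x in M. \<bar>v x\<bar> powr t \<le> V powr t * Y x powr (t * recip q')"
    using lp_bound_normalize[OF M v pos(2) q(2) t] by blast
  obtain Z where Z: "Z \<in> borel_measurable M" "\<And>x. 1 \<le> Z x" "(\<integral>\<^sup>+x. ennreal (Z x) \<partial>M) \<le> 2"
    "AE x in M. \<bar>\<omega> x\<bar> powr 1 \<le> C powr 1 * Z x powr (1 * recip (ennreal r))"
    using lp_bound_normalize[OF M \<omega> pos(3) r1 zero_less_one] by blast
  note [measurable] = X(1) Y(1) Z(1)
  let ?K = "C * (U * V) powr t"
  have "AE x in M. \<bar>u x * v x\<bar> powr t * \<omega> x \<le> ?K * (X x + Y x + Z x)"
    using X(4) Y(4) Z(4)
  proof eventually_elim
    fix x
    assume *: "\<bar>u x\<bar> powr t \<le> U powr t * X x powr (t * recip q)"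
      "\<bar>v x\<bar> powr t \<le> V powr t * Y x powr (t * recip q')"
      "\<bar>\<omega> x\<bar> powr 1 \<le> C powr 1 * Z x powr (1 * recip (ennreal r))"
    have 3: "\<omega> x \<le> C * Z x powr (1 / r)" using *(3) \<omega>0[of x] pos by (simp add: rr)
    define m where "m = max (X x) (max (Y x) (Z x))"
    have m: "1 \<le> m" "m \<le> X x + Y x + Z x" using X(2)[of x] Y(2)[of x] Z(2)[of x] by (auto simp: m_def)
    have "\<bar>u x * v x\<bar> powr t * \<omega> x = \<bar>u x\<bar> powr t * \<bar>v x\<bar> powr t * \<omega> x"
      by (simp add: abs_mult powr_mult)
    also have "\<dots> \<le> (U powr t * X x powr (t * recip q)) * (V powr t * Y x powr (t * recip q')) * (C * Z x powr (1 / r))"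
      using * 3 \<omega>0 pos by (intro mult_mono) auto
    also have "\<dots> \<le> (U powr t * m powr (t * recip q)) * (V powr t * m powr (t * recip q')) * (C * m powr (1 / r))"
      using X(2)[of x] Y(2)[of x] Z(2)[of x] recip_nonneg[of q] recip_nonneg[of q'] pos r t
      by (intro mult_mono powr_mono2 mult_nonneg_nonneg) (auto simp: m_def)
    also have "\<dots> = ?K * m powr (t * recip q + t * recip q' + 1 / r)"
      using pos by (simp add: powr_add powr_mult)
    also have "\<dots> \<le> ?K * m powr 1" using exps m pos by (intro mult_left_mono powr_mono) auto
    also have "\<dots> \<le> ?K * (X x + Y x + Z x)" using m pos by (intro mult_left_mono) auto
    finally show "\<bar>u x * v x\<bar> powr t * \<omega> x \<le> ?K * (X x + Y x + Z x)" .
  qed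
  then have "(\<integral>\<^sup>+x. ennreal (\<bar>u x * v x\<bar> powr t * \<omega> x) \<partial>M)
     \<le> (\<integral>\<^sup>+x. ennreal ?K * (ennreal (X x) + ennreal (Y x) + ennreal (Z x)) \<partial>M)"
  proof (intro nn_integral_mono_AE, eventually_elim)
    fix x assume "\<bar>u x * v x\<bar> powr t * \<omega> x \<le> ?K * (X x + Y x + Z x)"
    from ennreal_leI[OF this]
    show "ennreal (\<bar>u x * v x\<bar> powr t * \<omega> x) \<le> ennreal ?K * (ennreal (X x) + ennreal (Y x) + ennreal (Z x))"
      using X(2)[of x] Y(2)[of x] Z(2)[of x] pos by (simp flip: ennreal_plus ennreal_mult)
  qed
  also have "\<dots> = ennreal ?K * ((\<integral>\<^sup>+x. ennreal (X x) \<partial>M) + (\<integral>\<^sup>+x. ennreal (Y x) \<partial>M) + (\<integral>\<^sup>+x. ennreal (Z x) \<partial>M))"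
    by (simp add: nn_integral_cmult nn_integral_add)
  also have "\<dots> \<le> ennreal ?K * (ennreal 2 + ennreal 2 + ennreal 2)"
    using X(3) Y(3) Z(3) by (intro mult_left_mono add_mono) auto
  also have "\<dots> = ennreal (6 * C * (U * V) powr t)"
    using pos by (simp flip: ennreal_plus ennreal_mult del: ennreal_numeral add: mult.commute mult.left_commute)
  finally show ?thesis .
qed

text \<open>The choice \<open>l = T / (2 S)\<close> absorbs the first summand into the left-hand side.\<close>

lemma powr_le_of_scaled_bound:
  fixes T S J t :: real
  assumes t: "1 \<le> t" and S: "0 < S" and T: "0 \<le> T" and J: "0 \<le> J"
    and le: "\<And>l. 0 < l \<Longrightarrow> T \<le> l * S + l powr (1 - t) * J"
  shows "T powr t \<le> (2 * S) powr t / S * J"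
proof (cases "T = 0")
  case True
  then show ?thesis using S J by simp
next
  case False
  define l where "l = T / (2 * S)"
  have l: "0 < l" using False S T by (simp add: l_def)
  have lS: "l * S = T / 2" using S by (simp add: l_def)
  from le[OF l] have "l * S \<le> l powr (1 - t) * J" unfolding lS by simp
  then have "l powr (t - 1) * (l * S) \<le> l powr (t - 1) * (l powr (1 - t) * J)"
    by (intro mult_left_mono) auto
  also have "\<dots> = J" using l by (simp flip: mult.assoc powr_add)
  also have "l powr (t - 1) * (l * S) = l powr t * S" using l by (simp add: powr_diff)
  finally have "l powr t \<le> J / S" using S by (simp add: field_simps)
  moreover have "l powr t = T powr t / (2 * S) powr t" using T S by (simp add: l_def powr_divide)
  ultimately show ?thesis using S by (simp add: field_simps)
qed

text \<open>Minkowski's integral inequality up to the factor 2. With \<open>J x = \<integral> F(x,y)^t N(y)^{1-t} dy\<close>, truncating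
  \<open>F(x,y) / N(y)\<close> at level \<open>l\<close> gives \<open>\<integral> F(x,y) dy \<le> l S + l^{1-t} J x\<close>. Optimizing \<open>l\<close> yields the \<open>t\<close>-th power
  of the integral, and \<open>\<integral> J \<le> S\<close> by Tonelli. Where \<open>N\<close> vanishes, so does \<open>F\<close>, up to null sets.\<close>

lemma lp_bound_Minkowski:
  assumes "sigma_finite_measure M" "sigma_finite_measure Y"
    and F[measurable]: "(\<lambda>(x, y). F x y) \<in> borel_measurable (M \<Otimes>\<^sub>M Y)" and F0: "\<And>x y. 0 \<le> F x y"
    and N[measurable]: "N \<in> borel_measurable Y"
    and bd: "AE y in Y. lp_bound q M (\<lambda>x. F x y) (N y)" and q: "1 \<le> q"
    and S: "(\<integral>\<^sup>+y. ennreal (N y) \<partial>Y) \<le> ennreal S" "0 \<le> S"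
  shows "(AE x in M. (\<integral>\<^sup>+y. ennreal (F x y) \<partial>Y) < \<infinity>) \<and>
    lp_bound q M (\<lambda>x. enn2real (\<integral>\<^sup>+y. ennreal (F x y) \<partial>Y)) (2 * S)"
proof -
  interpret M: sigma_finite_measure M by fact
  interpret Y: sigma_finite_measure Y by fact
  interpret pair_sigma_finite M Y ..
  let ?h = "\<lambda>x. \<integral>\<^sup>+y. ennreal (F x y) \<partial>Y"
  have [measurable]: "?h \<in> borel_measurable M" by measurable
  have N0: "AE y in Y. 0 \<le> N y" using bd by eventually_elim (rule lp_bound_nonneg)
  show ?thesis
  proof (cases "q = \<infinity>")
    case True
    have "AE y in Y. AE x in M. F x y \<le> N y"
      using bd by eventually_elim (use F0 True in \<open>auto simp: lp_bound_def\<close>)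
    then have "AE x in M. AE y in Y. F x y \<le> N y" by (subst AE_commute) measurable
    then have "AE x in M. ?h x \<le> ennreal S"
    proof eventually_elim
      fix x assume "AE y in Y. F x y \<le> N y"
      then have "?h x \<le> (\<integral>\<^sup>+y. ennreal (N y) \<partial>Y)"
        by (intro nn_integral_mono_AE) (auto elim!: AE_mp intro!: ennreal_leI)
      then show "?h x \<le> ennreal S" using S by simp
    qed
    then have "AE x in M. ?h x < \<infinity> \<and> enn2real (?h x) \<le> 2 * S"
    proof eventually_elim
      fix x assume "?h x \<le> ennreal S"
      then show "?h x < \<infinity> \<and> enn2real (?h x) \<le> 2 * S"
        using enn2real_mono[of "?h x" "ennreal S"] S by (auto simp: order_le_less_trans)
    qed
    then show ?thesis using True S by (auto simp: lp_bound_def elim!: AE_mp)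
  next
    case False
    define t where "t = enn2real q"
    have t: "1 \<le> t" using enn2real_exponent[OF q False] by (simp add: t_def)
    let ?j = "\<lambda>x y. F x y powr t * N y powr (1 - t)"
    define J where "J x = (\<integral>\<^sup>+y. ennreal (?j x y) \<partial>Y)" for x
    have [measurable]: "J \<in> borel_measurable M" unfolding J_def by measurable
    have Ft: "AE y in Y. (\<integral>\<^sup>+x. ennreal (F x y powr t) \<partial>M) \<le> ennreal (N y powr t)"
      using bd by eventually_elim (use False F0 in \<open>auto simp: lp_bound_def t_def\<close>)
    have "(\<integral>\<^sup>+x. J x \<partial>M) = (\<integral>\<^sup>+y. (\<integral>\<^sup>+x. ennreal (?j x y) \<partial>M) \<partial>Y)"
      unfolding J_def by (rule Fubini'[symmetric]) measurable
    also have "\<dots> \<le> (\<integral>\<^sup>+y. ennreal (N y) \<partial>Y)"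
    proof (rule nn_integral_mono_AE, use Ft N0 AE_space in eventually_elim)
      fix y assume *: "(\<integral>\<^sup>+x. ennreal (F x y powr t) \<partial>M) \<le> ennreal (N y powr t)" "0 \<le> N y" "y \<in> space Y"
      then have [measurable]: "(\<lambda>x. F x y) \<in> borel_measurable M" by measurable
      have "(\<integral>\<^sup>+x. ennreal (?j x y) \<partial>M) = (\<integral>\<^sup>+x. ennreal (N y powr (1 - t)) * ennreal (F x y powr t) \<partial>M)"
        by (simp add: ennreal_mult mult.commute)
      also have "\<dots> = ennreal (N y powr (1 - t)) * (\<integral>\<^sup>+x. ennreal (F x y powr t) \<partial>M)"
        by (rule nn_integral_cmult) measurable
      also have "\<dots> \<le> ennreal (N y powr (1 - t)) * ennreal (N y powr t)"
        using * by (intro mult_left_mono) auto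
      also have "\<dots> = ennreal (N y)" using *(2) by (simp flip: ennreal_mult powr_add)
      finally show "(\<integral>\<^sup>+x. ennreal (?j x y) \<partial>M) \<le> ennreal (N y)" .
    qed
    finally have JS: "(\<integral>\<^sup>+x. J x \<partial>M) \<le> ennreal S" using S(1) by simp
    then have Jfin: "AE x in M. J x \<noteq> \<infinity>"
      by (intro nn_integral_noteq_infinite) (auto simp: top_unique)
    have "AE y in Y. AE x in M. N y = 0 \<longrightarrow> F x y = 0"
      using bd
    proof eventually_elim
      fix y assume "lp_bound q M (\<lambda>x. F x y) (N y)"
      then show "AE x in M. N y = 0 \<longrightarrow> F x y = 0"
        using lp_bound_zeroD[of q M "\<lambda>x. F x y"] q by (cases "N y = 0") auto
    qed
    then have null: "AE x in M. AE y in Y. N y = 0 \<longrightarrow> F x y = 0" by (subst AE_commute) measurable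
    have pw: "a \<le> l * n + l powr (1 - t) * (a powr t * n powr (1 - t))"
      if "0 \<le> a" "0 \<le> n" "n = 0 \<longrightarrow> a = 0" "0 < l" for a n l :: real
    proof (cases "n = 0")
      case False
      then have "0 < l * n" using that by simp
      from truncation_le[OF that(1) this t] show ?thesis using that by (simp add: powr_mult mult_ac)
    qed (use that in simp)
    have hl: "?h x \<le> ennreal l * ennreal S + ennreal (l powr (1 - t)) * J x"
      if x: "AE y in Y. N y = 0 \<longrightarrow> F x y = 0" "x \<in> space M" and l: "0 < l" for x l
    proof -
      have [measurable]: "(\<lambda>y. F x y) \<in> borel_measurable Y" using x(2) by measurable
      have "?h x \<le> (\<integral>\<^sup>+y. ennreal l * ennreal (N y) + ennreal (l powr (1 - t)) * ennreal (?j x y) \<partial>Y)"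
      proof (rule nn_integral_mono_AE, use x(1) N0 in eventually_elim)
        fix y assume "N y = 0 \<longrightarrow> F x y = 0" "0 \<le> N y"
        from ennreal_leI[OF pw[OF F0 this(2,1) l]] this
        show "ennreal (F x y) \<le> ennreal l * ennreal (N y) + ennreal (l powr (1 - t)) * ennreal (?j x y)"
          using l by (simp flip: ennreal_plus ennreal_mult)
      qed
      also have "\<dots> = ennreal l * (\<integral>\<^sup>+y. ennreal (N y) \<partial>Y) + ennreal (l powr (1 - t)) * J x"
        unfolding J_def by (simp add: nn_integral_add nn_integral_cmult)
      also have "\<dots> \<le> ennreal l * ennreal S + ennreal (l powr (1 - t)) * J x"
        using S(1) by (intro add_mono mult_left_mono) auto
      finally show ?thesis .
    qed
    have fin: "AE x in M. ?h x < \<infinity>"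
      using null Jfin AE_space
    proof eventually_elim
      fix x assume "AE y in Y. N y = 0 \<longrightarrow> F x y = 0" "J x \<noteq> \<infinity>" "x \<in> space M"
      with hl[of x 1] show "?h x < \<infinity>"
        by (auto simp: order_le_less_trans ennreal_add_less_top less_top)
    qed
    have key: "AE x in M. enn2real (?h x) powr t \<le> (2 * S) powr t / S * enn2real (J x)" if "0 < S"
      using null Jfin fin AE_space
    proof eventually_elim
      fix x assume *: "AE y in Y. N y = 0 \<longrightarrow> F x y = 0" "J x \<noteq> \<infinity>" "?h x < \<infinity>" "x \<in> space M"
      show "enn2real (?h x) powr t \<le> (2 * S) powr t / S * enn2real (J x)"
      proof (rule powr_le_of_scaled_bound[OF t that])
        fix l :: real assume l: "0 < l"
        have "ennreal (enn2real (?h x)) = ?h x" using * by (intro ennreal_enn2real) auto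
        also have "\<dots> \<le> ennreal l * ennreal S + ennreal (l powr (1 - t)) * ennreal (enn2real (J x))"
          using hl[OF *(1,4) l] *(2) by (simp add: less_top)
        also have "\<dots> = ennreal (l * S + l powr (1 - t) * enn2real (J x))"
          using l S by (simp flip: ennreal_plus ennreal_mult)
        finally show "enn2real (?h x) \<le> l * S + l powr (1 - t) * enn2real (J x)"
          using l S by (subst (asm) ennreal_le_iff) auto
      qed auto
    qed
    have "(\<integral>\<^sup>+x. ennreal (enn2real (?h x) powr t) \<partial>M) \<le> ennreal ((2 * S) powr t)"
    proof (cases "S = 0")
      case True
      then have "AE x in M. J x = 0" using JS by (simp add: nn_integral_0_iff_AE)
      then have "AE x in M. ?h x = 0"
        using null AE_space
      proof eventually_elim
        fix x assume "J x = 0" "AE y in Y. N y = 0 \<longrightarrow> F x y = 0" "x \<in> space M"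
        with hl[of x 1] True show "?h x = 0" by auto
      qed
      then have "(\<integral>\<^sup>+x. ennreal (enn2real (?h x) powr t) \<partial>M) = (\<integral>\<^sup>+x. 0 \<partial>M)"
        by (intro nn_integral_cong_AE) (auto elim!: AE_mp)
      then show ?thesis by simp
    next
      case False
      with S have S0: "0 < S" by simp
      have "(\<integral>\<^sup>+x. ennreal (enn2real (?h x) powr t) \<partial>M) \<le> (\<integral>\<^sup>+x. ennreal ((2 * S) powr t / S) * J x \<partial>M)"
      proof (rule nn_integral_mono_AE, use key[OF S0] Jfin in eventually_elim)
        fix x assume *: "enn2real (?h x) powr t \<le> (2 * S) powr t / S * enn2real (J x)" "J x \<noteq> \<infinity>"
        have "ennreal (enn2real (?h x) powr t) \<le> ennreal ((2 * S) powr t / S) * ennreal (enn2real (J x))"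
          using ennreal_leI[OF *(1)] S0 by (subst (asm) ennreal_mult) auto
        then show "ennreal (enn2real (?h x) powr t) \<le> ennreal ((2 * S) powr t / S) * J x"
          using *(2) by (simp add: less_top)
      qed
      also have "\<dots> = ennreal ((2 * S) powr t / S) * (\<integral>\<^sup>+x. J x \<partial>M)" by (rule nn_integral_cmult) measurable
      also have "\<dots> \<le> ennreal ((2 * S) powr t / S) * ennreal S" using JS by (intro mult_left_mono) auto
      also have "\<dots> = ennreal ((2 * S) powr t)" using S0 by (simp flip: ennreal_mult)
      finally show ?thesis .
    qed
    then have "lp_bound q M (\<lambda>x. enn2real (?h x)) (2 * S)"
      using False S by (auto simp: lp_bound_def t_def)
    then show ?thesis using fin by simp
  qed
qed

section \<open>The homogeneous norm and its balls\<close>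

lemma hnorm_nonneg [simp]: "0 \<le> hnorm x"
  by (simp add: hnorm_def)

lemma hnorm_pow4: "hnorm x ^ 4 = (\<Sum>j\<in>UNIV. (x $ Inl j)\<^sup>2 + (x $ Inr (Inl j))\<^sup>2)\<^sup>2 + (x $ Inr (Inr ()))\<^sup>2"
  unfolding hnorm_def by (rule real_root_pow_pos2) auto

lemma hnorm_coords:
  shows "(x $ Inl j)\<^sup>2 \<le> (hnorm x)\<^sup>2" "(x $ Inr (Inl j))\<^sup>2 \<le> (hnorm x)\<^sup>2" "\<bar>x $ Inr (Inr u)\<bar> \<le> (hnorm x)\<^sup>2"
proof -
  let ?s = "\<Sum>j\<in>UNIV. (x $ Inl j)\<^sup>2 + (x $ Inr (Inl j))\<^sup>2"
  have s: "0 \<le> ?s" by (intro sum_nonneg) auto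
  have eq: "((hnorm x)\<^sup>2)\<^sup>2 = ?s\<^sup>2 + (x $ Inr (Inr ()))\<^sup>2"
    using hnorm_pow4[of x] by (simp flip: power_mult)
  have "?s\<^sup>2 \<le> ((hnorm x)\<^sup>2)\<^sup>2" unfolding eq by simp
  then have le: "?s \<le> (hnorm x)\<^sup>2" by (rule power2_le_imp_le) simp
  have "(x $ Inl j)\<^sup>2 + (x $ Inr (Inl j))\<^sup>2 \<le> ?s"
    by (rule member_le_sum[of j UNIV "\<lambda>j. (x $ Inl j)\<^sup>2 + (x $ Inr (Inl j))\<^sup>2"]) auto
  then show "(x $ Inl j)\<^sup>2 \<le> (hnorm x)\<^sup>2" "(x $ Inr (Inl j))\<^sup>2 \<le> (hnorm x)\<^sup>2"
    using le zero_le_power2[of "x $ Inl j"] zero_le_power2[of "x $ Inr (Inl j)"] by linarith+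
  have "\<bar>x $ Inr (Inr u)\<bar>\<^sup>2 \<le> ((hnorm x)\<^sup>2)\<^sup>2" unfolding eq by simp
  then show "\<bar>x $ Inr (Inr u)\<bar> \<le> (hnorm x)\<^sup>2" by (rule power2_le_imp_le) simp
qed

lemma hnorm_eq_0_iff [simp]: "hnorm x = 0 \<longleftrightarrow> x = 0"
proof
  assume 0: "hnorm x = 0"
  show "x = 0" by (rule heis_eqI) (use hnorm_coords[of x] in \<open>auto simp: 0\<close>)
next
  assume "x = 0" then show "hnorm x = 0" by (simp add: hnorm_def)
qed

lemma hnorm_zero [simp]: "hnorm 0 = 0"
  by simp

lemma hnorm_uminus [simp]: "hnorm (- x) = hnorm x"
  by (simp add: hnorm_def)

lemma continuous_on_hnorm [continuous_intros]: "continuous_on S (hnorm :: 'n::finite heis \<Rightarrow> real)"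
  unfolding hnorm_def by (intro continuous_intros)

lemma borel_measurable_hnorm [measurable]: "hnorm \<in> borel_measurable borel"
  by (intro borel_measurable_continuous_onI continuous_intros)

lemma compact_hnorm_le: "compact {x :: 'n::finite heis. hnorm x \<le> r}"
proof -
  have "closed {x :: 'n heis. hnorm x \<le> r}"
    by (intro closed_Collect_le continuous_on_hnorm continuous_on_const)
  moreover have "bounded {x :: 'n heis. hnorm x \<le> r}"
  proof (rule boundedI)
    have coord: "\<bar>x $ i\<bar> \<le> \<bar>r\<bar> + r\<^sup>2" if "hnorm x \<le> r" for x :: "'n heis" and i :: "'n + 'n + unit"
    proof -
      have r: "\<bar>hnorm x\<bar> \<le> \<bar>r\<bar>" "(hnorm x)\<^sup>2 \<le> r\<^sup>2" using that hnorm_nonneg[of x] by (auto intro!: power_mono)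
      show ?thesis
      proof (cases i)
        case (Inl j)
        then have "\<bar>x $ i\<bar> \<le> \<bar>hnorm x\<bar>" using hnorm_coords(1)[of x j] by (simp only: abs_le_square_iff)
        then show ?thesis using r by (simp add: add_increasing2)
      next
        case (Inr i')
        show ?thesis
        proof (cases i')
          case (Inl j)
          then have "\<bar>x $ i\<bar> \<le> \<bar>hnorm x\<bar>" using Inr hnorm_coords(2)[of x j] by (simp only: abs_le_square_iff)
          then show ?thesis using r by (simp add: add_increasing2)
        next
          case (Inr u)
          then show ?thesis using \<open>i = Inr i'\<close> hnorm_coords(3)[of x u] r by simp
        qed
      qed
    qed
    fix x :: "'n heis" assume "x \<in> {x. hnorm x \<le> r}"
    then have "(\<Sum>i\<in>UNIV. \<bar>x $ i\<bar>) \<le> (\<Sum>i\<in>(UNIV :: ('n + 'n + unit) set). \<bar>r\<bar> + r\<^sup>2)"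
      by (intro sum_mono coord) simp
    with norm_le_l1_cart[of x] show "norm x \<le> (\<Sum>i\<in>(UNIV :: ('n + 'n + unit) set). \<bar>r\<bar> + r\<^sup>2)"
      by linarith
  qed
  ultimately show ?thesis by (simp add: compact_eq_bounded_closed)
qed

lemma hball_0: "hball 0 r = {x. hnorm x < r}"
  by (simp add: hball_def hdist_def hmul_zero)

lemma dball_eq_hball: "dball k = hball 0 (2 powi k)"
  by (simp add: dball_def hball_0)

lemma open_dball [simp]: "open (dball k :: 'n::finite heis set)"
  unfolding dball_def by (intro open_Collect_less continuous_on_hnorm continuous_on_const)

lemma sets_dball [measurable]: "dball k \<in> sets borel"
  using borel_open[OF open_dball] .

lemma sets_dshell [measurable]: "dshell k \<in> sets borel"
  unfolding dshell_def by measurable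

lemma dball_mono: "k \<le> l \<Longrightarrow> dball k \<subseteq> dball l"
  unfolding dball_def using power_int_increasing[of k l "2::real"] by auto

lemma dshell_subset: "dshell k \<subseteq> dball k"
  by (auto simp: dshell_def)

lemma zero_in_dball [simp]: "0 \<in> dball k"
  by (simp add: dball_def)

definition vol :: "'n::finite itself \<Rightarrow> int \<Rightarrow> real" where
  "vol _ k = measure lebesgue (dball k :: 'n heis set)"

abbreviation Qdim :: "'n::finite itself \<Rightarrow> real" where
  "Qdim T \<equiv> real (hom_dim T)"

lemma Qdim_pos: "0 < Qdim T"
  by (simp add: hom_dim_def)

text \<open>The automorphic dilation of the group, for which the homogeneous norm has degree 1; its determinant
  is the reason for the homogeneous dimension.\<close>

definition dilation :: "real \<Rightarrow> real ^ ('n + 'n + unit) ^ ('n::finite + 'n + unit)" where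
  "dilation l = (\<chi> i j. if i = j then (case i of Inr (Inr u) \<Rightarrow> l\<^sup>2 | _ \<Rightarrow> l) else 0)"

lemma dilation_nth:
  "(dilation l *v x) $ i = (case i of Inr (Inr u) \<Rightarrow> l\<^sup>2 | _ \<Rightarrow> l) * x $ i"
  by (simp add: matrix_vector_mult_def dilation_def if_distrib[of "\<lambda>t. t * _"] cong: if_cong)

lemma hnorm_dilation: "0 \<le> l \<Longrightarrow> hnorm (dilation l *v x) = l * hnorm x"
proof -
  assume l: "0 \<le> l"
  have "hnorm (dilation l *v x) ^ 4 = (l * hnorm x) ^ 4"
    by (simp add: hnorm_pow4 dilation_nth power_mult_distrib flip: distrib_left sum_distrib_left)
  then show ?thesis using l by (subst (asm) power_eq_iff_eq_base) auto
qed

lemma det_dilation: "det (dilation l :: real ^ ('n + 'n + unit) ^ ('n::finite + 'n + unit)) = l ^ hom_dim TYPE('n)"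
proof -
  let ?c = "\<lambda>i :: 'n + 'n + unit. (case i of Inr (Inr u) \<Rightarrow> l\<^sup>2 | _ \<Rightarrow> l)"
  have "det (dilation l :: real ^ ('n + 'n + unit) ^ ('n + 'n + unit)) = (\<Prod>i\<in>UNIV. ?c i)"
    by (subst det_diagonal) (auto simp: dilation_def)
  also have "(UNIV :: ('n + 'n + unit) set) = UNIV <+> (UNIV <+> UNIV)"
    by (simp add: UNIV_Plus_UNIV)
  also have "(\<Prod>i\<in>(UNIV :: 'n set) <+> ((UNIV :: 'n set) <+> (UNIV :: unit set)). ?c i) = l ^ hom_dim TYPE('n)"
    by (simp add: prod.Plus hom_dim_def power2_eq_square power_add mult_2 del: UNIV_Plus_UNIV)
  finally show ?thesis .
qed

lemma emeasure_dball_scale: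
  "emeasure lborel (dball k :: 'n::finite heis set)
     = ennreal (2 powr (of_int k * Qdim TYPE('n))) * emeasure lborel (dball 0 :: 'n heis set)"
proof -
  let ?l = "2 powi k :: real"
  let ?D = "dilation ?l :: real ^ ('n + 'n + unit) ^ ('n + 'n + unit)"
  have det: "det ?D = 2 powr (of_int k * Qdim TYPE('n))"
    by (simp add: det_dilation powr_realpow[symmetric] powr_powr flip: powr_real_of_int')
  have ind: "indicator (dball k) (?D *v x) = (indicator (dball 0) x :: ennreal)" for x
    by (auto simp: dball_def hnorm_dilation indicator_def)
  have "emeasure lborel (dball k :: 'n heis set) = (\<integral>\<^sup>+x. indicator (dball k :: 'n heis set) x \<partial>lborel)"
    by (subst nn_integral_indicator) auto
  also have "\<dots> = ennreal \<bar>det ?D\<bar> * (\<integral>\<^sup>+x. indicator (dball k) (?D *v x) \<partial>lborel)"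
    by (rule nn_integral_matrix) (auto simp: det)
  also have "(\<integral>\<^sup>+x. indicator (dball k) (?D *v x) \<partial>lborel) = emeasure lborel (dball 0 :: 'n heis set)"
    unfolding ind by (subst nn_integral_indicator) auto
  finally show ?thesis by (simp add: det)
qed

lemma emeasure_dball_finite: "emeasure lborel (dball k :: 'n::finite heis set) < \<infinity>"
proof -
  have "emeasure lborel (dball k :: 'n heis set) \<le> emeasure lborel {x :: 'n heis. hnorm x \<le> 2 powi k}"
    by (rule emeasure_mono) (auto simp: dball_def)
  also have "\<dots> < \<infinity>" using emeasure_compact_finite[OF compact_hnorm_le] by simp
  finally show ?thesis .
qed

lemma emeasure_dball: "emeasure lebesgue (dball k :: 'n::finite heis set) = ennreal (vol TYPE('n) k)"
  unfolding vol_def using emeasure_dball_finite[of k, where 'n='n]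
  by (subst emeasure_eq_ennreal_measure) auto

lemma vol_pos: "0 < vol TYPE('n::finite) k"
proof -
  have "open (dball k :: 'n heis set)" "(0 :: 'n heis) \<in> dball k" by auto
  then have "emeasure lborel (dball k :: 'n heis set) \<noteq> 0"
    using open_not_negligible[of "dball k :: 'n heis set"]
    by (auto simp: negligible_iff_null_sets null_sets_def simp del: zero_in_dball)
  then have "ennreal (vol TYPE('n) k) \<noteq> 0" by (simp flip: emeasure_dball)
  then show ?thesis using measure_nonneg[of lebesgue "dball k :: 'n heis set"]
    by (auto simp: vol_def less_le)
qed

lemma vol_add: "vol TYPE('n::finite) (k + j) = 2 powr (of_int j * Qdim TYPE('n)) * vol TYPE('n) k"
proof -
  have *: "vol TYPE('n) i = 2 powr (of_int i * Qdim TYPE('n)) * vol TYPE('n) 0" for i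
  proof -
    have "ennreal (vol TYPE('n) i) = ennreal (2 powr (of_int i * Qdim TYPE('n))) * ennreal (vol TYPE('n) 0)"
      using emeasure_dball_scale[of i, where 'n='n] by (simp flip: emeasure_dball)
    then show ?thesis using vol_pos[of i, where 'n='n] vol_pos[of 0, where 'n='n]
      by (simp flip: ennreal_mult)
  qed
  show ?thesis unfolding *[of "k + j"] *[of k] by (simp add: powr_add distrib_right)
qed

section \<open>The operator norm\<close>

lemma continuous_on_matrix_vector: "continuous_on S (\<lambda>p. fst p *v snd p :: real ^ 'n)"
  for S :: "((real ^ 'm ^ 'n) \<times> (real ^ 'm)) set"
  unfolding matrix_vector_mult_def by (intro continuous_intros)

lemma measurable_matrix_vector [measurable (raw)]:
  fixes A :: "'a \<Rightarrow> real ^ 'm ^ 'n"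
  assumes "A \<in> borel_measurable M" "x \<in> borel_measurable M"
  shows "(\<lambda>t. A t *v x t) \<in> borel_measurable M"
  by (rule borel_measurable_continuous_Pair[OF assms]) (rule continuous_on_matrix_vector)

lemma continuous_on_det: "continuous_on S (det :: real ^ 'n ^ 'n \<Rightarrow> real)"
  unfolding det_def by (intro continuous_intros)

lemma measurable_det [measurable]: "(det :: real ^ 'n ^ 'n \<Rightarrow> real) \<in> borel_measurable borel"
  by (intro borel_measurable_continuous_onI continuous_on_det)

text \<open>A supremum of continuous functions is lower semicontinuous.\<close>

lemma measurable_mat_hnorm [measurable]:
  "(mat_hnorm :: real ^ ('n + 'n + unit) ^ ('n::finite + 'n + unit) \<Rightarrow> ennreal) \<in> borel_measurable borel"
proof (rule borel_measurableI_greater)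
  fix c :: ennreal
  let ?f = "\<lambda>x (M :: real ^ ('n + 'n + unit) ^ ('n + 'n + unit)). ennreal (hnorm (M *v x) / hnorm x)"
  have "continuous_on UNIV (?f x)" if "x \<noteq> 0" for x
  proof -
    have "continuous_on UNIV (\<lambda>M. hnorm ((M :: real ^ ('n + 'n + unit) ^ ('n + 'n + unit)) *v x))"
      by (rule continuous_on_compose2[OF continuous_on_hnorm[of UNIV]])
         (auto simp: matrix_vector_mult_def intro!: continuous_intros)
    then show ?thesis
      by (intro continuous_on_ennreal continuous_on_divide continuous_on_const) (use that in auto)
  qed
  then have "open {M. c < ?f x M}" if "x \<noteq> 0" for x
    using that by (intro open_Collect_less continuous_on_const) auto
  then have "open (\<Union>x\<in>- {0}. {M. c < ?f x M})" by auto
  also have "(\<Union>x\<in>- {0}. {M. c < ?f x M}) = {M \<in> space borel. c < mat_hnorm M}"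
    by (auto simp: mat_hnorm_def less_SUP_iff)
  finally have "open \<dots>" .
  then show "{M \<in> space borel. c < mat_hnorm M} \<in> sets (borel :: (real ^ ('n + 'n + unit) ^ ('n + 'n + unit)) measure)"
    by (rule borel_open)
qed

lemma hnorm_matrix_le:
  assumes "mat_hnorm A < \<infinity>"
  shows "hnorm (A *v x) \<le> enn2real (mat_hnorm A) * hnorm x"
proof (cases "x = 0")
  case False
  have "ennreal (hnorm (A *v x) / hnorm x) \<le> mat_hnorm A"
    unfolding mat_hnorm_def using False by (intro SUP_upper) auto
  also have "\<dots> = ennreal (enn2real (mat_hnorm A))" using assms by (simp add: less_top)
  finally have "hnorm (A *v x) / hnorm x \<le> enn2real (mat_hnorm A)" by simp
  moreover have "0 < hnorm x" using False hnorm_nonneg[of x] by (simp add: less_le)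
  ultimately show ?thesis by (simp add: divide_simps)
qed simp

lemma mat_hnorm_pos:
  assumes "det A \<noteq> 0"
  shows "0 < mat_hnorm A"
proof -
  let ?x = "axis (Inl undefined) 1 :: 'a heis"
  have x: "?x \<noteq> 0" by (simp add: axis_eq_0_iff)
  have "A *v ?x \<noteq> 0"
    using assms x by (metis invertible_det_nz matrix_left_invertible_ker invertible_left_inverse)
  then have "0 < hnorm (A *v ?x) / hnorm ?x"
    using x hnorm_nonneg by (metis divide_pos_pos hnorm_eq_0_iff less_eq_real_def)
  then have "0 < ennreal (hnorm (A *v ?x) / hnorm ?x)" by simp
  also have "\<dots> \<le> mat_hnorm A" unfolding mat_hnorm_def using x by (intro SUP_upper) auto
  finally show ?thesis .
qed

lemma dball_matrix:
  assumes "mat_hnorm A < \<infinity>" "enn2real (mat_hnorm A) \<le> 2 powi j" "x \<in> dball k"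
  shows "A *v x \<in> dball (k + j)"
proof -
  have "hnorm (A *v x) \<le> 2 powi j * hnorm x"
    using hnorm_matrix_le[OF assms(1), of x] mult_right_mono[OF assms(2), of "hnorm x"] by simp
  also have "\<dots> < 2 powi j * 2 powi k" using assms(3) by (auto simp: dball_def)
  finally show ?thesis by (simp add: dball_def power_int_add mult.commute)
qed

lemma AE_matrix:
  fixes A :: "real ^ 'n ^ 'n"
  assumes "AE y in lborel. P y" "det A \<noteq> 0"
  shows "AE x in lborel. P (A *v x)"
proof -
  obtain N where N: "{y \<in> space lborel. \<not> P y} \<subseteq> N" "emeasure lborel N = 0" "N \<in> sets lborel"
    using assms(1) by (rule AE_E)
  then have [measurable]: "N \<in> sets borel" by simp
  have "0 = (\<integral>\<^sup>+y. indicator N y \<partial>lborel)" using N by simp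
  also have "\<dots> = ennreal \<bar>det A\<bar> * (\<integral>\<^sup>+x. indicator N (A *v x) \<partial>lborel)"
    using assms(2) by (intro nn_integral_matrix) measurable
  finally have "(\<integral>\<^sup>+x. indicator N (A *v x) \<partial>lborel) = 0" using assms(2) by auto
  then have "AE x in lborel. indicator N (A *v x) = (0::ennreal)"
    by (subst (asm) nn_integral_0_iff_AE) measurable
  then show ?thesis by eventually_elim (use N in \<open>auto simp: indicator_def split: if_splits\<close>)
qed

text \<open>Normalized Lebesgue measure on \<open>B\<^sub>k\<close>, so that integrals against it are means.\<close>

definition Lavg :: "int \<Rightarrow> 'n::finite heis measure" where
  "Lavg k = uniform_measure lebesgue (dball k)"

lemma Lavg_space_sets [simp, measurable_cong]:
  "sets (Lavg k) = sets lebesgue" and space_Lavg [simp]: "space (Lavg k) = UNIV"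
  by (simp_all add: Lavg_def uniform_measure_def)

lemma emeasure_dball_bounds:
  "emeasure lebesgue (dball k :: 'n::finite heis set) \<noteq> 0"
  "emeasure lebesgue (dball k :: 'n::finite heis set) \<noteq> \<infinity>"
  "emeasure lebesgue (dball k :: 'n::finite heis set) < \<infinity>"
  using vol_pos[of k, where 'n='n] unfolding emeasure_dball by auto

lemma emeasure_Lavg: "emeasure (Lavg k :: 'n::finite heis measure) (space (Lavg k)) \<le> 1"
proof -
  have "emeasure (Lavg k :: 'n heis measure) UNIV
      = emeasure lebesgue ((dball k :: 'n heis set) \<inter> UNIV) / emeasure lebesgue (dball k :: 'n heis set)"
    unfolding Lavg_def by (rule emeasure_uniform_measure) auto
  also have "\<dots> = 1"
    using emeasure_dball_bounds[of k, where 'n='n] unfolding Int_UNIV_right infinity_ennreal_def by (intro ennreal_divide_self)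
  finally show ?thesis by simp
qed

lemma nn_integral_Lavg:
  assumes "g \<in> borel_measurable lebesgue"
  shows "(\<integral>\<^sup>+x. g x \<partial>(Lavg k :: 'n::finite heis measure))
    = ennreal (1 / vol TYPE('n) k) * (\<integral>\<^sup>+x. g x * indicator (dball k) x \<partial>lebesgue)"
  unfolding Lavg_def using vol_pos[of k, where 'n='n] assms
  by (subst nn_integral_uniform_measure)
     (auto simp: emeasure_dball divide_ennreal_def mult.commute inverse_ennreal inverse_eq_divide)

lemma AE_Lavg: "(AE x in Lavg k. P x) \<longleftrightarrow> (AE x in lebesgue. x \<in> dball k \<longrightarrow> P x)"
  unfolding Lavg_def by (rule AE_uniform_measure) (use emeasure_dball_bounds in auto)

text \<open>The density of the image of \<open>Lavg k\<close> under \<open>A\<close> with respect to \<open>Lavg (k + j)\<close> is at most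
  \<open>|B\<^sub>k\<^sub>+\<^sub>j| / (|det A| |B\<^sub>k|)\<close>.\<close>

lemma lp_bound_matrix:
  fixes A :: "real ^ ('n + 'n + unit) ^ ('n::finite + 'n + unit)" and g :: "'n heis \<Rightarrow> real"
  assumes g: "lp_bound q (Lavg (k + j)) g U" and [measurable]: "g \<in> borel_measurable borel"
    and A: "det A \<noteq> 0" "\<And>x. x \<in> dball k \<Longrightarrow> A *v x \<in> dball (k + j)" and q: "1 \<le> q"
  shows "lp_bound q (Lavg k) (\<lambda>x. g (A *v x))
    ((2 powr (of_int j * Qdim TYPE('n)) / \<bar>det A\<bar>) powr recip q * U)"
proof -
  have U: "0 \<le> U" using g by (rule lp_bound_nonneg)
  have [measurable]: "(\<lambda>x. g (A *v x)) \<in> borel_measurable borel" by measurable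
  have meas: "(\<lambda>x. g (A *v x)) \<in> borel_measurable (Lavg k)"
    using measurable_completion[of "\<lambda>x. g (A *v x)" lborel borel]
    by (simp add: measurable_cong_sets[OF Lavg_space_sets refl])
  show ?thesis
  proof (cases "q = \<infinity>")
    case True
    have "AE x in lborel. x \<in> dball (k + j) \<longrightarrow> \<bar>g x\<bar> \<le> U"
      using g True by (simp add: lp_bound_def AE_Lavg AE_completion_iff)
    then have "AE x in lborel. A *v x \<in> dball (k + j) \<longrightarrow> \<bar>g (A *v x)\<bar> \<le> U"
      by (rule AE_matrix[OF _ A(1)])
    then have "AE x in lborel. x \<in> dball k \<longrightarrow> \<bar>g (A *v x)\<bar> \<le> U"
      by eventually_elim (use A in auto)
    then show ?thesis using True meas U A(1)
      by (simp add: lp_bound_def AE_Lavg AE_completion_iff recip_infinity[unfolded infinity_ennreal_def])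
  next
    case False
    define t where "t = enn2real q"
    have t: "1 \<le> t" "recip q = 1 / t" using enn2real_exponent[OF q False] by (auto simp: t_def)
    let ?m = "2 powr (of_int j * Qdim TYPE('n))" and ?v = "vol TYPE('n)"
    have m: "?v (k + j) = ?m * ?v k" by (rule vol_add)
    have vp: "0 < ?v k" "0 < ?v (k + j)" by (rule vol_pos)+
    have d: "0 < \<bar>det A\<bar>" using A by simp
    have "(\<integral>\<^sup>+x. ennreal (\<bar>g (A *v x)\<bar> powr t) * indicator (dball k) x \<partial>lborel)
       \<le> (\<integral>\<^sup>+x. ennreal (\<bar>g (A *v x)\<bar> powr t) * indicator (dball (k + j)) (A *v x) \<partial>lborel)"
      using A by (intro nn_integral_mono) (auto simp: indicator_def)
    also have "\<dots> = ennreal (1 / \<bar>det A\<bar>) * (ennreal \<bar>det A\<bar> * \<dots>)"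
      using d by (simp flip: mult.assoc ennreal_mult)
    also have "ennreal \<bar>det A\<bar> * (\<integral>\<^sup>+x. ennreal (\<bar>g (A *v x)\<bar> powr t) * indicator (dball (k + j)) (A *v x) \<partial>lborel)
       = (\<integral>\<^sup>+y. ennreal (\<bar>g y\<bar> powr t) * indicator (dball (k + j)) y \<partial>lborel)"
      by (rule nn_integral_matrix[symmetric]) (use A in auto)
    finally have 1: "(\<integral>\<^sup>+x. ennreal (\<bar>g (A *v x)\<bar> powr t) * indicator (dball k) x \<partial>lborel)
      \<le> ennreal (1 / \<bar>det A\<bar>) * (\<integral>\<^sup>+y. ennreal (\<bar>g y\<bar> powr t) * indicator (dball (k + j)) y \<partial>lborel)" .
    have 2: "(\<integral>\<^sup>+x. ennreal (\<bar>h x\<bar> powr t) \<partial>Lavg i) =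
      ennreal (1 / ?v i) * (\<integral>\<^sup>+x. ennreal (\<bar>h x\<bar> powr t) * indicator (dball i) x \<partial>lborel)"
      if [measurable]: "h \<in> borel_measurable borel" for h :: "'n heis \<Rightarrow> real" and i
    proof -
      have "(\<lambda>x. ennreal (\<bar>h x\<bar> powr t)) \<in> borel_measurable lebesgue"
        by (rule measurable_completion) measurable
      then show ?thesis by (subst nn_integral_Lavg) (auto simp: nn_integral_completion)
    qed
    have "(\<integral>\<^sup>+x. ennreal (\<bar>g (A *v x)\<bar> powr t) \<partial>Lavg k)
       \<le> ennreal (1 / ?v k) * (ennreal (1 / \<bar>det A\<bar>) * (\<integral>\<^sup>+y. ennreal (\<bar>g y\<bar> powr t) * indicator (dball (k + j)) y \<partial>lborel))"
      using 1 by (subst 2) (auto intro!: mult_left_mono)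
    also have "\<dots> = ennreal (?m / \<bar>det A\<bar>) * (ennreal (1 / ?v (k + j)) * (\<integral>\<^sup>+y. ennreal (\<bar>g y\<bar> powr t) * indicator (dball (k + j)) y \<partial>lborel))"
    proof -
      have "1 / ?v k * (1 / \<bar>det A\<bar>) = ?m / \<bar>det A\<bar> * (1 / ?v (k + j))"
        using vp d by (simp add: m)
      then show ?thesis using vp d by (simp only: ennreal_mult[symmetric] mult.assoc[symmetric] divide_nonneg_pos less_imp_le zero_le_one powr_ge_zero)
    qed
    also have "\<dots> = ennreal (?m / \<bar>det A\<bar>) * (\<integral>\<^sup>+x. ennreal (\<bar>g x\<bar> powr t) \<partial>Lavg (k + j))"
      by (subst 2) auto
    also have "\<dots> \<le> ennreal (?m / \<bar>det A\<bar>) * ennreal (U powr t)"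
      using g False by (intro mult_left_mono) (auto simp: lp_bound_def t_def)
    also have "\<dots> = ennreal (((?m / \<bar>det A\<bar>) powr recip q * U) powr t)"
      using t U d by (simp add: powr_mult powr_powr flip: ennreal_mult)
    finally show ?thesis using False meas U by (simp add: lp_bound_def t_def)
  qed
qed

section \<open>Weights on dyadic balls\<close>

lemma loc_integrable_measurable:
  fixes f :: "'n::finite heis \<Rightarrow> 'b::euclidean_space"
  assumes "loc_integrable f"
  shows "f \<in> borel_measurable lebesgue"
proof (rule borel_measurable_LIMSEQ_metric)
  fix m :: nat
  have "compact (cball 0 (real m) :: 'n heis set)" by simp
  then have "set_integrable lebesgue (cball 0 (real m)) f" using assms by (auto simp: loc_integrable_def)
  then show "(\<lambda>x. indicator (cball 0 (real m)) x *\<^sub>R f x) \<in> borel_measurable lebesgue"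
    unfolding set_integrable_def by (rule borel_measurable_integrable)
next
  fix x :: "'n heis"
  have "\<forall>\<^sub>F m in sequentially. indicator (cball 0 (real m)) x *\<^sub>R f x = f x"
    using eventually_ge_at_top[of "nat \<lceil>norm x\<rceil>"]
    by eventually_elim (auto simp: indicator_def nat_le_iff ceiling_le_iff)
  then show "(\<lambda>m. indicator (cball 0 (real m)) x *\<^sub>R f x) \<longlonglongrightarrow> f x"
    by (rule tendsto_eventually)
qed

lemma sets_dball_lebesgue [measurable]: "dball k \<in> sets lebesgue"
  and sets_dshell_lebesgue [measurable]: "dshell k \<in> sets lebesgue"
  by auto

lemma ex_mem_dball: "\<exists>k::nat. x \<in> dball (int k)"
proof -
  obtain k where "hnorm x < 2 ^ k" using real_arch_pow[of 2 "hnorm x"] by auto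
  then show ?thesis by (intro exI[of _ k]) (simp add: dball_def)
qed

definition wvol :: "('n::finite heis \<Rightarrow> real) \<Rightarrow> int \<Rightarrow> real" where
  "wvol w k = enn2real (wmeas w (dball k))"

text \<open>A lower bound for the weight on a large ball passes to the volumes of the smaller balls inside it.\<close>

lemma wvol_ge_of_lower_bound:
  fixes w :: "'n::finite heis \<Rightarrow> real"
  assumes [measurable]: "w \<in> borel_measurable lebesgue" and fin: "wmeas w (dball l) < \<infinity>"
    and low: "AE x in lebesgue. x \<in> dball k \<longrightarrow> c \<le> w x" and "l \<le> k" "0 \<le> c"
  shows "c * vol TYPE('n) l \<le> wvol w l"
proof -
  have "ennreal (c * vol TYPE('n) l) = (\<integral>\<^sup>+x. ennreal c * indicator (dball l :: 'n heis set) x \<partial>lebesgue)"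
    using \<open>0 \<le> c\<close> vol_pos[where 'n='n and k=l]
    by (subst nn_integral_cmult_indicator) (auto simp: emeasure_dball ennreal_mult simp del: emeasure_completion)
  also have "\<dots> \<le> wmeas w (dball l)"
    unfolding wmeas_def
  proof (rule nn_integral_mono_AE, use low in eventually_elim)
    fix x assume "x \<in> dball k \<longrightarrow> c \<le> w x"
    then show "ennreal c * indicator (dball l) x \<le> ennreal (w x) * indicator (dball l) x"
      using dball_mono[OF \<open>l \<le> k\<close>] by (auto simp: indicator_def ennreal_leI)
  qed
  also have "\<dots> = ennreal (wvol w l)" using fin by (simp add: wvol_def less_top)
  finally show ?thesis by (simp add: wvol_def)
qed

text \<open>The part of \<open>w \<in> A\<^sub>1 \<inter> RH\<^sub>r\<close> that concerns balls around the origin with dyadic radii, with a common constant.\<close>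

locale dyadic_weight =
  fixes w :: "'n::finite heis \<Rightarrow> real" and r C :: real
  assumes w_measurable [measurable]: "w \<in> borel_measurable lebesgue"
    and w_nonneg: "0 \<le> w x"
    and wmeas_finite: "wmeas w (dball k) < \<infinity>"
    and wvol_pos: "0 < wvol w k"
    and r: "1 < r" and C: "1 \<le> C"
    and w_lower: "AE x in lebesgue. x \<in> dball k \<longrightarrow> wvol w k \<le> C * vol TYPE('n) k * w x"
    and w_upper: "lp_bound (ennreal r) (Lavg k) (\<lambda>x. w x * (vol TYPE('n) k / wvol w k)) C"

lemma epowr_le_iff_powr:
  assumes "0 < a" "0 \<le> b"
  shows "epowr x (1 / a) \<le> ennreal b \<longleftrightarrow> x \<le> ennreal (b powr a)"
proof (cases x)
  case (real u)
  show ?thesis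
  proof (cases "u = 0")
    case True
    then show ?thesis using real assms by (simp add: epowr_def)
  next
    case False
    then have u: "0 < u" using real by simp
    have "u powr (1 / a) \<le> b \<longleftrightarrow> u \<le> b powr a"
    proof
      assume "u powr (1 / a) \<le> b"
      then have "(u powr (1 / a)) powr a \<le> b powr a" using assms by (intro powr_mono2) auto
      then show "u \<le> b powr a" using assms u by (simp add: powr_powr)
    next
      assume "u \<le> b powr a"
      then have "u powr (1 / a) \<le> (b powr a) powr (1 / a)" using assms u by (intro powr_mono2) auto
      then show "u powr (1 / a) \<le> b" using assms by (simp add: powr_powr)
    qed
    then show ?thesis using real u assms by (simp add: epowr_def ennreal_eq_0_iff)
  qed
next
  case top
  then show ?thesis using assms by (simp add: epowr_def top_unique)
qed

text \<open>The factor 2 in front of the \<open>A\<^sub>1\<close> constant makes the bound strictly smaller than the essential infimum, so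
  that it is attained almost everywhere. Positivity: a weight that is not almost everywhere zero has
  positive mass on some dyadic ball, and the \<open>A\<^sub>1\<close> condition spreads a positive lower bound over that ball and
  over every larger one.\<close>

lemma A1_reverse_Hoelder_dyadic:
  fixes w :: "'n::finite heis \<Rightarrow> real"
  assumes A1: "A1_weight w" and r: "1 < r" and RH: "reverse_Hoelder r w"
  obtains C where "dyadic_weight w r C"
proof -
  let ?v = "vol TYPE('n)"
  have wt: "weight w" using A1 by (simp add: A1_weight_def)
  have w0: "0 \<le> w x" for x using wt by (simp add: weight_def)
  have wl: "loc_integrable w" using wt by (simp add: weight_def)
  have meas[measurable]: "w \<in> borel_measurable lebesgue" by (rule loc_integrable_measurable[OF wl])
  have vp: "0 < ?v k" for k by (rule vol_pos)
  have fin: "wmeas w (dball k) < \<infinity>" for k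
  proof -
    have "set_integrable lebesgue {x. hnorm x \<le> 2 powi k} w"
      using wl compact_hnorm_le by (auto simp: loc_integrable_def)
    then have "(\<integral>\<^sup>+x. ennreal (norm (indicator {x. hnorm x \<le> 2 powi k} x *\<^sub>R w x)) \<partial>lebesgue) < \<infinity>"
      unfolding set_integrable_def by (simp add: integrable_iff_bounded)
    moreover have "wmeas w (dball k) \<le> (\<integral>\<^sup>+x. ennreal (norm (indicator {x. hnorm x \<le> 2 powi k} x *\<^sub>R w x)) \<partial>lebesgue)"
      unfolding wmeas_def by (intro nn_integral_mono) (auto simp: indicator_def dball_def w0)
    ultimately show ?thesis by (rule order_le_less_trans[rotated])
  qed
  have wm: "wmeas w (dball k) = ennreal (wvol w k)" for k
    using fin[of k] by (simp add: wvol_def less_top)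
  have W0: "0 \<le> wvol w k" for k by (simp add: wvol_def)
  obtain C1 where C1: "0 < C1" and
    A: "\<And>x \<rho>. 0 < \<rho> \<Longrightarrow> wmeas w (hball x \<rho>) / emeasure lebesgue (hball x \<rho>) \<le> ennreal C1 * essinf_on (hball x \<rho>) w"
    using A1 by (auto simp: A1_weight_def)
  have Ak: "ennreal (wvol w k / ?v k) \<le> ennreal C1 * essinf_on (dball k) w" for k
    using A[of "2 powi k" 0] vp[of k] W0[of k]
    by (simp add: dball_eq_hball[symmetric] wm emeasure_dball divide_ennreal
          del: emeasure_completion)
  have low: "AE x in lebesgue. x \<in> dball k \<longrightarrow> wvol w k \<le> 2 * C1 * ?v k * w x" for k
  proof (cases "wvol w k = 0")
    case True
    then show ?thesis using C1 vp[of k] w0 by (simp add: mult_nonneg_nonneg less_imp_le)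
  next
    case False
    then have Wp: "0 < wvol w k" using W0[of k] by simp
    define c where "c = wvol w k / (2 * C1 * ?v k)"
    have c: "0 < c" using Wp C1 vp[of k] by (simp add: c_def)
    have "ennreal c < essinf_on (dball k) w"
    proof (rule ccontr)
      assume "\<not> ?thesis"
      then have "ennreal C1 * essinf_on (dball k) w \<le> ennreal C1 * ennreal c" by (intro mult_left_mono) auto
      with Ak[of k] have "ennreal (wvol w k / ?v k) \<le> ennreal C1 * ennreal c" by (rule order_trans)
      then have "wvol w k / ?v k \<le> C1 * c" using C1 c by (simp flip: ennreal_mult)
      then show False using Wp C1 vp[of k] by (simp add: c_def field_simps)
    qed
    then obtain c' where c': "ennreal c < c'" "AE x in lebesgue. x \<in> dball k \<longrightarrow> c' \<le> ennreal (w x)"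
      unfolding essinf_on_def less_Sup_iff by auto
    show ?thesis
      using c'(2)
    proof eventually_elim
      fix x assume "x \<in> dball k \<longrightarrow> c' \<le> ennreal (w x)"
      then have "x \<in> dball k \<longrightarrow> ennreal c \<le> ennreal (w x)" using c'(1) by (auto intro: order_trans less_imp_le)
      then have "x \<in> dball k \<longrightarrow> c \<le> w x" using w0 by simp
      then show "x \<in> dball k \<longrightarrow> wvol w k \<le> 2 * C1 * ?v k * w x"
        using C1 vp[of k] by (simp add: c_def field_simps)
    qed
  qed
  have mono: "wvol w l \<le> wvol w k" if "l \<le> k" for l k
  proof -
    have "wmeas w (dball l) \<le> wmeas w (dball k)"
      unfolding wmeas_def using dball_mono[OF that] by (intro nn_integral_mono) (auto simp: indicator_def)
    then show ?thesis using W0[of k] by (simp add: wm)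
  qed
  have "\<exists>k0::nat. 0 < wvol w (int k0)"
  proof (rule ccontr)
    assume "\<not> ?thesis"
    then have 0: "wvol w (int k) = 0" for k using W0[of "int k"] by (simp add: not_less antisym)
    have "AE x in lebesgue. x \<in> dball (int k) \<longrightarrow> w x = 0" for k
    proof -
      have "(\<integral>\<^sup>+x\<in>dball (int k). ennreal (w x) \<partial>lebesgue) = 0" using wm[of "int k"] 0 by (simp add: wmeas_def)
      then have "AE x in lebesgue. ennreal (w x) * indicator (dball (int k)) x = 0"
        by (subst (asm) nn_integral_0_iff_AE) auto
      then show ?thesis by eventually_elim (use w0 in \<open>auto simp: indicator_def ennreal_eq_0_iff antisym split: if_splits\<close>)
    qed
    then have "AE x in lebesgue. \<forall>k. x \<in> dball (int k) \<longrightarrow> w x = 0" by (subst AE_all_countable) auto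
    then have "AE x in lebesgue. w x = 0" by eventually_elim (use ex_mem_dball in blast)
    then show False using wt by (simp add: weight_def)
  qed
  then obtain k0 :: nat where k0: "0 < wvol w (int k0)" by blast
  have Wp: "0 < wvol w l" for l
  proof -
    define k where "k = max l (int k0)"
    have Wk: "0 < wvol w k" using k0 mono[of "int k0" k] by (simp add: k_def)
    define c where "c = wvol w k / (2 * C1 * ?v k)"
    have c: "0 < c" using Wk C1 vp[of k] by (simp add: c_def)
    have "AE x in lebesgue. x \<in> dball k \<longrightarrow> c \<le> w x"
      using low[of k] by eventually_elim (use C1 vp[of k] in \<open>simp add: c_def field_simps\<close>)
    then have "c * ?v l \<le> wvol w l"
      by (rule wvol_ge_of_lower_bound[OF meas fin]) (use c in \<open>auto simp: k_def\<close>)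
    moreover have "0 < c * ?v l" using c vp[of l] by simp
    ultimately show ?thesis by linarith
  qed
  obtain C2 where C2: "0 < C2" and
    R: "\<And>x \<rho>. 0 < \<rho> \<Longrightarrow> epowr ((\<integral>\<^sup>+z\<in>hball x \<rho>. ennreal (w z powr r) \<partial>lebesgue)
                 / emeasure lebesgue (hball x \<rho>)) (1 / r)
          \<le> ennreal C2 * (wmeas w (hball x \<rho>) / emeasure lebesgue (hball x \<rho>))"
    using RH by (auto simp: reverse_Hoelder_def)
  define C where "C = max 1 (max (2 * C1) C2)"
  have C: "1 \<le> C" "2 * C1 \<le> C" "C2 \<le> C" by (auto simp: C_def)
  have r1: "enn2real (ennreal r) = r" "ennreal r \<noteq> \<infinity>" using r by auto
  have "dyadic_weight w r C"
  proof
    fix k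
    show "AE x in lebesgue. x \<in> dball k \<longrightarrow> wvol w k \<le> C * ?v k * w x"
      using low[of k]
    proof eventually_elim
      fix x assume "x \<in> dball k \<longrightarrow> wvol w k \<le> 2 * C1 * ?v k * w x"
      moreover have "2 * C1 * (?v k * w x) \<le> C * (?v k * w x)"
        using C w0[of x] vp[of k] by (intro mult_right_mono) auto
      ultimately show "x \<in> dball k \<longrightarrow> wvol w k \<le> C * ?v k * w x" by (auto simp: mult.assoc)
    qed
    have "lp_bound (ennreal r) (Lavg k) w (C * (wvol w k / ?v k))"
    proof -
      have "epowr ((\<integral>\<^sup>+z\<in>dball k. ennreal (w z powr r) \<partial>lebesgue) / ennreal (?v k)) (1 / r)
          \<le> ennreal (C2 * (wvol w k / ?v k))"
        using R[of "2 powi k" 0] C2 Wp[of k] vp[of k]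
        by (subst ennreal_mult) (simp_all add: dball_eq_hball[symmetric] wm emeasure_dball divide_ennreal
          del: emeasure_completion)
      then have "(\<integral>\<^sup>+z\<in>dball k. ennreal (w z powr r) \<partial>lebesgue) / ennreal (?v k) \<le> ennreal ((C2 * (wvol w k / ?v k)) powr r)"
        using r C2 Wp[of k] vp[of k] by (subst (asm) epowr_le_iff_powr) auto
      also have "\<dots> \<le> ennreal ((C * (wvol w k / ?v k)) powr r)"
        using C C2 Wp[of k] vp[of k] r by (intro ennreal_leI powr_mono2 mult_right_mono) auto
      also have "(\<integral>\<^sup>+z\<in>dball k. ennreal (w z powr r) \<partial>lebesgue) / ennreal (?v k)
          = (\<integral>\<^sup>+z. ennreal (\<bar>w z\<bar> powr r) \<partial>Lavg k)"
        using vp[of k] w0 by (subst nn_integral_Lavg) (auto simp: divide_ennreal_def inverse_ennreal inverse_eq_divide mult.commute)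
      finally show ?thesis using r1 C(1) Wp[of k] vp[of k]
        by (auto simp: lp_bound_def measurable_cong_sets[OF Lavg_space_sets refl])
    qed
    from lp_bound_cmult[OF this, of "?v k / wvol w k"]
    show "lp_bound (ennreal r) (Lavg k) (\<lambda>x. w x * (?v k / wvol w k)) C"
      using Wp[of k] vp[of k] by (simp add: mult.commute)
  qed (use meas w0 fin Wp r C in auto)
  then show ?thesis by (rule that)
qed

context dyadic_weight
begin

abbreviation W :: "int \<Rightarrow> real" where "W \<equiv> wvol w"

lemma wmeas_dball: "wmeas w (dball k) = ennreal (W k)"
  using wmeas_finite[of k] by (simp add: wvol_def less_top)

lemma w_pos_AE: "AE x in lebesgue. 0 < w x"
proof -
  have "AE x in lebesgue. \<forall>k::nat. x \<in> dball (int k) \<longrightarrow> W (int k) \<le> C * vol TYPE('n) (int k) * w x"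
    by (subst AE_all_countable) (auto intro: w_lower)
  then show ?thesis
  proof eventually_elim
    fix x assume *: "\<forall>k::nat. x \<in> dball (int k) \<longrightarrow> W (int k) \<le> C * vol TYPE('n) (int k) * w x"
    obtain k :: nat where "x \<in> dball (int k)" using ex_mem_dball by blast
    with * wvol_pos[of "int k"] have "0 < C * vol TYPE('n) (int k) * w x" by fastforce
    then show "0 < w x" using C vol_pos[where 'n='n and k="int k"] w_nonneg[of x] by (simp add: zero_less_mult_iff)
  qed
qed

text \<open>Integrate the lower bound \<open>w \<ge> W\<^sub>k / (C |B\<^sub>k|)\<close>, valid on \<open>B\<^sub>k\<close>, over \<open>B\<^sub>l\<close>.\<close>

lemma wvol_doubling:
  assumes "l \<le> k"
  shows "W k \<le> C * 2 powr (of_int (k - l) * Qdim TYPE('n)) * W l"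
proof -
  define c where "c = W k / (C * vol TYPE('n) k)"
  have c: "0 < c" using wvol_pos[of k] C vol_pos[where 'n='n and k=k] by (simp add: c_def)
  have "AE x in lebesgue. x \<in> dball k \<longrightarrow> c \<le> w x"
    using w_lower[of k] by eventually_elim (use C vol_pos[where 'n='n and k=k] in \<open>simp add: c_def field_simps\<close>)
  then have "c * vol TYPE('n) l \<le> W l"
    by (rule wvol_ge_of_lower_bound[OF w_measurable wmeas_finite _ assms]) (use c in simp)
  moreover have "vol TYPE('n) k = 2 powr (of_int (k - l) * Qdim TYPE('n)) * vol TYPE('n) l" using vol_add[of l "k - l", where 'n='n] by simp
  ultimately show ?thesis using C vol_pos[where 'n='n and k=l] vol_pos[where 'n='n and k=k] by (simp add: c_def field_simps)
qed

text \<open>Hoelder's inequality on \<open>B\<^sub>l\<close> against the \<open>r\<close>-th mean of \<open>w\<close> over \<open>B\<^sub>k\<close>, in the form of a truncation of \<open>w\<close> at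
  the level \<open>l0\<close> for which both parts contribute equally.\<close>

lemma wvol_reverse_doubling:
  assumes "l \<le> k"
  shows "W l \<le> 2 * C * 2 powr (- of_int (k - l) * Qdim TYPE('n) * (1 - 1 / r)) * W k"
proof -
  let ?m = "2 powr (of_int (k - l) * Qdim TYPE('n)) :: real"
  have m: "0 < ?m" by simp
  have Vk: "vol TYPE('n) k = ?m * vol TYPE('n) l" using vol_add[of l "k - l", where 'n='n] by simp
  define a where "a = W k / vol TYPE('n) k"
  have a: "0 < a" using wvol_pos[of k] vol_pos[where 'n='n and k=k] by (simp add: a_def)
  have "lp_bound (ennreal r) (Lavg k) w (C * a)"
    using lp_bound_cmult[OF w_upper[of k], of a] wvol_pos[of k] vol_pos[where 'n='n and k=k]
    by (simp add: a_def mult.commute)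
  then have up: "(\<integral>\<^sup>+x. ennreal (w x powr r) \<partial>Lavg k) \<le> ennreal ((C * a) powr r)"
    using r w_nonneg by (simp add: lp_bound_def)
  \<comment> \<open>At this level \<open>l0 |B\<^sub>l|\<close> equals the bound for the integral of \<open>l0^{1-r} w^r\<close> over \<open>B\<^sub>k\<close>.\<close>
  define l0 where "l0 = C * a * ?m powr (1 / r)"
  have l0: "0 < l0" using C a by (simp add: l0_def)
  have pw: "w x \<le> l0 + l0 powr (1 - r) * w x powr r" for x
    using truncation_le[OF w_nonneg l0] r by simp
  have "ennreal (W l) = (\<integral>\<^sup>+x. ennreal (w x) * indicator (dball l) x \<partial>lebesgue)"
    using wmeas_dball[of l] by (simp add: wmeas_def)
  also have "\<dots> \<le> (\<integral>\<^sup>+x. ennreal l0 * indicator (dball l) x + ennreal (l0 powr (1 - r)) * (ennreal (w x powr r) * indicator (dball k) x) \<partial>lebesgue)"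
  proof (rule nn_integral_mono)
    fix x
    show "ennreal (w x) * indicator (dball l) x \<le> ennreal l0 * indicator (dball l) x + ennreal (l0 powr (1 - r)) * (ennreal (w x powr r) * indicator (dball k) x)"
      using ennreal_leI[OF pw[of x]] dball_mono[OF assms] l0 w_nonneg[of x]
      by (auto simp: indicator_def simp flip: ennreal_plus ennreal_mult)
  qed
  also have "\<dots> = ennreal l0 * emeasure lebesgue (dball l :: 'n heis set)
      + ennreal (l0 powr (1 - r)) * (\<integral>\<^sup>+x. ennreal (w x powr r) * indicator (dball k) x \<partial>lebesgue)"
    proof -
    have "(\<integral>\<^sup>+x. ennreal l0 * indicator (dball l) x + ennreal (l0 powr (1 - r)) * (ennreal (w x powr r) * indicator (dball k) x) \<partial>lebesgue)
      = (\<integral>\<^sup>+x. ennreal l0 * indicator (dball l :: 'n heis set) x \<partial>lebesgue)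
        + (\<integral>\<^sup>+x. ennreal (l0 powr (1 - r)) * (ennreal (w x powr r) * indicator (dball k) x) \<partial>lebesgue)"
      by (rule nn_integral_add) measurable
    moreover have "(\<integral>\<^sup>+x. ennreal l0 * indicator (dball l :: 'n heis set) x \<partial>lebesgue) = ennreal l0 * emeasure lebesgue (dball l :: 'n heis set)"
      by (rule nn_integral_cmult_indicator) measurable
    moreover have "(\<integral>\<^sup>+x. ennreal (l0 powr (1 - r)) * (ennreal (w x powr r) * indicator (dball k) x) \<partial>lebesgue)
      = ennreal (l0 powr (1 - r)) * (\<integral>\<^sup>+x. ennreal (w x powr r) * indicator (dball k) x \<partial>lebesgue)"
      by (rule nn_integral_cmult) measurable
    ultimately show ?thesis by (simp only:)
  qed
  also have "(\<integral>\<^sup>+x. ennreal (w x powr r) * indicator (dball k) x \<partial>lebesgue) = ennreal (vol TYPE('n) k) * (\<integral>\<^sup>+x. ennreal (w x powr r) \<partial>Lavg k)"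
    using vol_pos[where 'n='n and k=k] by (subst nn_integral_Lavg) (auto simp flip: mult.assoc ennreal_mult)
  also have "ennreal l0 * emeasure lebesgue (dball l :: 'n heis set) + ennreal (l0 powr (1 - r)) * (ennreal (vol TYPE('n) k) * (\<integral>\<^sup>+x. ennreal (w x powr r) \<partial>Lavg k))
     \<le> ennreal l0 * ennreal (vol TYPE('n) l) + ennreal (l0 powr (1 - r)) * (ennreal (vol TYPE('n) k) * ennreal ((C * a) powr r))"
    using up by (intro add_mono mult_left_mono) (auto simp: emeasure_dball simp del: emeasure_completion)
  also have "\<dots> = ennreal (l0 * vol TYPE('n) l + l0 powr (1 - r) * (vol TYPE('n) k * (C * a) powr r))"
    using l0 vol_pos[where 'n='n and k=l] vol_pos[where 'n='n and k=k] by (simp flip: ennreal_plus ennreal_mult)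
  finally have "W l \<le> l0 * vol TYPE('n) l + l0 powr (1 - r) * (vol TYPE('n) k * (C * a) powr r)"
    using l0 vol_pos[where 'n='n and k=l] vol_pos[where 'n='n and k=k] by (subst (asm) ennreal_le_iff) auto
  also have "l0 powr (1 - r) * (vol TYPE('n) k * (C * a) powr r) = l0 * vol TYPE('n) l"
  proof -
    have "l0 powr (1 - r) = (C * a) powr (1 - r) * ?m powr ((1 - r) / r)"
      using C a by (simp add: l0_def powr_mult powr_powr)
    moreover have "(C * a) powr (1 - r) * (C * a) powr r = C * a" using C a by (simp flip: powr_add)
    moreover have "?m powr ((1 - r) / r) * ?m = ?m powr (1 / r)"
    proof -
      have "?m powr ((1 - r) / r) * ?m powr 1 = ?m powr ((1 - r) / r + 1)" by (simp only: powr_add)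
      also have "(1 - r) / r + 1 = 1 / r" using r by (simp add: field_simps)
      finally show ?thesis by simp
    qed
    moreover have "l0 powr (1 - r) * (vol TYPE('n) k * (C * a) powr r)
        = l0 powr (1 - r) * (?m * vol TYPE('n) l * (C * a) powr r)"
      unfolding Vk ..
    moreover have "b * c * (?m * v * d) = (b * d) * (c * ?m) * v" for b c d v :: real
      by (simp add: mult_ac)
    ultimately have "l0 powr (1 - r) * (vol TYPE('n) k * (C * a) powr r) = (C * a) * ?m powr (1 / r) * vol TYPE('n) l"
      by presburger
    then show ?thesis by (simp add: l0_def)
  qed
  also have "l0 * vol TYPE('n) l + l0 * vol TYPE('n) l = 2 * C * (?m powr (1 / r) / ?m) * W k"
    using vol_pos[where 'n='n and k=l] m by (simp add: l0_def a_def Vk field_simps)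
  also have "?m powr (1 / r) / ?m = 2 powr (- of_int (k - l) * Qdim TYPE('n) * (1 - 1 / r))"
  proof -
    have "?m powr (1 / r) / ?m powr 1 = ?m powr (1 / r - 1)" by (simp only: powr_diff)
    also have "\<dots> = 2 powr (of_int (k - l) * Qdim TYPE('n) * (1 / r - 1))" by (simp only: powr_powr)
    also have "of_int (k - l) * Qdim TYPE('n) * (1 / r - 1) = - of_int (k - l) * Qdim TYPE('n) * (1 - 1 / r)" by (simp add: algebra_simps)
    finally show ?thesis by simp
  qed
  finally show ?thesis .
qed

text \<open>Normalized weighted measure on \<open>B\<^sub>k\<close>; it has the same null sets as \<open>Lavg k\<close>, since \<open>w > 0\<close> almost everywhere.\<close>

definition Wavg :: "int \<Rightarrow> 'n heis measure" where
  "Wavg k = uniform_measure (density lebesgue (\<lambda>x. ennreal (w x))) (dball k)"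

lemma Wavg_sets [simp, measurable_cong]: "sets (Wavg k) = sets lebesgue"
  and space_Wavg [simp]: "space (Wavg k) = UNIV"
  by (simp_all add: Wavg_def uniform_measure_def)

lemma emeasure_density_dball: "emeasure (density lebesgue (\<lambda>x. ennreal (w x))) (dball k) = ennreal (W k)"
  using wmeas_dball[of k] by (subst emeasure_density) (auto simp: wmeas_def)

lemma AE_Wavg: "(AE x in Wavg k. P x) \<longleftrightarrow> (AE x in lebesgue. x \<in> dball k \<longrightarrow> P x)"
proof -
  have "(AE x in Wavg k. P x) \<longleftrightarrow> (AE x in density lebesgue (\<lambda>x. ennreal (w x)). x \<in> dball k \<longrightarrow> P x)"
    unfolding Wavg_def using wvol_pos[of k] by (intro AE_uniform_measure) (auto simp: emeasure_density_dball)
  also have "\<dots> \<longleftrightarrow> (AE x in lebesgue. 0 < ennreal (w x) \<longrightarrow> x \<in> dball k \<longrightarrow> P x)"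
    by (rule AE_density) measurable
  also have "\<dots> \<longleftrightarrow> (AE x in lebesgue. x \<in> dball k \<longrightarrow> P x)"
    using w_pos_AE by (auto elim!: AE_mp)
  finally show ?thesis .
qed

lemma nn_integral_Wavg:
  assumes [measurable]: "g \<in> borel_measurable lebesgue"
  shows "(\<integral>\<^sup>+x. g x \<partial>Wavg k) = ennreal (1 / W k) * (\<integral>\<^sup>+x. g x * ennreal (w x) * indicator (dball k) x \<partial>lebesgue)"
proof -
  have "(\<integral>\<^sup>+x. g x \<partial>Wavg k) = (\<integral>\<^sup>+x. g x * indicator (dball k) x \<partial>density lebesgue (\<lambda>x. ennreal (w x))) / ennreal (W k)"
    unfolding Wavg_def by (subst nn_integral_uniform_measure) (auto simp: emeasure_density_dball)
  also have "\<dots> = (\<integral>\<^sup>+x. g x * ennreal (w x) * indicator (dball k) x \<partial>lebesgue) / ennreal (W k)"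
    by (subst nn_integral_density) (auto simp: mult_ac)
  finally show ?thesis using wvol_pos[of k] by (simp add: divide_ennreal_def inverse_ennreal inverse_eq_divide mult.commute)
qed

lemma sigma_finite_Wavg: "sigma_finite_measure (Wavg k)"
proof -
  have "emeasure (Wavg k) UNIV = emeasure (density lebesgue (\<lambda>x. ennreal (w x))) (dball k \<inter> UNIV) / ennreal (W k)"
    unfolding Wavg_def emeasure_density_dball[symmetric] by (rule emeasure_uniform_measure) auto
  also have "\<dots> = 1" using wvol_pos[of k] by (simp add: emeasure_density_dball)
  finally have "finite_measure (Wavg k)" by (intro finite_measureI) simp
  then show ?thesis by (rule finite_measure.axioms(1))
qed

text \<open>By the lower bound on \<open>w\<close> the unweighted mean is at most \<open>C\<close> times the weighted one.\<close>

lemma lp_bound_Wavg_imp_Lavg: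
  assumes g: "lp_bound q (Wavg k) g U" and q: "1 \<le> q"
  shows "lp_bound q (Lavg k) g (C * U)"
proof -
  have U: "0 \<le> U" and [measurable]: "g \<in> borel_measurable lebesgue"
    using lp_bound_nonneg[OF g] lp_bound_measurable[OF g] by (auto simp: measurable_cong_sets[OF Wavg_sets refl])
  have gm: "g \<in> borel_measurable (Lavg k)" by (simp add: measurable_cong_sets[OF Lavg_space_sets refl])
  have UC: "U \<le> C * U" using C U by (simp add: mult_le_cancel_right1)
  show ?thesis
  proof (cases "q = \<infinity>")
    case True
    then have "AE x in Lavg k. \<bar>g x\<bar> \<le> U" using g by (simp add: lp_bound_def AE_Wavg AE_Lavg)
    then have "AE x in Lavg k. \<bar>g x\<bar> \<le> C * U" by eventually_elim (use UC in linarith)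
    then show ?thesis using True C U gm by (simp add: lp_bound_def)
  next
    case False
    define t where "t = enn2real q"
    have t: "1 \<le> t" using enn2real_exponent[OF q False] by (simp add: t_def)
    have "(\<integral>\<^sup>+x. ennreal (\<bar>g x\<bar> powr t) \<partial>Lavg k) = ennreal (1 / vol TYPE('n) k) * (\<integral>\<^sup>+x. ennreal (\<bar>g x\<bar> powr t) * indicator (dball k) x \<partial>lebesgue)"
      by (rule nn_integral_Lavg) measurable
    also have "\<dots> \<le> ennreal (1 / vol TYPE('n) k) * (\<integral>\<^sup>+x. ennreal (C * vol TYPE('n) k / W k) * (ennreal (\<bar>g x\<bar> powr t) * ennreal (w x) * indicator (dball k) x) \<partial>lebesgue)"
    proof (intro mult_left_mono nn_integral_mono_AE, use w_lower[of k] in eventually_elim)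
      fix x assume *: "x \<in> dball k \<longrightarrow> W k \<le> C * vol TYPE('n) k * w x"
      show "ennreal (\<bar>g x\<bar> powr t) * indicator (dball k) x \<le> ennreal (C * vol TYPE('n) k / W k) * (ennreal (\<bar>g x\<bar> powr t) * ennreal (w x) * indicator (dball k) x)"
      proof (cases "x \<in> dball k")
        case True
        then have "1 \<le> C * vol TYPE('n) k / W k * w x" using * wvol_pos[of k] by (simp add: field_simps)
        then have "\<bar>g x\<bar> powr t * 1 \<le> \<bar>g x\<bar> powr t * (C * vol TYPE('n) k / W k * w x)" by (intro mult_left_mono) auto
        from ennreal_leI[OF this] show ?thesis using True C vol_pos[where 'n='n and k=k] wvol_pos[of k] w_nonneg[of x]
          by (simp add: mult_ac flip: ennreal_mult)
      qed simp
    qed simp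
    also have "\<dots> = ennreal (1 / vol TYPE('n) k) * (ennreal (C * vol TYPE('n) k / W k) * (\<integral>\<^sup>+x. ennreal (\<bar>g x\<bar> powr t) * ennreal (w x) * indicator (dball k) x \<partial>lebesgue))"
      by (subst nn_integral_cmult) auto
    also have "\<dots> = ennreal C * (ennreal (1 / W k) * (\<integral>\<^sup>+x. ennreal (\<bar>g x\<bar> powr t) * ennreal (w x) * indicator (dball k) x \<partial>lebesgue))"
    proof -
      have "1 / vol TYPE('n) k * (C * vol TYPE('n) k / W k) = C * (1 / W k)"
        using vol_pos[where 'n='n and k=k] by simp
      then show ?thesis using C vol_pos[where 'n='n and k=k] wvol_pos[of k]
        by (simp only: mult.assoc[symmetric] ennreal_mult[symmetric] divide_nonneg_pos mult_nonneg_nonneg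
            less_imp_le zero_le_one order_trans[OF zero_le_one C])
    qed
    also have "\<dots> = ennreal C * (\<integral>\<^sup>+x. ennreal (\<bar>g x\<bar> powr t) \<partial>Wavg k)"
      by (subst nn_integral_Wavg) auto
    also have "\<dots> \<le> ennreal (C powr t) * ennreal (U powr t)"
      using g False C t powr_mono[of 1 t C] by (intro mult_mono) (auto simp: lp_bound_def t_def intro!: ennreal_leI)
    also have "\<dots> = ennreal ((C * U) powr t)" using C U by (simp add: powr_mult ennreal_mult)
    finally show ?thesis using False gm C U by (simp add: lp_bound_def t_def)
  qed
qed

end

section \<open>Central mean oscillation\<close>

lemma borel_imp_lebesgue_measurable:
  "f \<in> borel_measurable borel \<Longrightarrow> f \<in> borel_measurable lebesgue"
  by (rule measurable_completion) simp

text \<open>The index of the dyadic shell that contains the points of norm \<open>a > 0\<close>.\<close>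

definition dlevel :: "real \<Rightarrow> int" where
  "dlevel a = \<lfloor>log 2 a\<rfloor> + 1"

lemma dlevel:
  assumes "0 < a"
  shows "2 powi (dlevel a - 1) \<le> a" "a < 2 powi (dlevel a)"
proof -
  have "2 powr of_int \<lfloor>log 2 a\<rfloor> \<le> 2 powr (log 2 a)" by (intro powr_mono) auto
  then show "2 powi (dlevel a - 1) \<le> a" using assms by (simp add: dlevel_def powr_real_of_int')
  have "2 powr (log 2 a) < 2 powr of_int (dlevel a)"
    unfolding dlevel_def by (intro powr_less_mono) (linarith, simp)
  then show "a < 2 powi (dlevel a)" using assms by (simp add: powr_real_of_int')
qed

lemma dball_subset_shells:
  assumes "x \<in> dball k" "x \<noteq> 0"
  shows "\<exists>m::nat. x \<in> dshell (k - int m)"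
proof -
  have x: "0 < hnorm x" using assms(2) hnorm_nonneg[of x] by (simp add: less_le)
  define l where "l = dlevel (hnorm x)"
  have l: "2 powi (l - 1) \<le> hnorm x" "hnorm x < 2 powi l" using dlevel[OF x] by (auto simp: l_def)
  have "l \<le> k"
  proof (rule ccontr)
    assume "\<not> l \<le> k"
    then have "2 powi k \<le> (2 powi (l - 1) :: real)" by (intro power_int_increasing) auto
    then show False using l assms(1) by (auto simp: dball_def)
  qed
  then show ?thesis using l by (intro exI[of _ "nat (k - l)"]) (auto simp: dshell_def dball_def)
qed

context dyadic_weight
begin

lemma measurable_Wavg: "f \<in> borel_measurable (Wavg k) \<longleftrightarrow> f \<in> borel_measurable lebesgue"
  by (simp add: measurable_cong_sets[OF Wavg_sets refl])

lemma measurable_Lavg: "f \<in> borel_measurable (Lavg k) \<longleftrightarrow> f \<in> borel_measurable lebesgue"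
  by (simp add: measurable_cong_sets[OF Lavg_space_sets refl])

text \<open>The relative density is the weight divided by its mean, the function that the reverse Hoelder
  condition controls.\<close>

lemma nn_integral_Wavg_Lavg:
  assumes [measurable]: "g \<in> borel_measurable lebesgue"
  shows "(\<integral>\<^sup>+x. g x \<partial>Wavg k) = (\<integral>\<^sup>+x. g x * ennreal (w x * (vol TYPE('n) k / W k)) \<partial>Lavg k)"
proof -
  let ?c = "vol TYPE('n) k / W k"
  have c: "0 < ?c" using vol_pos[where 'n='n and k=k] wvol_pos[of k] by simp
  have "(\<integral>\<^sup>+x. g x * ennreal (w x * ?c) \<partial>Lavg k)
     = ennreal (1 / vol TYPE('n) k) * (\<integral>\<^sup>+x. g x * ennreal (w x * ?c) * indicator (dball k) x \<partial>lebesgue)"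
    by (rule nn_integral_Lavg) measurable
  also have "(\<integral>\<^sup>+x. g x * ennreal (w x * ?c) * indicator (dball k) x \<partial>lebesgue)
     = (\<integral>\<^sup>+x. ennreal ?c * (g x * ennreal (w x) * indicator (dball k) x) \<partial>lebesgue)"
    using c w_nonneg by (intro nn_integral_cong) (simp add: ennreal_mult mult_ac del: times_divide_eq_right)
  also have "\<dots> = ennreal ?c * (\<integral>\<^sup>+x. g x * ennreal (w x) * indicator (dball k) x \<partial>lebesgue)"
    by (rule nn_integral_cmult) measurable
  also have "ennreal (1 / vol TYPE('n) k) * (ennreal ?c * (\<integral>\<^sup>+x. g x * ennreal (w x) * indicator (dball k) x \<partial>lebesgue))
     = ennreal (1 / W k) * (\<integral>\<^sup>+x. g x * ennreal (w x) * indicator (dball k) x \<partial>lebesgue)"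
  proof -
    have "1 / vol TYPE('n) k * ?c = 1 / W k" using vol_pos[where 'n='n and k=k] by simp
    then have "ennreal (1 / vol TYPE('n) k) * ennreal ?c = ennreal (1 / W k)"
      using c vol_pos[where 'n='n and k=k] by (subst ennreal_mult[symmetric]) auto
    then show ?thesis by (simp only: mult.assoc[symmetric])
  qed
  also have "\<dots> = (\<integral>\<^sup>+x. g x \<partial>Wavg k)" by (rule nn_integral_Wavg[symmetric]) measurable
  finally show ?thesis by simp
qed

lemma lp_bound_prod_Wavg:
  assumes u: "lp_bound q (Lavg k) u U" and v: "lp_bound q1 (Lavg k) v V"
    and q: "1 \<le> q" "1 \<le> q1" "1 \<le> q2" "q2 \<noteq> \<infinity>"
    and exps: "enn2real q2 * recip q + enn2real q2 * recip q1 + 1 / r \<le> 1"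
  shows "lp_bound q2 (Wavg k) (\<lambda>x. u x * v x) (6 * C * (U * V))"
proof -
  define t where "t = enn2real q2"
  have t: "1 \<le> t" using enn2real_exponent[OF q(3,4)] by (simp add: t_def)
  have U: "0 \<le> U" "0 \<le> V" using u v by (auto dest: lp_bound_nonneg)
  have [measurable]: "u \<in> borel_measurable lebesgue" "v \<in> borel_measurable lebesgue"
    using u v by (auto dest: lp_bound_measurable simp: measurable_Lavg)
  have c: "0 \<le> w x * (vol TYPE('n) k / W k)" for x
    using w_nonneg[of x] vol_pos[where 'n='n and k=k] wvol_pos[of k] by simp
  have "(\<integral>\<^sup>+x. ennreal (\<bar>u x * v x\<bar> powr t) \<partial>Wavg k)
     = (\<integral>\<^sup>+x. ennreal (\<bar>u x * v x\<bar> powr t) * ennreal (w x * (vol TYPE('n) k / W k)) \<partial>Lavg k)"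
    by (rule nn_integral_Wavg_Lavg) measurable
  also have "\<dots> = (\<integral>\<^sup>+x. ennreal (\<bar>u x * v x\<bar> powr t * (w x * (vol TYPE('n) k / W k))) \<partial>Lavg k)"
    by (subst ennreal_mult[OF powr_ge_zero c]) simp
  also have "\<dots> \<le> ennreal (6 * C * (U * V) powr t)"
    by (rule lp_bound_Hoelder3[OF emeasure_Lavg u v w_upper c q(1,2)]) (use r t exps in \<open>auto simp: t_def\<close>)
  also have "\<dots> \<le> ennreal ((6 * C * (U * V)) powr t)"
  proof (rule ennreal_leI)
    have "6 * C \<le> (6 * C) powr t" using C t powr_mono[of 1 t "6 * C"] by simp
    then show "6 * C * (U * V) powr t \<le> (6 * C * (U * V)) powr t"
      using U C by (subst powr_mult) (auto intro!: mult_right_mono)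
  qed
  finally show ?thesis using q U C by (simp add: lp_bound_def t_def measurable_Wavg)
qed

text \<open>The mean over \<open>B\<^sub>k\<close> of \<open>|b - c|\<close> is at most \<open>|B\<^sub>k\<^sub>+\<^sub>1| / |B\<^sub>k| = 2^Q\<close> times its mean over \<open>B\<^sub>k\<^sub>+\<^sub>1\<close>.\<close>

lemma Lavg_average_diff:
  fixes b :: "'n heis \<Rightarrow> complex"
  assumes b: "loc_integrable b"
    and bd: "lp_bound q (Wavg (k + 1)) (\<lambda>x. norm (b x - c)) B" and q: "1 \<le> q"
  shows "norm (mean (dball k) b - c) \<le> 2 powr Qdim TYPE('n) * (2 * (C * B))"
proof -
  let ?v = "vol TYPE('n)"
  have [measurable]: "b \<in> borel_measurable lebesgue" using b by (rule loc_integrable_measurable)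
  have vp: "0 < ?v k" "0 < ?v (k + 1)" by (rule vol_pos)+
  have "set_integrable lebesgue {x. hnorm x \<le> 2 powi k} b"
    using b compact_hnorm_le by (auto simp: loc_integrable_def)
  then have bi: "set_integrable lebesgue (dball k) b"
    by (rule set_integrable_subset) (auto simp: dball_def)
  have ci: "set_integrable lebesgue (dball k :: 'n heis set) (\<lambda>_. c)"
    unfolding set_integrable_def using emeasure_dball_bounds(3)[of k, where 'n='n]
    by (intro integrable_scaleR_left) (auto simp: integrable_indicator_iff)
  have "(LINT x:(dball k :: 'n heis set)|lebesgue. c) = ?v k *\<^sub>R c"
    unfolding set_lebesgue_integral_def vol_def by (subst integral_scaleR_left)
      (use emeasure_dball_bounds(3)[of k, where 'n='n] in \<open>auto simp: integrable_indicator_iff\<close>)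
  then have "mean (dball k) b - c = (1 / ?v k) *\<^sub>R ((LINT x:dball k|lebesgue. b x) - (LINT x:(dball k :: 'n heis set)|lebesgue. c))"
    using vp by (simp add: mean_def vol_def algebra_simps)
  also have "\<dots> = (1 / ?v k) *\<^sub>R (LINT x:dball k|lebesgue. b x - c)"
    using set_integral_diff(2)[OF bi ci] by simp
  finally have eq: "norm (mean (dball k) b - c) = 1 / ?v k * norm (LINT x:dball k|lebesgue. b x - c)"
    using vp by simp
  have "ennreal (norm (LINT x:dball k|lebesgue. b x - c)) \<le> (\<integral>\<^sup>+x. ennreal (norm (indicator (dball k) x *\<^sub>R (b x - c))) \<partial>lebesgue)"
    unfolding set_lebesgue_integral_def using set_integral_diff(1)[OF bi ci]
    by (intro integral_norm_bound_ennreal) (simp add: set_integrable_def)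
  also have "\<dots> \<le> (\<integral>\<^sup>+x. ennreal (norm (b x - c)) * indicator (dball (k + 1)) x \<partial>lebesgue)"
    using dball_mono[of k "k + 1"] by (intro nn_integral_mono) (auto simp: indicator_def)
  also have "\<dots> = ennreal (?v (k + 1)) * (\<integral>\<^sup>+x. ennreal \<bar>norm (b x - c)\<bar> \<partial>Lavg (k + 1))"
    using vp by (subst nn_integral_Lavg) (auto simp flip: mult.assoc ennreal_mult)
  also have "\<dots> \<le> ennreal (?v (k + 1)) * ennreal (2 * (C * B))"
    using lp_bound_integral_le[OF emeasure_Lavg lp_bound_Wavg_imp_Lavg[OF bd q] q] by (intro mult_left_mono) auto
  also have "\<dots> = ennreal (?v (k + 1) * (2 * (C * B)))"
    using vp C lp_bound_nonneg[OF bd] by (simp add: ennreal_mult)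
  finally have "norm (LINT x:dball k|lebesgue. b x - c) \<le> ?v (k + 1) * (2 * (C * B))"
    using vp C lp_bound_nonneg[OF bd] by (subst (asm) ennreal_le_iff) auto
  then have "norm (mean (dball k) b - c) \<le> 1 / ?v k * (?v (k + 1) * (2 * (C * B)))"
    unfolding eq using vp by (intro mult_left_mono) auto
  also have "\<dots> = 2 powr Qdim TYPE('n) * (2 * (C * B))"
    using vp vol_add[of k 1, where 'n='n] by simp
  finally show ?thesis .
qed

lemma mean_dball_diff:
  fixes b :: "'n heis \<Rightarrow> complex"
  assumes b: "loc_integrable b" and q: "1 \<le> q"
    and bd: "\<And>k. lp_bound q (Wavg k) (\<lambda>x. norm (b x - mean (dball k) b)) B"
  shows "norm (mean (dball k) b - mean (dball (k + j)) b) \<le> \<bar>of_int j\<bar> * (2 powr Qdim TYPE('n) * (2 * (C * B)))"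
proof -
  let ?D = "2 powr Qdim TYPE('n) * (2 * (C * B))"
  have n: "norm (mean (dball i) b - mean (dball (i + int n)) b) \<le> real n * ?D" for i n
  proof (induction n)
    case (Suc n)
    have "norm (mean (dball i) b - mean (dball (i + int (Suc n))) b)
       \<le> norm (mean (dball i) b - mean (dball (i + int n)) b)
         + norm (mean (dball (i + int n)) b - mean (dball (i + int (Suc n))) b)"
      using norm_triangle_ineq[of "mean (dball i) b - mean (dball (i + int n)) b" "mean (dball (i + int n)) b - mean (dball (i + int (Suc n))) b"]
      by simp
    also have "\<dots> \<le> real n * ?D + ?D"
      using Suc Lavg_average_diff[OF b bd[of "i + int n + 1"] q] by (intro add_mono) (auto simp: add_ac)
    finally show ?case by (simp add: algebra_simps)
  qed simp
  show ?thesis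
  proof (cases "0 \<le> j")
    case True
    then show ?thesis using n[of k "nat j"] by simp
  next
    case False
    then show ?thesis using n[of "k + j" "nat (- j)"] by (simp add: norm_minus_commute)
  qed
qed

text \<open>Compare \<open>b\<close> with its mean over \<open>B\<^sub>k\<close>, and \<open>b \<circ> A\<close> with the mean over \<open>B\<^sub>k\<^sub>+\<^sub>j\<close>, after a change of variables.
  The difference of the two means is a telescoping sum of \<open>|j|\<close> terms.\<close>

lemma lp_bound_oscillation:
  fixes b :: "'n heis \<Rightarrow> complex"
  assumes b: "loc_integrable b" and bm: "b \<in> borel_measurable borel" and q: "1 \<le> q"
    and bd: "\<And>k. lp_bound q (Wavg k) (\<lambda>x. norm (b x - mean (dball k) b)) B"
    and A: "det A \<noteq> 0" "\<And>x. x \<in> dball k \<Longrightarrow> A *v x \<in> dball (k + j)"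
  shows "lp_bound q (Lavg k) (\<lambda>x. norm (b x - b (A *v x)))
    (18 * 2 powr Qdim TYPE('n) * C * (1 + \<bar>of_int j\<bar>) * (1 + (2 powr (of_int j * Qdim TYPE('n)) / \<bar>det A\<bar>) powr recip q) * B)"
proof -
  note [measurable] = bm
  let ?m = "\<lambda>k. mean (dball k) b" and ?\<rho> = "(2 powr (of_int j * Qdim TYPE('n)) / \<bar>det A\<bar>) powr recip q"
  let ?P = "2 powr Qdim TYPE('n) :: real"
  have B: "0 \<le> B" using bd by (rule lp_bound_nonneg)
  have P: "1 \<le> ?P" using Qdim_pos[of "TYPE('n)"] by (simp add: ge_one_powr_ge_zero)
  \<comment> \<open>A common bound for the three pieces.\<close>
  define U where "U = 2 * ?P * C * (1 + \<bar>of_int j\<bar>) * (1 + ?\<rho>) * B"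
  have le: "a * (C * B) \<le> U" if "0 \<le> a" "a \<le> 2 * ?P * ((1 + \<bar>of_int j\<bar>) * (1 + ?\<rho>))" for a
  proof -
    have "a * (C * B) \<le> 2 * ?P * ((1 + \<bar>of_int j\<bar>) * (1 + ?\<rho>)) * (C * B)"
      using that B C by (intro mult_right_mono) auto
    then show ?thesis by (simp add: U_def mult_ac)
  qed
  have big: "1 \<le> (1 + \<bar>of_int j :: real\<bar>) * (1 + ?\<rho>)" "\<bar>of_int j\<bar> \<le> (1 + \<bar>of_int j :: real\<bar>) * (1 + ?\<rho>)"
    "?\<rho> \<le> (1 + \<bar>of_int j :: real\<bar>) * (1 + ?\<rho>)"
  proof -
    have "0 \<le> ?\<rho>" "0 \<le> \<bar>of_int j :: real\<bar>" "0 \<le> \<bar>of_int j :: real\<bar> * ?\<rho>" by auto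
    moreover have "(1 + \<bar>of_int j :: real\<bar>) * (1 + ?\<rho>) = 1 + \<bar>of_int j\<bar> + ?\<rho> + \<bar>of_int j\<bar> * ?\<rho>"
      by (simp add: algebra_simps)
    ultimately show "1 \<le> (1 + \<bar>of_int j :: real\<bar>) * (1 + ?\<rho>)" "\<bar>of_int j\<bar> \<le> (1 + \<bar>of_int j :: real\<bar>) * (1 + ?\<rho>)"
      "?\<rho> \<le> (1 + \<bar>of_int j :: real\<bar>) * (1 + ?\<rho>)" by linarith+
  qed
  have big2: "x \<le> 2 * ?P * y" if "x \<le> y" "0 \<le> y" for x y :: real
  proof -
    have "1 * y \<le> 2 * ?P * y" using that P by (intro mult_right_mono) auto
    then show ?thesis using that by simp
  qed
  have mL: "f \<in> borel_measurable (Lavg k)" if "f \<in> borel_measurable borel" for f :: "'n heis \<Rightarrow> real" and k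
    using that by (simp add: measurable_Lavg borel_imp_lebesgue_measurable)
  have 0: "lp_bound q (Lavg i) (\<lambda>x. norm (b x - ?m i)) (C * B)" for i
    by (rule lp_bound_Wavg_imp_Lavg[OF bd q])
  have 1: "lp_bound q (Lavg k) (\<lambda>x. norm (b x - ?m k)) U"
    using 0 le[of 1] big2[OF big(1)] big(1) by (intro lp_bound_mono[OF 0]) (auto intro!: mL)
  have 2: "lp_bound q (Lavg k) (\<lambda>x. norm (?m k - ?m (k + j))) U"
  proof (rule lp_bound_mono[OF lp_bound_const[OF emeasure_Lavg, of _ _ "norm (?m k - ?m (k + j))"]])
    have "norm (?m k - ?m (k + j)) \<le> \<bar>of_int j\<bar> * (?P * (2 * (C * B)))" by (rule mean_dball_diff[OF b q bd])
    also have "\<dots> = (2 * ?P * \<bar>of_int j\<bar>) * (C * B)" by simp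
    also have "\<dots> \<le> U" using big(2) by (intro le mult_left_mono) auto
    finally show "\<bar>norm (?m k - ?m (k + j))\<bar> \<le> U" by simp
  qed auto
  have 3: "lp_bound q (Lavg k) (\<lambda>x. norm (b (A *v x) - ?m (k + j))) U"
  proof -
    have "lp_bound q (Lavg k) (\<lambda>x. norm (b (A *v x) - ?m (k + j))) (?\<rho> * (C * B))"
      using lp_bound_matrix[OF 0 _ A q] by simp
    moreover have "?\<rho> * (C * B) \<le> U" using big big2[OF big(3)] by (intro le) auto
    ultimately show ?thesis by (rule lp_bound_mono) (auto intro!: mL)
  qed
  have "lp_bound q (Lavg k) (\<lambda>x. norm (b x - b (A *v x))) (9 * U)"
  proof (rule lp_bound_add3[OF 1 2 3 q])
    show "(\<lambda>x. norm (b x - b (A *v x))) \<in> borel_measurable (Lavg k)" by (rule mL) measurable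
    have "norm (b x - b (A *v x)) \<le> norm (b x - ?m k) + norm (?m k - ?m (k + j)) + norm (b (A *v x) - ?m (k + j))" for x
      using norm_triangle_ineq[of "b x - ?m k" "?m k - ?m (k + j)"]
        norm_triangle_ineq4[of "b x - ?m k + (?m k - ?m (k + j))" "b (A *v x) - ?m (k + j)"] by simp
    then show "AE x in Lavg k. \<bar>norm (b x - b (A *v x))\<bar> \<le> \<bar>norm (b x - ?m k)\<bar> + \<bar>norm (?m k - ?m (k + j))\<bar> + \<bar>norm (b (A *v x) - ?m (k + j))\<bar>"
      by simp
  qed
  then show ?thesis by (simp add: U_def mult_ac)
qed

lemma lp_bound_commutator_kernel:
  fixes b f :: "'n heis \<Rightarrow> complex"
  assumes b: "loc_integrable b" and bm: "b \<in> borel_measurable borel"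
    and bd: "\<And>k. lp_bound q (Wavg k) (\<lambda>x. norm (b x - mean (dball k) b)) B"
    and fm: "f \<in> borel_measurable borel" and fd: "lp_bound q1 (Wavg (k + j)) (\<lambda>x. norm (f x)) D"
    and A: "det A \<noteq> 0" "\<And>x. x \<in> dball k \<Longrightarrow> A *v x \<in> dball (k + j)"
    and q: "1 \<le> q" "1 \<le> q1" "1 \<le> q2" "q2 \<noteq> \<infinity>"
    and exps: "enn2real q2 * recip q + enn2real q2 * recip q1 + 1 / r \<le> 1"
  shows "lp_bound q2 (Wavg k) (\<lambda>x. norm (b x - b (A *v x)) * norm (f (A *v x)))
    (108 * 2 powr Qdim TYPE('n) * C ^ 3 * B *
      ((1 + \<bar>of_int j\<bar>) * (1 + (2 powr (of_int j * Qdim TYPE('n)) / \<bar>det A\<bar>) powr recip q)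
       * (2 powr (of_int j * Qdim TYPE('n)) / \<bar>det A\<bar>) powr recip q1 * D))"
proof -
  have 1: "lp_bound q1 (Lavg k) (\<lambda>x. norm (f (A *v x))) ((2 powr (of_int j * Qdim TYPE('n)) / \<bar>det A\<bar>) powr recip q1 * (C * D))"
    by (rule lp_bound_matrix[OF lp_bound_Wavg_imp_Lavg[OF fd q(2)] _ A q(2)]) (use fm in measurable)
  show ?thesis
    using lp_bound_prod_Wavg[OF lp_bound_oscillation[OF b bm q(1) bd A] 1 q exps]
    by (simp add: power3_eq_cube mult_ac del: distrib_left_numeral)
qed

section \<open>From shells to balls\<close>

text \<open>The weighted measure on a shell, in whose \<open>L\<^sup>q\<close> norms the Herz norm is expressed.\<close>

definition Wshell :: "int \<Rightarrow> 'n heis measure" where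
  "Wshell l = density lebesgue (\<lambda>x. ennreal (w x) * indicator (dshell l) x)"

lemma sets_Wshell [simp, measurable_cong]: "sets (Wshell l) = sets lebesgue"
  by (simp add: Wshell_def)

lemma AE_Wshell: "(AE x in Wshell l. P x) \<longleftrightarrow> (AE x in lebesgue. x \<in> dshell l \<longrightarrow> P x)"
proof -
  have "(AE x in Wshell l. P x) \<longleftrightarrow> (AE x in lebesgue. 0 < ennreal (w x) * indicator (dshell l) x \<longrightarrow> P x)"
    unfolding Wshell_def by (rule AE_density) measurable
  also have "\<dots> \<longleftrightarrow> (AE x in lebesgue. x \<in> dshell l \<longrightarrow> P x)"
    using w_pos_AE by (auto elim!: AE_mp simp: indicator_def)
  finally show ?thesis .
qed

lemma nn_integral_Wshell:
  assumes [measurable]: "g \<in> borel_measurable lebesgue"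
  shows "(\<integral>\<^sup>+x. g x \<partial>Wshell l) = (\<integral>\<^sup>+x. g x * ennreal (w x) * indicator (dshell l) x \<partial>lebesgue)"
  unfolding Wshell_def by (subst nn_integral_density) (auto simp: mult_ac)

text \<open>A ball is the disjoint union of its shells and the origin. For finite \<open>q = t\<close> the powers of the bounds add
  up to at most \<open>\<Sum> F S^{t-1} = S^t\<close>, where \<open>F \<le> S\<close> termwise.\<close>

lemma lp_bound_Wavg_of_shells:
  fixes f :: "'n heis \<Rightarrow> complex"
  assumes f: "\<And>l. lp_bound q (Wshell l) (\<lambda>x. norm (f x)) (F l)" and q: "1 \<le> q"
    and S: "(\<lambda>m. F (k - int m)) sums S"
  shows "lp_bound q (Wavg k) (\<lambda>x. norm (f x)) (W k powr (- recip q) * S)"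
proof -
  have F: "0 \<le> F l" for l using f by (rule lp_bound_nonneg)
  have S0: "0 \<le> S" by (rule sums_le[OF _ sums_zero S]) (rule F)
  have FS: "F (k - int m) \<le> S" for m
    using S F sum_le_suminf[of "\<lambda>m. F (k - int m)" "{m}"] by (auto simp: sums_iff)
  have [measurable]: "(\<lambda>x. norm (f x)) \<in> borel_measurable lebesgue"
    using lp_bound_measurable[OF f[of 0]] by (simp add: measurable_cong_sets[OF sets_Wshell refl])
  have Wk: "0 < W k" by (rule wvol_pos)
  have x0: "AE x in lebesgue. x \<noteq> (0 :: 'n heis)"
    using AE_lborel_singleton[of "0 :: 'n heis"] by (simp add: AE_completion_iff)
  show ?thesis
  proof (cases "q = \<infinity>")
    case True
    have "AE x in lebesgue. \<forall>m. x \<in> dshell (k - int m) \<longrightarrow> norm (f x) \<le> F (k - int m)"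
      unfolding AE_all_countable using f True by (auto simp: lp_bound_def AE_Wshell)
    with x0 have "AE x in lebesgue. x \<in> dball k \<longrightarrow> norm (f x) \<le> S"
    proof eventually_elim
      fix x :: "'n heis" assume "x \<noteq> 0" "\<forall>m. x \<in> dshell (k - int m) \<longrightarrow> norm (f x) \<le> F (k - int m)"
      then show "x \<in> dball k \<longrightarrow> norm (f x) \<le> S"
        using dball_subset_shells[of x k] FS by (meson order_trans)
    qed
    then show ?thesis using True S0 Wk
      by (simp add: lp_bound_def AE_Wavg measurable_Wavg recip_infinity[unfolded infinity_ennreal_def])
  next
    case False
    define t where "t = enn2real q"
    have t: "1 \<le> t" "recip q = 1 / t" using enn2real_exponent[OF q False] by (auto simp: t_def)
    let ?g = "\<lambda>x. ennreal (\<bar>norm (f x)\<bar> powr t)"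
    have "(\<integral>\<^sup>+x. ?g x * ennreal (w x) * indicator (dball k) x \<partial>lebesgue)
       \<le> (\<integral>\<^sup>+x. (\<Sum>m. ?g x * ennreal (w x) * indicator (dshell (k - int m)) x) \<partial>lebesgue)"
    proof (rule nn_integral_mono_AE, use x0 in eventually_elim)
      fix x :: "'n heis" assume "x \<noteq> 0"
      show "?g x * ennreal (w x) * indicator (dball k) x \<le> (\<Sum>m. ?g x * ennreal (w x) * indicator (dshell (k - int m)) x)"
      proof (cases "x \<in> dball k")
        case True
        then obtain m where "x \<in> dshell (k - int m)" using dball_subset_shells \<open>x \<noteq> 0\<close> by blast
        then have "?g x * ennreal (w x) * indicator (dball k) x = (\<Sum>m\<in>{m}. ?g x * ennreal (w x) * indicator (dshell (k - int m)) x)"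
          using True by simp
        also have "\<dots> \<le> (\<Sum>m. ?g x * ennreal (w x) * indicator (dshell (k - int m)) x)"
          by (intro sum_le_suminf summableI) auto
        finally show ?thesis .
      qed simp
    qed
    also have "\<dots> = (\<Sum>m. \<integral>\<^sup>+x. ?g x * ennreal (w x) * indicator (dshell (k - int m)) x \<partial>lebesgue)"
      by (rule nn_integral_suminf) measurable
    also have "\<dots> \<le> (\<Sum>m. ennreal (S powr (t - 1)) * ennreal (F (k - int m)))"
    proof (intro suminf_le summableI)
      fix m
      let ?F = "F (k - int m)"
      have "(\<integral>\<^sup>+x. ?g x * ennreal (w x) * indicator (dshell (k - int m)) x \<partial>lebesgue) = (\<integral>\<^sup>+x. ?g x \<partial>Wshell (k - int m))"
        by (rule nn_integral_Wshell[symmetric]) measurable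
      also have "\<dots> \<le> ennreal (?F powr t)" using f[of "k - int m"] False by (simp add: lp_bound_def t_def)
      also have "?F powr t = ?F powr (t - 1) * ?F"
        using F[of "k - int m"] by (cases "?F = 0") (auto simp: powr_diff)
      also have "ennreal \<dots> \<le> ennreal (S powr (t - 1) * ?F)"
        using F FS[of m] t by (intro ennreal_leI mult_right_mono powr_mono2) auto
      finally show "(\<integral>\<^sup>+x. ?g x * ennreal (w x) * indicator (dshell (k - int m)) x \<partial>lebesgue) \<le> ennreal (S powr (t - 1)) * ennreal ?F"
        using F by (simp add: ennreal_mult)
    qed
    also have "\<dots> = ennreal (S powr (t - 1)) * (\<Sum>m. ennreal (F (k - int m)))" by (rule ennreal_suminf_cmult)
    also have "(\<Sum>m. ennreal (F (k - int m))) = ennreal S"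
      using S F by (subst suminf_ennreal2) (auto simp: sums_iff)
    also have "ennreal (S powr (t - 1)) * ennreal S = ennreal (S powr t)"
      using S0 by (cases "S = 0") (auto simp: powr_diff simp flip: ennreal_mult)
    finally have *: "(\<integral>\<^sup>+x. ?g x * ennreal (w x) * indicator (dball k) x \<partial>lebesgue) \<le> ennreal (S powr t)" .
    have "(\<integral>\<^sup>+x. ?g x \<partial>Wavg k) = ennreal (1 / W k) * (\<integral>\<^sup>+x. ?g x * ennreal (w x) * indicator (dball k) x \<partial>lebesgue)"
      by (rule nn_integral_Wavg) measurable
    also have "\<dots> \<le> ennreal (1 / W k) * ennreal (S powr t)" using * by (intro mult_left_mono) auto
    also have "\<dots> = ennreal ((W k powr (- recip q) * S) powr t)"
    proof -
      have "(W k powr (- recip q) * S) powr t = (W k powr (- recip q)) powr t * S powr t"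
        by (rule powr_mult)
      also have "(W k powr (- recip q)) powr t = W k powr (- 1)" using t by (simp add: powr_powr)
      also have "\<dots> = 1 / W k" using Wk by (simp add: powr_minus_divide)
      finally have "(W k powr (- recip q) * S) powr t = 1 / W k * S powr t" .
      then show ?thesis using Wk by (simp flip: ennreal_mult)
    qed
    finally show ?thesis using False S0 by (simp add: lp_bound_def measurable_Wavg t_def)
  qed
qed

end

section \<open>The norms of the function spaces as norm bounds\<close>

lemma epowr_eq: "0 < u \<Longrightarrow> epowr (ennreal u) a = ennreal (u powr a)"
  by (simp add: epowr_def ennreal_eq_0_iff)

lemma epowr_eq_nonneg: "0 \<le> u \<Longrightarrow> 0 < a \<Longrightarrow> epowr (ennreal u) a = ennreal (u powr a)"
  by (cases "u = 0") (auto simp: epowr_eq epowr_def)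

text \<open>Sums over the shells become integrals, so that Minkowski's inequality also covers the sequence space.\<close>

lemma infsum_int_nn_integral:
  fixes f :: "int \<Rightarrow> ennreal"
  shows "(\<Sum>\<^sub>\<infinity>k\<in>UNIV. f k) = (\<integral>\<^sup>+k. f k \<partial>count_space UNIV)"
proof (rule antisym)
  have eq: "(\<Sum>\<^sub>\<infinity>k\<in>UNIV. f k) = (SUP F\<in>{F. finite F \<and> F \<subseteq> UNIV}. sum f F)"
    by (rule nonneg_infsum_complete) simp
  show "(\<Sum>\<^sub>\<infinity>k\<in>UNIV. f k) \<le> (\<integral>\<^sup>+k. f k \<partial>count_space UNIV)"
    unfolding eq
  proof (rule SUP_least)
    fix F :: "int set" assume "F \<in> {F. finite F \<and> F \<subseteq> UNIV}"
    then have F: "finite F" by simp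
    have "sum f F = (\<Sum>k\<in>F. f k * indicator F k)" by (intro sum.cong) auto
    also have "\<dots> = (\<integral>\<^sup>+k. f k * indicator F k \<partial>count_space UNIV)"
      using F by (intro nn_integral_count_space'[symmetric]) auto
    also have "\<dots> \<le> (\<integral>\<^sup>+k. f k \<partial>count_space UNIV)"
      by (intro nn_integral_mono) (auto simp: indicator_def)
    finally show "sum f F \<le> (\<integral>\<^sup>+k. f k \<partial>count_space UNIV)" .
  qed
  have "(\<integral>\<^sup>+k. f k \<partial>count_space UNIV) = (\<integral>\<^sup>+n. f (int_decode n) \<partial>count_space UNIV)"
    by (rule nn_integral_bij_count_space[symmetric]) (rule bij_int_decode)
  also have "\<dots> = (\<Sum>n. f (int_decode n))" by (rule nn_integral_count_space_nat)
  also have "\<dots> = (SUP n. \<Sum>i<n. f (int_decode i))" by (rule suminf_eq_SUP)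
  also have "\<dots> \<le> (SUP F\<in>{F. finite F \<and> F \<subseteq> UNIV}. sum f F)"
  proof (rule SUP_least)
    fix n
    have "(\<Sum>i<n. f (int_decode i)) = sum f (int_decode ` {..<n})"
      by (subst sum.reindex) (auto intro: inj_int_decode)
    also have "\<dots> \<le> (SUP F\<in>{F. finite F \<and> F \<subseteq> UNIV}. sum f F)" by (rule SUP_upper) auto
    finally show "(\<Sum>i<n. f (int_decode i)) \<le> (SUP F\<in>{F. finite F \<and> F \<subseteq> UNIV}. sum f F)" .
  qed
  finally show "(\<integral>\<^sup>+k. f k \<partial>count_space UNIV) \<le> (\<Sum>\<^sub>\<infinity>k\<in>UNIV. f k)" unfolding eq .
qed

context dyadic_weight
begin

lemma lp_bound_Wshell_iff:
  fixes f :: "'n heis \<Rightarrow> complex"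
  assumes [measurable]: "f \<in> borel_measurable lebesgue" and U: "0 \<le> U" and q: "1 \<le> q"
  shows "lp_bound q (Wshell l) (\<lambda>x. norm (f x)) U \<longleftrightarrow> Lq_norm q (dshell l) w f \<le> ennreal U"
proof (cases "q = \<infinity>")
  case True
  let ?g = "\<lambda>x. ennreal (norm (f x)) * indicator (dshell l) x"
  have "Lq_norm q (dshell l) w f \<le> ennreal U \<longleftrightarrow> (AE x in lebesgue. ?g x \<le> ennreal U)"
  proof
    assume le: "Lq_norm q (dshell l) w f \<le> ennreal U"
    show "AE x in lebesgue. ?g x \<le> ennreal U"
      using esssup_AE[where f="?g" and M=lebesgue]
      by eventually_elim (use le True in \<open>auto simp: Lq_norm_def intro: order_trans\<close>)
  next
    assume "AE x in lebesgue. ?g x \<le> ennreal U"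
    then have "esssup lebesgue ?g \<le> ennreal U" by (intro esssup_I) measurable
    then show "Lq_norm q (dshell l) w f \<le> ennreal U" using True by (simp add: Lq_norm_def)
  qed
  also have "\<dots> \<longleftrightarrow> (AE x in lebesgue. x \<in> dshell l \<longrightarrow> norm (f x) \<le> U)"
    using U by (intro AE_cong) (auto simp: indicator_def)
  finally show ?thesis using True U
    by (simp add: lp_bound_def AE_Wshell measurable_cong_sets[OF sets_Wshell refl])
next
  case False
  define t where "t = enn2real q"
  have t: "1 \<le> t" using enn2real_exponent[OF q False] by (simp add: t_def)
  have "(\<integral>\<^sup>+x. ennreal (\<bar>norm (f x)\<bar> powr t) \<partial>Wshell l) = (\<integral>\<^sup>+x\<in>dshell l. ennreal (norm (f x) powr t * w x) \<partial>lebesgue)"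
    using w_nonneg by (subst nn_integral_Wshell) (auto intro!: nn_integral_cong simp: ennreal_mult)
  moreover have "Lq_norm q (dshell l) w f \<le> ennreal U \<longleftrightarrow> (\<integral>\<^sup>+x\<in>dshell l. ennreal (norm (f x) powr t * w x) \<partial>lebesgue) \<le> ennreal (U powr t)"
    unfolding Lq_norm_def using False t U by (simp add: t_def[symmetric] epowr_le_iff_powr)
  ultimately show ?thesis using False U
    by (simp add: lp_bound_def t_def measurable_cong_sets[OF sets_Wshell refl])
qed

text \<open>The dyadic radii among those in the definition of the norm suffice.\<close>

lemma lp_bound_of_cmo:
  fixes b :: "'n heis \<Rightarrow> complex"
  assumes [measurable]: "b \<in> borel_measurable lebesgue" and q: "1 \<le> q" and B: "cmo_norm q w b \<le> ennreal B" "0 \<le> B"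
  shows "lp_bound q (Wavg k) (\<lambda>x. norm (b x - mean (dball k) b)) B"
proof -
  let ?m = "mean (dball k) b"
  have le: "(if q = \<infinity> then esssup lebesgue (\<lambda>x. ennreal (norm (b x - ?m)) * indicator (dball k) x)
        else epowr ((\<integral>\<^sup>+x\<in>dball k. ennreal (norm (b x - ?m) powr enn2real q * w x) \<partial>lebesgue) / wmeas w (dball k))
          (1 / enn2real q)) \<le> ennreal B"
    using B(1) unfolding cmo_norm_def SUP_le_iff
    by (drule_tac bspec[of _ _ "2 powi k"]) (auto simp: dball_eq_hball)
  show ?thesis
  proof (cases "q = \<infinity>")
    case True
    let ?g = "\<lambda>x. ennreal (norm (b x - ?m)) * indicator (dball k) x"
    have "AE x in lebesgue. ?g x \<le> ennreal B"
      using esssup_AE[where f="?g" and M=lebesgue] by eventually_elim (use le True in \<open>auto intro: order_trans\<close>)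
    then have "AE x in lebesgue. x \<in> dball k \<longrightarrow> norm (b x - ?m) \<le> B"
      by eventually_elim (use B in \<open>auto simp: indicator_def\<close>)
    then show ?thesis using True B by (simp add: lp_bound_def AE_Wavg measurable_Wavg)
  next
    case False
    define t where "t = enn2real q"
    have t: "1 \<le> t" using enn2real_exponent[OF q False] by (simp add: t_def)
    have "(\<integral>\<^sup>+x. ennreal (\<bar>norm (b x - ?m)\<bar> powr t) \<partial>Wavg k)
      = ennreal (1 / W k) * (\<integral>\<^sup>+x\<in>dball k. ennreal (norm (b x - ?m) powr t * w x) \<partial>lebesgue)"
      using w_nonneg by (subst nn_integral_Wavg) (auto intro!: nn_integral_cong simp: ennreal_mult)
    also have "\<dots> = (\<integral>\<^sup>+x\<in>dball k. ennreal (norm (b x - ?m) powr t * w x) \<partial>lebesgue) / wmeas w (dball k)"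
      using wvol_pos[of k] by (simp add: wmeas_dball divide_ennreal_def inverse_ennreal inverse_eq_divide mult.commute)
    also have "\<dots> \<le> ennreal (B powr t)" using le False t B by (simp add: t_def[symmetric] epowr_le_iff_powr)
    finally show ?thesis using False B by (simp add: lp_bound_def measurable_Wavg t_def)
  qed
qed

lemma epowr_wmeas: "epowr (wmeas w (dball k)) a = ennreal (W k powr a)"
  unfolding wmeas_dball by (rule epowr_eq) (rule wvol_pos)

lemma herz_norm_le:
  assumes p: "1 \<le> p" and G: "\<And>k. Lq_norm q (dshell k) w f \<le> ennreal (G k)" "\<And>k. 0 \<le> G k"
    and bd: "lp_bound p (count_space UNIV) (\<lambda>k. W k powr (\<alpha> / Qdim TYPE('n)) * G k) U"
  shows "herz_norm \<alpha> p q w f \<le> ennreal U"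
proof (cases "p = \<infinity>")
  case True
  have "W k powr (\<alpha> / Qdim TYPE('n)) * G k \<le> U" for k

  proof -
    have "\<bar>W k powr (\<alpha> / Qdim TYPE('n)) * G k\<bar> \<le> U"
      using bd True by (simp add: lp_bound_def AE_count_space)
    then show ?thesis by (rule abs_le_D1)
  qed
  then have "epowr (wmeas w (dball k)) (\<alpha> / Qdim TYPE('n)) * Lq_norm q (dshell k) w f \<le> ennreal U" for k
  proof -
    have "epowr (wmeas w (dball k)) (\<alpha> / Qdim TYPE('n)) * Lq_norm q (dshell k) w f
      \<le> ennreal (W k powr (\<alpha> / Qdim TYPE('n))) * ennreal (G k)"
      unfolding epowr_wmeas by (intro mult_left_mono G) auto
    also have "\<dots> = ennreal (W k powr (\<alpha> / Qdim TYPE('n)) * G k)" using G(2) by (simp add: ennreal_mult)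
    also have "\<dots> \<le> ennreal U" by (intro ennreal_leI) fact
    finally show ?thesis .
  qed
  then show ?thesis unfolding herz_norm_def using True by (auto intro!: SUP_least)
next
  case False
  define t where "t = enn2real p"
  have t: "1 \<le> t" using enn2real_exponent[OF p False] by (simp add: t_def)
  have U: "0 \<le> U" using bd by (rule lp_bound_nonneg)
  have term_le: "epowr (wmeas w (dball k)) (\<alpha> * t / Qdim TYPE('n)) * epowr (Lq_norm q (dshell k) w f) t
     \<le> ennreal (\<bar>W k powr (\<alpha> / Qdim TYPE('n)) * G k\<bar> powr t)" for k
  proof -
    have "epowr (Lq_norm q (dshell k) w f) t \<le> ennreal (G k powr t)"
    proof (cases "Lq_norm q (dshell k) w f")
      case (real u)
      then have "u \<le> G k" using G[of k] by simp
      then show ?thesis unfolding real(2) using real(1) t by (subst epowr_eq_nonneg) (auto intro!: ennreal_leI powr_mono2)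
    next
      case top
      then show ?thesis using G(1)[of k] by (simp add: top_unique)
    qed
    then have "epowr (wmeas w (dball k)) (\<alpha> * t / Qdim TYPE('n)) * epowr (Lq_norm q (dshell k) w f) t
      \<le> ennreal (W k powr (\<alpha> * t / Qdim TYPE('n))) * ennreal (G k powr t)"
      unfolding epowr_wmeas by (intro mult_left_mono) auto
    also have "\<dots> = ennreal (\<bar>W k powr (\<alpha> / Qdim TYPE('n)) * G k\<bar> powr t)"
      using G(2)[of k] by (simp add: abs_mult powr_mult powr_powr flip: ennreal_mult)
    finally show ?thesis .
  qed
  have "(\<Sum>\<^sub>\<infinity>k\<in>UNIV. epowr (wmeas w (dball k)) (\<alpha> * t / Qdim TYPE('n)) * epowr (Lq_norm q (dshell k) w f) t)
     \<le> (\<integral>\<^sup>+k. ennreal (\<bar>W k powr (\<alpha> / Qdim TYPE('n)) * G k\<bar> powr t) \<partial>count_space UNIV)"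
    unfolding infsum_int_nn_integral by (intro nn_integral_mono term_le)
  also have "\<dots> \<le> ennreal (U powr t)" using bd False by (simp add: lp_bound_def t_def)
  finally show ?thesis
    unfolding herz_norm_def using False t U by (simp add: t_def[symmetric] epowr_le_iff_powr)
qed

lemma herz_norm_lp_bound:
  assumes p: "1 \<le> p" and fin: "herz_norm \<alpha> p q w f < \<infinity>"
  shows "Lq_norm q (dshell k) w f < \<infinity>"
    and "lp_bound p (count_space UNIV)
      (\<lambda>k. W k powr (\<alpha> / Qdim TYPE('n)) * enn2real (Lq_norm q (dshell k) w f)) (enn2real (herz_norm \<alpha> p q w f))"
proof -
  let ?H = "herz_norm \<alpha> p q w f" and ?N = "\<lambda>k. Lq_norm q (dshell k) w f" and ?a = "\<lambda>k. W k powr (\<alpha> / Qdim TYPE('n))"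
  have a: "0 < ?a k" for k using wvol_pos[of k] by simp
  have H: "?H = ennreal (enn2real ?H)" using fin by (simp add: less_top)
  have "(\<forall>k. ?N k < \<infinity>) \<and> lp_bound p (count_space UNIV) (\<lambda>k. ?a k * enn2real (?N k)) (enn2real ?H)"
  proof (cases "p = \<infinity>")
    case True
    have le: "ennreal (?a k) * ?N k \<le> ?H" for k
      unfolding herz_norm_def using True by (auto simp: epowr_wmeas intro: SUP_upper2[of k])
    have N: "?N k < \<infinity>" for k
    proof (rule ccontr)
      assume "\<not> ?thesis"
      then have "?N k = \<infinity>" by (simp flip: less_top)
      then have "?H = \<infinity>" using le[of k] a[of k] by (simp add: ennreal_mult_top top_unique)
      then show False using fin by simp
    qed
    have "?a k * enn2real (?N k) \<le> enn2real ?H" for k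
    proof -
      have "ennreal (?a k * enn2real (?N k)) = ennreal (?a k) * ?N k" using N[of k] by (simp add: ennreal_mult less_top)
      also have "\<dots> \<le> ennreal (enn2real ?H)" using le[of k] H by simp
      finally show ?thesis by simp
    qed
    then show ?thesis using True N by (auto simp: lp_bound_def AE_count_space abs_mult)
  next
    case False
    define t where "t = enn2real p"
    have t: "1 \<le> t" using enn2real_exponent[OF p False] by (simp add: t_def)
    let ?T = "\<lambda>k. ennreal (W k powr (\<alpha> * t / Qdim TYPE('n))) * epowr (?N k) t"
    have "epowr (\<Sum>\<^sub>\<infinity>k\<in>UNIV. ?T k) (1 / t) = ?H"
      unfolding herz_norm_def using False by (simp add: t_def[symmetric] epowr_wmeas)
    then have "epowr (\<Sum>\<^sub>\<infinity>k\<in>UNIV. ?T k) (1 / t) \<le> ennreal (enn2real ?H)" using H by simp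
    then have le: "(\<integral>\<^sup>+k. ?T k \<partial>count_space UNIV) \<le> ennreal (enn2real ?H powr t)"
      using t by (simp add: epowr_le_iff_powr infsum_int_nn_integral)
    have N: "?N k < \<infinity>" for k
    proof (rule ccontr)
      assume "\<not> ?thesis"
      then have "?N k = \<infinity>" by (simp flip: less_top)
      then have "?T k = \<infinity>" using wvol_pos[of k] t by (simp add: epowr_def ennreal_mult_top)
      moreover have "?T k \<le> (\<integral>\<^sup>+k. ?T k \<partial>count_space UNIV)"
        by (rule nn_integral_ge_point) simp
      ultimately have "ennreal (enn2real ?H powr t) = \<infinity>" using le by (simp add: top_unique)
      then show False by simp
    qed
    have "ennreal (\<bar>?a k * enn2real (?N k)\<bar> powr t) = ?T k" for k
    proof -
      have "?N k = ennreal (enn2real (?N k))" using N[of k] by (simp add: less_top)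
      then have "epowr (?N k) t = ennreal (enn2real (?N k) powr t)"
        using t by (metis epowr_eq_nonneg enn2real_nonneg less_le_trans zero_less_one)
      then show ?thesis by (simp add: abs_mult powr_mult powr_powr flip: ennreal_mult)
    qed
    then show ?thesis using False N le by (simp add: lp_bound_def t_def)
  qed
  then show "?N k < \<infinity>" "lp_bound p (count_space UNIV) (\<lambda>k. ?a k * enn2real (?N k)) (enn2real ?H)"
    by auto
qed

end

section \<open>Geometric tails and growth of the weighted volume\<close>

lemma sigma_finite_count_int: "sigma_finite_measure (count_space (UNIV :: int set))"
  and sigma_finite_count_nat: "sigma_finite_measure (count_space (UNIV :: nat set))"
  by (rule sigma_finite_measure_count_space_countable; simp)+

lemma lp_bound_count_pointwise:
  assumes "lp_bound p (count_space UNIV) a H" "1 \<le> p"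
  shows "\<bar>a k\<bar> \<le> H"
proof (cases "p = \<infinity>")
  case True
  then show ?thesis using assms by (simp add: lp_bound_def AE_count_space)
next
  case False
  define t where "t = enn2real p"
  have t: "1 \<le> t" using enn2real_exponent[OF assms(2) False] by (simp add: t_def)
  have H: "0 \<le> H" using assms(1) by (rule lp_bound_nonneg)
  have "ennreal (\<bar>a k\<bar> powr t) \<le> (\<integral>\<^sup>+k. ennreal (\<bar>a k\<bar> powr t) \<partial>count_space UNIV)"
    by (rule nn_integral_ge_point) simp
  also have "\<dots> \<le> ennreal (H powr t)" using assms(1) False by (simp add: lp_bound_def t_def)
  finally have "\<bar>a k\<bar> powr t \<le> H powr t" by simp
  then show ?thesis using t H by (metis abs_ge_zero less_le_trans not_le powr_less_mono2 zero_less_one)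
qed

lemma lp_bound_count_shift:
  fixes a :: "int \<Rightarrow> real"
  assumes "lp_bound p (count_space UNIV) a H"
  shows "lp_bound p (count_space UNIV) (\<lambda>k. a (k - m)) H"
proof (cases "p = \<infinity>")
  case True
  then show ?thesis using assms by (simp add: lp_bound_def AE_count_space)
next
  case False
  have "bij (\<lambda>k. k - m)" by (rule bij_betw_byWitness[where f'="\<lambda>k. k + m"]) auto
  then have "(\<integral>\<^sup>+k. ennreal (\<bar>a (k - m)\<bar> powr enn2real p) \<partial>count_space UNIV)
    = (\<integral>\<^sup>+k. ennreal (\<bar>a k\<bar> powr enn2real p) \<partial>count_space UNIV)"
    by (rule nn_integral_bij_count_space)
  then show ?thesis using assms False by (simp add: lp_bound_def)
qed

text \<open>The weighted sum over all shells inside \<open>B\<^sub>k\<close>; a convolution of \<open>a\<close> with a one-sided geometric sequence.\<close>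

definition geom_tail :: "real \<Rightarrow> (int \<Rightarrow> real) \<Rightarrow> int \<Rightarrow> real" where
  "geom_tail \<theta> a k = (\<Sum>m. \<theta> ^ m * a (k - int m))"

lemma
  assumes a: "lp_bound p (count_space UNIV) a H" "\<And>k. 0 \<le> a k" and p: "1 \<le> p" and \<theta>: "0 < \<theta>" "\<theta> < 1"
  shows geom_tail_summable: "summable (\<lambda>m. \<theta> ^ m * a (k - int m))"
    and geom_tail_nonneg: "0 \<le> geom_tail \<theta> a k"
    and lp_bound_geom_tail: "lp_bound p (count_space UNIV) (geom_tail \<theta> a) (2 * (H / (1 - \<theta>)))"
proof -
  have aH: "a k \<le> H" for k using lp_bound_count_pointwise[OF a(1) p, of k] a(2) by simp
  have H: "0 \<le> H" using a(1) by (rule lp_bound_nonneg)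
  have geo: "summable (\<lambda>m. \<theta> ^ m * H)" using \<theta> by (intro summable_mult2 summable_geometric) auto
  show sm: "summable (\<lambda>m. \<theta> ^ m * a (k - int m))" for k
    by (rule summable_comparison_test'[OF geo, of 0])
       (use \<theta> a(2) aH in \<open>auto simp: abs_mult intro!: mult_left_mono\<close>)
  then show "0 \<le> geom_tail \<theta> a k" for k
    unfolding geom_tail_def using \<theta> a by (intro suminf_nonneg) auto
  have "(\<integral>\<^sup>+m. ennreal (\<theta> ^ m * H) \<partial>count_space UNIV) = (\<Sum>m. ennreal (\<theta> ^ m * H))"
    by (rule nn_integral_count_space_nat)
  also have "\<dots> = ennreal (\<Sum>m. \<theta> ^ m * H)" using geo \<theta> H by (intro suminf_ennreal2) auto
  also have "(\<Sum>m. \<theta> ^ m * H) = H / (1 - \<theta>)"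
    using \<theta> by (simp add: suminf_mult2[symmetric] suminf_geometric)
  finally have S: "(\<integral>\<^sup>+m. ennreal (\<theta> ^ m * H) \<partial>count_space UNIV) \<le> ennreal (H / (1 - \<theta>))" by simp
  have h: "enn2real (\<integral>\<^sup>+m. ennreal (\<theta> ^ m * a (k - int m)) \<partial>count_space UNIV) = geom_tail \<theta> a k" for k
  proof -
    have "(\<integral>\<^sup>+m. ennreal (\<theta> ^ m * a (k - int m)) \<partial>count_space UNIV) = (\<Sum>m. ennreal (\<theta> ^ m * a (k - int m)))"
      by (rule nn_integral_count_space_nat)
    also have "\<dots> = ennreal (geom_tail \<theta> a k)"
      unfolding geom_tail_def using sm[of k] \<theta> a(2) by (intro suminf_ennreal2) auto
    finally show ?thesis using \<open>0 \<le> geom_tail \<theta> a k\<close> by simp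
  qed
  have "lp_bound p (count_space UNIV)
     (\<lambda>k. enn2real (\<integral>\<^sup>+m. ennreal (\<theta> ^ m * a (k - int m)) \<partial>count_space UNIV)) (2 * (H / (1 - \<theta>)))"
  proof (rule conjunct2[OF lp_bound_Minkowski[OF sigma_finite_count_int sigma_finite_count_nat _ _ _ _ p S]])
    show "(\<lambda>(k, m). \<theta> ^ m * a (k - int m)) \<in> borel_measurable (count_space UNIV \<Otimes>\<^sub>M count_space UNIV)"
      by (simp add: pair_measure_countable)
    show "AE m in count_space UNIV. lp_bound p (count_space UNIV) (\<lambda>k. \<theta> ^ m * a (k - int m)) (\<theta> ^ m * H)"
    proof (rule AE_I2)
      fix m
      show "lp_bound p (count_space UNIV) (\<lambda>k. \<theta> ^ m * a (k - int m)) (\<theta> ^ m * H)"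
        using lp_bound_cmult[OF lp_bound_count_shift[OF a(1), of "int m"], of "\<theta> ^ m"] \<theta> by simp
    qed
  qed (use \<theta> a H in auto)
  then show "lp_bound p (count_space UNIV) (geom_tail \<theta> a) (2 * (H / (1 - \<theta>)))" unfolding h .
qed

context dyadic_weight
begin

text \<open>As \<open>\<alpha> < 0\<close>, reverse doubling becomes decay towards the origin.\<close>

lemma wvol_ratio_tail:
  assumes "\<alpha> < 0"
  shows "(W k / W (k - int m)) powr (\<alpha> / Qdim TYPE('n))
    \<le> (2 * C) powr (- \<alpha> / Qdim TYPE('n)) * (2 powr ((1 - 1 / r) * \<alpha>)) ^ m"
proof -
  let ?Q = "Qdim TYPE('n)"
  have Q: "0 < ?Q" by (rule Qdim_pos)
  have W: "0 < W k" "0 < W (k - int m)" by (rule wvol_pos)+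
  have "W (k - int m) / W k \<le> 2 * C * 2 powr (- real m * ?Q * (1 - 1 / r))"
    using wvol_reverse_doubling[of "k - int m" k] W by (simp add: divide_simps)
  then have "(W (k - int m) / W k) powr (- \<alpha> / ?Q) \<le> (2 * C * 2 powr (- real m * ?Q * (1 - 1 / r))) powr (- \<alpha> / ?Q)"
    using assms Q W by (intro powr_mono2) (auto simp: divide_nonpos_pos)
  also have "\<dots> = (2 * C) powr (- \<alpha> / ?Q) * (2 powr (- real m * ?Q * (1 - 1 / r))) powr (- \<alpha> / ?Q)"
    by (rule powr_mult)
  also have "(2 powr (- real m * ?Q * (1 - 1 / r))) powr (- \<alpha> / ?Q) = (2 powr ((1 - 1 / r) * \<alpha>)) ^ m"
  proof -
    have "- real m * ?Q * (1 - 1 / r) * (- \<alpha> / ?Q) = (1 - 1 / r) * \<alpha> * real m" using Q by (simp add: field_simps)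
    then show ?thesis by (simp only: powr_powr powr_realpow[symmetric] zero_less_numeral powr_gt_zero)
  qed
  also have "(W (k - int m) / W k) powr (- \<alpha> / ?Q) = (W k / W (k - int m)) powr (\<alpha> / ?Q)"
    using W by (simp add: powr_divide powr_minus divide_simps)
  finally show ?thesis .
qed

lemma wvol_ratio_powr_le:
  assumes "0 < \<beta> \<Longrightarrow> W k \<le> 2 * C * 2 powr E * W l" and "\<beta> < 0 \<Longrightarrow> W l \<le> 2 * C * 2 powr (- E) * W k"
  shows "(W k / W l) powr \<beta> \<le> (2 * C) powr \<bar>\<beta>\<bar> * 2 powr (E * \<beta>)"
proof -
  have W: "0 < W k" "0 < W l" by (rule wvol_pos)+
  consider "0 < \<beta>" | "\<beta> = 0" | "\<beta> < 0" by linarith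
  then show ?thesis
  proof cases
    case 1
    have "(W k / W l) powr \<beta> \<le> (2 * C * 2 powr E) powr \<beta>"
      using assms(1)[OF 1] W 1 by (intro powr_mono2) (auto simp: divide_simps)
    also have "\<dots> = (2 * C) powr \<bar>\<beta>\<bar> * 2 powr (E * \<beta>)" using 1 by (simp only: powr_mult powr_powr abs_of_pos)
    finally show ?thesis .
  next
    case 2
    then show ?thesis using W C by simp
  next
    case 3
    have "(W k / W l) powr \<beta> = (W l / W k) powr (- \<beta>)"
      using W by (simp add: powr_divide powr_minus divide_simps)
    also have "\<dots> \<le> (2 * C * 2 powr (- E)) powr (- \<beta>)"
      using assms(2)[OF 3] W 3 by (intro powr_mono2) (auto simp: divide_simps)
    also have "\<dots> = (2 * C) powr \<bar>\<beta>\<bar> * 2 powr (- E * - \<beta>)" using 3 by (simp only: powr_mult powr_powr abs_of_neg)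
    finally show ?thesis by simp
  qed
qed

text \<open>The four exponents of \<open>\<parallel>A(y)\<parallel>\<close> in the two constants. If \<open>j\<close> and \<open>\<beta>\<close> have opposite signs, the ratio is
  controlled by doubling, which costs the full dimension and gives \<open>-\<alpha>\<close>; if the signs agree, it is
  controlled by reverse doubling, with the exponent \<open>1 - 1/r \<ge> (\<delta> - 1)/\<delta>\<close>.\<close>

lemma wvol_growth:
  fixes j :: int and \<alpha> s :: real
  assumes \<delta>: "1 < \<delta>" "\<delta> \<le> r"
  defines "\<beta> \<equiv> \<alpha> / Qdim TYPE('n) + s"
  shows "of_int j * \<beta> \<le> 0 \<Longrightarrow> (W k / W (k + j)) powr \<beta> * 2 powr (of_int j * Qdim TYPE('n) * s)
      \<le> (2 * C) powr \<bar>\<beta>\<bar> * 2 powr (of_int j * (- \<alpha>))"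
    and "0 \<le> of_int j * \<beta> \<Longrightarrow> (W k / W (k + j)) powr \<beta> * 2 powr (of_int j * Qdim TYPE('n) * s)
      \<le> (2 * C) powr \<bar>\<beta>\<bar> * 2 powr (of_int j * (Qdim TYPE('n) * s - (\<alpha> + Qdim TYPE('n) * s) * (\<delta> - 1) / \<delta>))"
proof -
  let ?Q = "Qdim TYPE('n)" and ?j = "of_int j :: real"
  have Q: "0 < ?Q" by (rule Qdim_pos)
  have Qb: "?Q * \<beta> = \<alpha> + ?Q * s" using Q by (simp add: \<beta>_def distrib_left)
  have W: "0 < W k" for k by (rule wvol_pos)
  have main: "(W k / W (k + j)) powr \<beta> * 2 powr (?j * ?Q * s) \<le> (2 * C) powr \<bar>\<beta>\<bar> * 2 powr e"
    if "0 < \<beta> \<Longrightarrow> W k \<le> 2 * C * 2 powr E * W (k + j)" "\<beta> < 0 \<Longrightarrow> W (k + j) \<le> 2 * C * 2 powr (- E) * W k"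
      "E * \<beta> + ?j * ?Q * s \<le> e" for E e
  proof -
    have "(W k / W (k + j)) powr \<beta> * 2 powr (?j * ?Q * s) \<le> (2 * C) powr \<bar>\<beta>\<bar> * 2 powr (E * \<beta>) * 2 powr (?j * ?Q * s)"
      by (intro mult_right_mono wvol_ratio_powr_le that(1,2)) auto
    also have "\<dots> = (2 * C) powr \<bar>\<beta>\<bar> * 2 powr (E * \<beta> + ?j * ?Q * s)" by (simp only: powr_add mult.assoc)
    also have "\<dots> \<le> (2 * C) powr \<bar>\<beta>\<bar> * 2 powr e" using that(3) by (intro mult_left_mono powr_mono) auto
    finally show ?thesis .
  qed
  have sign: "?j * \<beta> \<le> 0 \<Longrightarrow> 0 < \<beta> \<Longrightarrow> j \<le> 0" "?j * \<beta> \<le> 0 \<Longrightarrow> \<beta> < 0 \<Longrightarrow> 0 \<le> j"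
    "0 \<le> ?j * \<beta> \<Longrightarrow> 0 < \<beta> \<Longrightarrow> 0 \<le> j" "0 \<le> ?j * \<beta> \<Longrightarrow> \<beta> < 0 \<Longrightarrow> j \<le> 0"
    by (auto simp: mult_le_0_iff zero_le_mult_iff)
  have dbl: "W b \<le> 2 * C * 2 powr (of_int (b - a) * ?Q) * W a" if "a \<le> b" for a b
    by (rule order_trans[OF wvol_doubling[OF that]]) (use C W[of a] in simp)
  {
    assume j: "?j * \<beta> \<le> 0"
    show "(W k / W (k + j)) powr \<beta> * 2 powr (?j * ?Q * s) \<le> (2 * C) powr \<bar>\<beta>\<bar> * 2 powr (?j * (- \<alpha>))"
    proof (rule main)
      show "W k \<le> 2 * C * 2 powr (- ?j * ?Q) * W (k + j)" if "0 < \<beta>" using dbl[of "k + j" k] sign(1)[OF j that] by simp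
      show "W (k + j) \<le> 2 * C * 2 powr (- (- ?j * ?Q)) * W k" if "\<beta> < 0" using dbl[of k "k + j"] sign(2)[OF j that] by simp
      have "- ?j * ?Q * \<beta> = - ?j * (\<alpha> + ?Q * s)" unfolding Qb[symmetric] by simp
      then show "- ?j * ?Q * \<beta> + ?j * ?Q * s \<le> ?j * (- \<alpha>)" by (simp add: algebra_simps)
    qed
  }
  {
    assume j: "0 \<le> ?j * \<beta>"
    show "(W k / W (k + j)) powr \<beta> * 2 powr (?j * ?Q * s)
      \<le> (2 * C) powr \<bar>\<beta>\<bar> * 2 powr (?j * (?Q * s - (\<alpha> + ?Q * s) * (\<delta> - 1) / \<delta>))"
    proof (rule main)
      show "W k \<le> 2 * C * 2 powr (- ?j * ?Q * (1 - 1 / r)) * W (k + j)" if "0 < \<beta>"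
        using wvol_reverse_doubling[of k "k + j"] sign(3)[OF j that] by simp
      show "W (k + j) \<le> 2 * C * 2 powr (- (- ?j * ?Q * (1 - 1 / r))) * W k" if "\<beta> < 0"
        using wvol_reverse_doubling[of "k + j" k] sign(4)[OF j that] by simp
      have le: "(?j * \<beta> * ?Q) * (1 - 1 / \<delta>) \<le> (?j * \<beta> * ?Q) * (1 - 1 / r)"
        by (rule mult_left_mono[OF _ mult_nonneg_nonneg[OF j]]) (use Q \<delta> in \<open>auto simp: frac_le\<close>)
      have eq: "(\<alpha> + ?Q * s) * (\<delta> - 1) / \<delta> = (?Q * \<beta>) * (1 - 1 / \<delta>)" using \<delta> unfolding Qb by (simp add: field_simps)
      show "- ?j * ?Q * (1 - 1 / r) * \<beta> + ?j * ?Q * s \<le> ?j * (?Q * s - (\<alpha> + ?Q * s) * (\<delta> - 1) / \<delta>)"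
        unfolding eq using le by (simp add: algebra_simps)
    qed
  }
qed

end

section \<open>The commutator with Borel data\<close>

lemma dlevel_powr:
  assumes "0 < a"
  shows "2 powr of_int (dlevel a - 1) \<le> a" "a < 2 powr of_int (dlevel a)"
proof -
  have e: "(2 :: real) powr of_int n = 2 powi n" for n by (rule powr_real_of_int') auto
  show "2 powr of_int (dlevel a - 1) \<le> a" "a < 2 powr of_int (dlevel a)"
    unfolding e by (rule dlevel[OF assms])+
qed

lemma one_plus_abs_dlevel_le:
  assumes a: "0 < a"
  shows "1 + \<bar>of_int (dlevel a)\<bar> \<le> 2 / ln 2 * (if a < 1 then ln (2 / a) else ln (2 * a))"
proof -
  let ?j = "dlevel a"
  have lv: "2 powr of_int (?j - 1) \<le> a" "a < 2 powr of_int ?j"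
    by (rule dlevel_powr[OF a])+
  have l2: "0 < ln (2 :: real)" by simp
  have l: "of_int (?j - 1) * ln 2 \<le> ln a" "ln a < of_int ?j * ln 2"
  proof -
    have "ln (2 powr of_int (?j - 1)) \<le> ln a" using lv(1) a by (intro iffD2[OF ln_le_cancel_iff]) auto
    then show "of_int (?j - 1) * ln 2 \<le> ln a" by (simp add: ln_powr)
    have "ln a < ln (2 powr of_int ?j)" using lv(2) a by (intro iffD2[OF ln_less_cancel_iff]) auto
    then show "ln a < of_int ?j * ln 2" by (simp add: ln_powr)
  qed
  show ?thesis
  proof (cases "a < 1")
    case True
    have "2 powr of_int (?j - 1) < (2 :: real) powr 0" using lv(1) True by simp
    then have j: "?j \<le> 0" by (subst (asm) powr_less_cancel_iff) auto
    have "(1 + \<bar>of_int ?j\<bar>) * ln 2 \<le> ln (2 / a)" using l(2) j a by (simp add: ln_div algebra_simps)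
    then have "1 + \<bar>of_int ?j\<bar> \<le> ln (2 / a) / ln 2" using l2 by (simp add: pos_le_divide_eq)
    moreover have "0 \<le> ln (2 / a)" using True a by (intro ln_ge_zero) simp
    then have "0 \<le> ln (2 / a) / ln 2" using l2 by (intro divide_nonneg_pos)
    then have "ln (2 / a) / ln 2 \<le> 2 * (ln (2 / a) / ln 2)" by linarith
    ultimately show ?thesis using True by simp
  next
    case False
    have "(2 :: real) powr 0 < 2 powr of_int ?j" using lv(2) False by simp
    then have j: "1 \<le> ?j" by (subst (asm) powr_less_cancel_iff) auto
    have "of_int ?j * ln 2 \<le> ln (2 * a)" using l(1) a by (simp add: ln_mult algebra_simps)
    then have "of_int ?j \<le> ln (2 * a) / ln 2" using l2 by (simp add: pos_le_divide_eq)
    moreover have "1 + \<bar>of_int ?j :: real\<bar> \<le> 2 * of_int ?j" using j by simp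
    ultimately have "1 + \<bar>of_int ?j\<bar> \<le> 2 * (ln (2 * a) / ln 2)" by linarith
    then show ?thesis using False by simp
  qed
qed

lemma dlevel_le_0_iff:
  assumes a: "0 < a"
  shows "a < 1 \<Longrightarrow> dlevel a \<le> 0" "\<not> a < 1 \<Longrightarrow> 0 \<le> dlevel a"
proof -
  show "dlevel a \<le> 0" if "a < 1"
  proof -
    have "log 2 a < 0" using that a by simp
    then have "\<lfloor>log 2 a\<rfloor> < 0" by (simp only: floor_less_iff of_int_0)
    then show ?thesis unfolding dlevel_def by linarith
  qed
  show "0 \<le> dlevel a" if "\<not> a < 1"
  proof -
    have "0 \<le> log 2 a" using that by simp
    then show ?thesis by (simp add: dlevel_def)
  qed
qed

lemma powr_dlevel_le:
  assumes a: "0 < a"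
  shows "2 powr (of_int (dlevel a) * e) \<le> 2 powr \<bar>e\<bar> * a powr e"
proof -
  let ?j = "dlevel a"
  have lv: "2 powr of_int (?j - 1) \<le> a" "a < 2 powr of_int ?j"
    by (rule dlevel_powr[OF a])+
  show ?thesis
  proof (cases "0 \<le> e")
    case True
    have "2 powr of_int ?j = 2 * 2 powr (of_int (?j - 1) :: real)" by (simp add: powr_diff)
    then have "2 powr of_int ?j \<le> 2 * a" using lv(1) by simp
    then have "(2 powr of_int ?j) powr e \<le> (2 * a) powr e" using True by (intro powr_mono2) auto
    then show ?thesis using True by (simp add: powr_powr powr_mult)
  next
    case False
    have "(2 powr of_int ?j) powr e \<le> a powr e" using False lv(2) a by (intro powr_mono2') auto
    also have "\<dots> \<le> 2 powr \<bar>e\<bar> * a powr e"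
      using mult_right_mono[of 1 "2 powr \<bar>e\<bar>" "a powr e"] by (simp add: ge_one_powr_ge_zero)
    finally show ?thesis by (simp add: powr_powr)
  qed
qed

text \<open>The integrand of the two constants as a real function, on the set where the matrix is invertible with
  finite norm; \<open>e_lo\<close> and \<open>e_hi\<close> are the exponents of the norm below and above 1.\<close>

definition K_integrand ::
  "real \<Rightarrow> real \<Rightarrow> ennreal \<Rightarrow> ennreal \<Rightarrow> ('n::finite heis \<Rightarrow> complex)
    \<Rightarrow> ('n heis \<Rightarrow> real ^ ('n + 'n + unit) ^ ('n + 'n + unit)) \<Rightarrow> 'n heis \<Rightarrow> real" where
  "K_integrand e_lo e_hi q q1 \<Phi> A y =
    (if det (A y) = 0 \<or> mat_hnorm (A y) = \<infinity> then 0
     else norm (\<Phi> y) / hnorm y ^ hom_dim TYPE('n)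
       * ((1 + (1 / \<bar>det (A y)\<bar>) powr recip q * enn2real (mat_hnorm (A y)) powr (Qdim TYPE('n) * recip q))
          * (1 / \<bar>det (A y)\<bar>) powr recip q1
          * (if enn2real (mat_hnorm (A y)) < 1
             then enn2real (mat_hnorm (A y)) powr e_lo * ln (2 / enn2real (mat_hnorm (A y)))
             else enn2real (mat_hnorm (A y)) powr e_hi * ln (2 * enn2real (mat_hnorm (A y))))))"

lemma measurable_K_integrand [measurable]:
  assumes [measurable]: "\<Phi> \<in> borel_measurable borel" "A \<in> borel_measurable borel"
  shows "K_integrand e_lo e_hi q q1 \<Phi> A \<in> borel_measurable borel"
  unfolding K_integrand_def by measurable

lemma K_integrand_nonneg:
  assumes "det (A y) \<noteq> 0 \<Longrightarrow> 0 < mat_hnorm (A y)"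
  shows "0 \<le> K_integrand e_lo e_hi q q1 \<Phi> A y"
proof (cases "det (A y) = 0 \<or> mat_hnorm (A y) = \<infinity>")
  case False
  then have "0 < enn2real (mat_hnorm (A y))" using assms by (simp add: enn2real_positive_iff less_top)
  then show ?thesis using False by (auto simp: K_integrand_def intro!: mult_nonneg_nonneg add_nonneg_nonneg)
qed (simp add: K_integrand_def)

text \<open>Both parts of the theorem at once: they differ only in the exponents \<open>e_lo\<close> and \<open>e_hi\<close> that satisfy the
  two growth conditions.\<close>

locale hausdorff_herz = dyadic_weight w r C for w :: "'n::finite heis \<Rightarrow> real" and r C +
  fixes p q q1 q2 :: ennreal and \<alpha>1 \<alpha>2 e_lo e_hi K :: real
  assumes p: "1 \<le> p" and q: "1 \<le> q" "1 \<le> q1" "1 \<le> q2" "q2 \<noteq> \<infinity>"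
    and exps: "enn2real q2 * recip q + enn2real q2 * recip q1 + 1 / r \<le> 1"
    and \<alpha>1: "\<alpha>1 < 0"
    and balance: "\<alpha>1 / Qdim TYPE('n) + recip q1 = \<alpha>2 / Qdim TYPE('n) + recip q2"
    and growth_lo: "j \<le> 0 \<Longrightarrow> (W k / W (k + j)) powr (\<alpha>1 / Qdim TYPE('n) + recip q1) * 2 powr (of_int j * Qdim TYPE('n) * recip q1)
      \<le> K * 2 powr (of_int j * e_lo)"
    and growth_hi: "0 \<le> j \<Longrightarrow> (W k / W (k + j)) powr (\<alpha>1 / Qdim TYPE('n) + recip q1) * 2 powr (of_int j * Qdim TYPE('n) * recip q1)
      \<le> K * 2 powr (of_int j * e_hi)"
begin

text \<open>The ratio of the geometric decay over the shells.\<close>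

definition \<theta> :: real where "\<theta> = 2 powr ((1 - 1 / r) * \<alpha>1)"

lemma \<theta>: "0 < \<theta>" "\<theta> < 1"
  using r \<alpha>1 powr_less_mono[of "(1 - 1 / r) * \<alpha>1" 0 2] by (auto simp: \<theta>_def mult_pos_neg)

abbreviation (input) tail_const :: "'n itself \<Rightarrow> real" where
  "tail_const T \<equiv> (2 * C) powr (- \<alpha>1 / Qdim T)"

abbreviation (input) growth_const :: "'n itself \<Rightarrow> real" where
  "growth_const T \<equiv> 2 / ln 2 * 2 powr Qdim T * K * 2 powr (\<bar>e_lo\<bar> + \<bar>e_hi\<bar>) * tail_const T"

lemma K_nonneg: "0 \<le> K"
proof -
  have "0 \<le> (W 0 / W (0 + 0)) powr (\<alpha>1 / Qdim TYPE('n) + recip q1) * 2 powr (of_int 0 * Qdim TYPE('n) * recip q1)" by simp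
  also have "\<dots> \<le> K * 2 powr (of_int 0 * e_lo)" by (rule growth_lo) simp
  finally show ?thesis by simp
qed

text \<open>Separating the powers of the two weighted volumes: \<open>\<beta> - 1/q1 = \<alpha>1/Q\<close>, so that a power of the ratio
  \<open>W\<^sub>k / W\<^sub>k\<^sub>+\<^sub>j\<close> splits off and the power left at \<open>k + j\<close> is the one in the Herz norm. All powers of \<open>2^j\<close> are then
  replaced by powers of \<open>a\<close>, which lies within a factor 2 of \<open>2^j\<close>.\<close>

lemma kernel_growth:
  assumes a: "0 < a" and D: "0 < D" and S: "0 \<le> S" "W (k + dlevel a) powr (\<alpha>1 / Qdim TYPE('n)) * S \<le> tail_const TYPE('n) * c" and c: "0 \<le> c"
  shows "W k powr (\<alpha>1 / Qdim TYPE('n) + recip q1)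
     * ((1 + \<bar>of_int (dlevel a)\<bar>) * (1 + (2 powr (of_int (dlevel a) * Qdim TYPE('n)) / D) powr recip q)
       * (2 powr (of_int (dlevel a) * Qdim TYPE('n)) / D) powr recip q1 * (W (k + dlevel a) powr (- recip q1) * S))
    \<le> growth_const TYPE('n)
       * ((1 + (1 / D) powr recip q * a powr (Qdim TYPE('n) * recip q)) * (1 / D) powr recip q1
          * (if a < 1 then a powr e_lo * ln (2 / a) else a powr e_hi * ln (2 * a)) * c)"
proof -
  let ?Q = "Qdim TYPE('n)" and ?j = "dlevel a"
  define \<beta> where "\<beta> = \<alpha>1 / ?Q + recip q1"
  define L where "L = (if a < 1 then ln (2 / a) else ln (2 * a))"
  define e where "e = (if a < 1 then e_lo else e_hi)"
  define X where "X = (1 / D) powr recip q * a powr (?Q * recip q)"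
  have Q: "0 < ?Q" by (rule Qdim_pos)
  have W: "0 < W k" for k by (rule wvol_pos)
  have X0: "0 \<le> X" by (simp add: X_def)
  have L: "1 + \<bar>of_int ?j\<bar> \<le> 2 / ln 2 * L" unfolding L_def by (rule one_plus_abs_dlevel_le[OF a])
  have L0: "0 \<le> 2 / ln 2 * L" using L by linarith
  have \<rho>: "1 + (2 powr (of_int ?j * ?Q) / D) powr recip q \<le> 2 powr ?Q * (1 + X)"
  proof -
    have "(2 powr (of_int ?j * ?Q) / D) powr recip q = (1 / D) powr recip q * 2 powr (of_int ?j * (?Q * recip q))"
      using D by (simp add: powr_divide powr_powr mult.assoc)
    also have "\<dots> \<le> (1 / D) powr recip q * (2 powr \<bar>?Q * recip q\<bar> * a powr (?Q * recip q))"
      by (intro mult_left_mono powr_dlevel_le a) simp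
    also have "\<dots> = 2 powr \<bar>?Q * recip q\<bar> * X" by (simp add: X_def)
    also have "\<dots> \<le> 2 powr ?Q * X"
    proof (intro mult_right_mono powr_mono X0)
      have "?Q * recip q \<le> ?Q * 1" using Q recip_le_1[OF q(1)] by (intro mult_left_mono) auto
      then show "\<bar>?Q * recip q\<bar> \<le> ?Q" using Q recip_nonneg[of q] by simp
    qed simp
    finally have "(2 powr (of_int ?j * ?Q) / D) powr recip q \<le> 2 powr ?Q * X" .
    moreover have "1 \<le> 2 powr ?Q" using Q by (simp add: ge_one_powr_ge_zero)
    ultimately show ?thesis by (simp add: distrib_left)
  qed
  have gr: "(W k / W (k + ?j)) powr \<beta> * 2 powr (of_int ?j * ?Q * recip q1) \<le> K * 2 powr (\<bar>e_lo\<bar> + \<bar>e_hi\<bar>) * a powr e"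
  proof -
    have "(W k / W (k + ?j)) powr \<beta> * 2 powr (of_int ?j * ?Q * recip q1) \<le> K * 2 powr (of_int ?j * e)"
      using growth_lo[of ?j k] growth_hi[of ?j k] dlevel_le_0_iff[OF a] by (auto simp: e_def \<beta>_def)
    also have "\<dots> \<le> K * (2 powr \<bar>e\<bar> * a powr e)" by (intro mult_left_mono powr_dlevel_le a K_nonneg)
    also have "\<dots> \<le> K * (2 powr (\<bar>e_lo\<bar> + \<bar>e_hi\<bar>) * a powr e)"
      by (intro mult_left_mono mult_right_mono powr_mono K_nonneg) (auto simp: e_def)
    finally show ?thesis by (simp add: mult.assoc)
  qed
  have \<rho>1: "(2 powr (of_int ?j * ?Q) / D) powr recip q1 = (1 / D) powr recip q1 * 2 powr (of_int ?j * ?Q * recip q1)"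
    using D by (simp add: powr_divide powr_powr)
  have Wsplit: "W k powr \<beta> * W (k + ?j) powr (- recip q1) = (W k / W (k + ?j)) powr \<beta> * W (k + ?j) powr (\<alpha>1 / ?Q)"
  proof -
    have "W (k + ?j) powr (\<alpha>1 / ?Q) = W (k + ?j) powr \<beta> * W (k + ?j) powr (- recip q1)"
      by (simp add: \<beta>_def flip: powr_add)
    then show ?thesis using W[of k] W[of "k + ?j"] by (simp add: powr_divide)
  qed
  have "W k powr \<beta> * ((1 + \<bar>of_int ?j\<bar>) * (1 + (2 powr (of_int ?j * ?Q) / D) powr recip q)
       * (2 powr (of_int ?j * ?Q) / D) powr recip q1 * (W (k + ?j) powr (- recip q1) * S))
    = (1 + \<bar>of_int ?j\<bar>) * (1 + (2 powr (of_int ?j * ?Q) / D) powr recip q) * (1 / D) powr recip q1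
      * 2 powr (of_int ?j * ?Q * recip q1) * (W k powr \<beta> * W (k + ?j) powr (- recip q1)) * S"
    unfolding \<rho>1 by (simp only: mult_ac)
  also have "\<dots> = (1 + \<bar>of_int ?j\<bar>) * (1 + (2 powr (of_int ?j * ?Q) / D) powr recip q) * (1 / D) powr recip q1
      * ((W k / W (k + ?j)) powr \<beta> * 2 powr (of_int ?j * ?Q * recip q1)) * (W (k + ?j) powr (\<alpha>1 / ?Q) * S)"
    unfolding Wsplit by (simp only: mult_ac)
  also have "\<dots> \<le> (2 / ln 2 * L) * (2 powr ?Q * (1 + X)) * (1 / D) powr recip q1
      * (K * 2 powr (\<bar>e_lo\<bar> + \<bar>e_hi\<bar>) * a powr e) * (tail_const TYPE('n) * c)"
  proof -
    have mono: "x1 * x2 * z * x3 * x4 \<le> y1 * y2 * z * y3 * y4"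
      if "0 \<le> x1" "x1 \<le> y1" "0 \<le> x2" "x2 \<le> y2" "0 \<le> z" "0 \<le> x3" "x3 \<le> y3" "0 \<le> x4" "x4 \<le> y4"
      for x1 x2 x3 x4 y1 y2 y3 y4 z :: real
      using that by (intro mult_mono mult_nonneg_nonneg) (auto intro: order_trans)
    show ?thesis
      by (rule mono[OF _ L _ \<rho> _ _ gr _ S(2)]) (use S(1) in auto)
  qed
  also have "\<dots> = growth_const TYPE('n) * ((1 + X) * (1 / D) powr recip q1 * (a powr e * L) * c)"
    by (simp add: mult_ac)
  also have "a powr e * L = (if a < 1 then a powr e_lo * ln (2 / a) else a powr e_hi * ln (2 * a))"
    by (simp add: e_def L_def)
  finally show ?thesis unfolding \<beta>_def X_def .
qed

lemma shell_sums:
  assumes F: "\<And>l. 0 \<le> F l" and H: "lp_bound p (count_space UNIV) (\<lambda>l. W l powr (\<alpha>1 / Qdim TYPE('n)) * F l) H"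
  shows "summable (\<lambda>m. F (k - int m))"
    and "W k powr (\<alpha>1 / Qdim TYPE('n)) * (\<Sum>m. F (k - int m))
      \<le> tail_const TYPE('n) * geom_tail \<theta> (\<lambda>l. W l powr (\<alpha>1 / Qdim TYPE('n)) * F l) k"
proof -
  let ?s = "\<alpha>1 / Qdim TYPE('n)"
  let ?a = "\<lambda>l. W l powr ?s * F l"
  have W: "0 < W k" for k by (rule wvol_pos)
  have sm: "summable (\<lambda>m. \<theta> ^ m * ?a (k - int m))"
    by (rule geom_tail_summable[OF H _ p \<theta>]) (use F in simp)
  have le: "W k powr ?s * F (k - int m) \<le> tail_const TYPE('n) * (\<theta> ^ m * ?a (k - int m))" for m
  proof -
    have "W k powr ?s * F (k - int m) = (W k / W (k - int m)) powr ?s * ?a (k - int m)"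
      using W[of k] W[of "k - int m"] by (simp add: powr_divide)
    also have "\<dots> \<le> (tail_const TYPE('n) * \<theta> ^ m) * ?a (k - int m)"
      using wvol_ratio_tail[OF \<alpha>1, of k m] F by (intro mult_right_mono) (auto simp: \<theta>_def)
    finally show ?thesis by (simp add: mult.assoc)
  qed
  have sm2: "summable (\<lambda>m. W k powr ?s * F (k - int m))"
    by (rule summable_comparison_test'[OF summable_mult[OF sm, of "tail_const TYPE('n)"], of 0])
       (use le F in auto)
  then show sm3: "summable (\<lambda>m. F (k - int m))"
    using W[of k] by (simp add: summable_cmult_iff)
  have "W k powr ?s * (\<Sum>m. F (k - int m)) = (\<Sum>m. W k powr ?s * F (k - int m))"
    using sm3 by (rule suminf_mult[symmetric])
  also have "\<dots> \<le> (\<Sum>m. tail_const TYPE('n) * (\<theta> ^ m * ?a (k - int m)))"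
    by (intro suminf_le le sm2 summable_mult sm)
  also have "\<dots> = tail_const TYPE('n) * geom_tail \<theta> ?a k"
    unfolding geom_tail_def using sm by (rule suminf_mult)
  finally show "W k powr ?s * (\<Sum>m. F (k - int m)) \<le> tail_const TYPE('n) * geom_tail \<theta> ?a k" .
qed

end

lemma measurable_pair_refine:
  fixes g :: "'a::euclidean_space \<times> 'b::euclidean_space \<Rightarrow> 'c::topological_space"
  assumes g: "g \<in> borel_measurable (borel \<Otimes>\<^sub>M borel)"
    and M: "(\<lambda>x. x) \<in> borel_measurable M" and Y: "(\<lambda>y. y) \<in> borel_measurable Y"
  shows "g \<in> borel_measurable (M \<Otimes>\<^sub>M Y)"
proof -
  have "(\<lambda>p. (fst p, snd p)) \<in> M \<Otimes>\<^sub>M Y \<rightarrow>\<^sub>M borel \<Otimes>\<^sub>M borel"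
    by (intro measurable_Pair measurable_compose[OF measurable_fst M] measurable_compose[OF measurable_snd Y])
  from measurable_compose[OF this g] show ?thesis by simp
qed

lemma norm_commutator_integrand:
  "norm (commutator_integrand \<Phi> A b f x y)
    = norm (\<Phi> y) / hnorm y ^ hom_dim TYPE('n) * (norm (b x - b (A y *v x)) * norm (f (A y *v x)))"
  for x y :: "'n::finite heis"
  by (simp add: commutator_integrand_def norm_mult norm_divide norm_power)

lemma measurable_commutator_integrand:
  fixes b f \<Phi> :: "'n::finite heis \<Rightarrow> complex"
  assumes [measurable]: "b \<in> borel_measurable borel" "f \<in> borel_measurable borel"
    "\<Phi> \<in> borel_measurable borel" "A \<in> borel_measurable borel"
  shows "(\<lambda>(x, y). commutator_integrand \<Phi> A b f x y) \<in> borel_measurable (borel \<Otimes>\<^sub>M borel)"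
  unfolding commutator_integrand_def case_prod_beta by measurable

context hausdorff_herz
begin

abbreviation (input) weight_exp :: "'n itself \<Rightarrow> real" where
  "weight_exp T \<equiv> \<alpha>1 / Qdim T + recip q1"

text \<open>The estimate for a single parameter \<open>y\<close>, with a power of \<open>W\<^sub>k\<close> split off that the Herz norm compensates: what
  remains depends on \<open>k\<close> only through the tail at the shifted level.\<close>

lemma lp_bound_fibre:
  fixes b f \<Phi> :: "'n heis \<Rightarrow> complex"
  assumes b: "loc_integrable b" "b \<in> borel_measurable borel"
    and bd: "\<And>k. lp_bound q (Wavg k) (\<lambda>x. norm (b x - mean (dball k) b)) B"
    and f: "f \<in> borel_measurable borel" "\<And>l. lp_bound q1 (Wshell l) (\<lambda>x. norm (f x)) (F l)"
    and H: "lp_bound p (count_space UNIV) (\<lambda>l. W l powr (\<alpha>1 / Qdim TYPE('n)) * F l) H"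
    and good: "det (A y) \<noteq> 0" "mat_hnorm (A y) < \<infinity>"
  shows "lp_bound q2 (Wavg k) (\<lambda>x. norm (commutator_integrand \<Phi> A b f x y))
    (W k powr (- weight_exp TYPE('n)) * (108 * 2 powr Qdim TYPE('n) * C ^ 3 * growth_const TYPE('n) * B
      * (K_integrand e_lo e_hi q q1 \<Phi> A y
         * geom_tail \<theta> (\<lambda>l. W l powr (\<alpha>1 / Qdim TYPE('n)) * F l) (k + dlevel (enn2real (mat_hnorm (A y)))))))"
proof -
  let ?a = "enn2real (mat_hnorm (A y))" and ?D = "\<bar>det (A y)\<bar>"
  let ?j = "dlevel ?a" and ?Q = "Qdim TYPE('n)"
  let ?c = "geom_tail \<theta> (\<lambda>l. W l powr (\<alpha>1 / ?Q) * F l) (k + ?j)"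
  let ?\<kappa> = "norm (\<Phi> y) / hnorm y ^ hom_dim TYPE('n)"
  let ?P = "108 * 2 powr ?Q * C ^ 3 * B"
  define S where "S = (\<Sum>m. F (k + ?j - int m))"
  have F: "0 \<le> F l" for l using f(2) by (rule lp_bound_nonneg)
  have B: "0 \<le> B" using bd by (rule lp_bound_nonneg)
  have a: "0 < ?a" using mat_hnorm_pos[OF good(1)] good(2) by (simp add: enn2real_positive_iff less_top)
  have D: "0 < ?D" using good by simp
  have sums: "(\<lambda>m. F (k + ?j - int m)) sums S"
    unfolding S_def by (rule summable_sums[OF shell_sums(1)[OF F H]])
  have S0: "0 \<le> S" by (rule sums_le[OF _ sums_zero sums]) (rule F)
  have c0: "0 \<le> ?c" by (rule geom_tail_nonneg[OF H _ p \<theta>]) (use F in simp)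
  have map: "A y *v x \<in> dball (k + ?j)" if "x \<in> dball k" for x
    using dlevel(2)[OF a] by (intro dball_matrix[OF good(2) _ that]) simp
  define T where "T = (1 + \<bar>of_int ?j\<bar>) * (1 + (2 powr (of_int ?j * ?Q) / ?D) powr recip q)
       * (2 powr (of_int ?j * ?Q) / ?D) powr recip q1 * (W (k + ?j) powr (- recip q1) * S)"
  have T0: "0 \<le> T" using S0 by (simp add: T_def)
  have "lp_bound q2 (Wavg k) (\<lambda>x. norm (b x - b (A y *v x)) * norm (f (A y *v x))) (?P * T)"
    unfolding T_def
    by (rule lp_bound_commutator_kernel[OF b bd f(1) lp_bound_Wavg_of_shells[OF f(2) q(2) sums] good(1) map q exps])
  from lp_bound_cmult[OF this, of ?\<kappa>]
  have 1: "lp_bound q2 (Wavg k) (\<lambda>x. norm (commutator_integrand \<Phi> A b f x y)) (?\<kappa> * (?P * T))"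
    by (simp add: norm_commutator_integrand)
  have "W k powr weight_exp TYPE('n) * T
    \<le> growth_const TYPE('n)
       * ((1 + (1 / ?D) powr recip q * ?a powr (?Q * recip q)) * (1 / ?D) powr recip q1
          * (if ?a < 1 then ?a powr e_lo * ln (2 / ?a) else ?a powr e_hi * ln (2 * ?a)) * ?c)"
    unfolding T_def using shell_sums(2)[OF F H, of "k + ?j"]
    by (intro kernel_growth[OF a D S0 _ c0]) (simp add: S_def)
  then have "?\<kappa> * ?P * (W k powr weight_exp TYPE('n) * T)
    \<le> ?\<kappa> * ?P * (growth_const TYPE('n)
       * ((1 + (1 / ?D) powr recip q * ?a powr (?Q * recip q)) * (1 / ?D) powr recip q1
          * (if ?a < 1 then ?a powr e_lo * ln (2 / ?a) else ?a powr e_hi * ln (2 * ?a)) * ?c))"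
    using B C by (intro mult_left_mono mult_nonneg_nonneg divide_nonneg_nonneg) auto
  also have "\<dots> = 108 * 2 powr ?Q * C ^ 3 * growth_const TYPE('n) * B * (K_integrand e_lo e_hi q q1 \<Phi> A y * ?c)"
    using good unfolding K_integrand_def by (simp only: less_top mult_ac infinity_ennreal_def if_False simp_thms) (simp add: mult_ac)
  finally have 2: "?\<kappa> * ?P * (W k powr weight_exp TYPE('n) * T)
    \<le> 108 * 2 powr ?Q * C ^ 3 * growth_const TYPE('n) * B * (K_integrand e_lo e_hi q q1 \<Phi> A y * ?c)" .
  have Wk: "W k powr (- weight_exp TYPE('n)) * W k powr weight_exp TYPE('n) = 1"
    using wvol_pos[of k] by (simp flip: powr_add)
  have "?\<kappa> * (?P * T) = (W k powr (- weight_exp TYPE('n)) * W k powr weight_exp TYPE('n)) * (?\<kappa> * (?P * T))"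
    unfolding Wk by simp
  also have "\<dots> = W k powr (- weight_exp TYPE('n)) * (?\<kappa> * ?P * (W k powr weight_exp TYPE('n) * T))"
    by (simp only: mult_ac)
  also have "\<dots> \<le> W k powr (- weight_exp TYPE('n)) * (108 * 2 powr ?Q * C ^ 3 * growth_const TYPE('n) * B * (K_integrand e_lo e_hi q q1 \<Phi> A y * ?c))"
    by (intro mult_left_mono 2) simp
  finally show ?thesis
    by (rule lp_bound_mono[OF 1]) (use lp_bound_measurable[OF 1] in auto)
qed

lemma lp_bound_Wshell_of_Wavg:
  assumes g: "lp_bound q2 (Wavg k) g U"
  shows "lp_bound q2 (Wshell k) g (W k powr recip q2 * U)"
proof -
  define t where "t = enn2real q2"
  have t: "1 \<le> t" "recip q2 = 1 / t" using enn2real_exponent[OF q(3,4)] by (auto simp: t_def)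
  have U: "0 \<le> U" using g by (rule lp_bound_nonneg)
  have [measurable]: "g \<in> borel_measurable lebesgue"
    using lp_bound_measurable[OF g] by (simp add: measurable_Wavg)
  have Wk: "0 < W k" by (rule wvol_pos)
  let ?g = "\<lambda>x. ennreal (\<bar>g x\<bar> powr t)"
  have "(\<integral>\<^sup>+x. ?g x \<partial>Wshell k) = (\<integral>\<^sup>+x. ?g x * ennreal (w x) * indicator (dshell k) x \<partial>lebesgue)"
    by (rule nn_integral_Wshell) measurable
  also have "\<dots> \<le> (\<integral>\<^sup>+x. ?g x * ennreal (w x) * indicator (dball k) x \<partial>lebesgue)"
    using dshell_subset[of k] by (intro nn_integral_mono) (auto simp: indicator_def)
  also have "\<dots> = ennreal (W k) * (ennreal (1 / W k) * (\<integral>\<^sup>+x. ?g x * ennreal (w x) * indicator (dball k) x \<partial>lebesgue))"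
    using Wk by (simp flip: mult.assoc ennreal_mult)
  also have "\<dots> = ennreal (W k) * (\<integral>\<^sup>+x. ?g x \<partial>Wavg k)"
    by (subst nn_integral_Wavg) auto
  also have "\<dots> \<le> ennreal (W k) * ennreal (U powr t)"
    using g q(4) by (intro mult_left_mono) (auto simp: lp_bound_def t_def)
  also have "\<dots> = ennreal ((W k powr recip q2 * U) powr t)"
    using t U Wk by (simp add: powr_mult powr_powr flip: ennreal_mult)
  finally show ?thesis using U q(4)
    by (simp add: lp_bound_def t_def measurable_cong_sets[OF sets_Wshell refl])
qed

definition total_const :: "'n itself \<Rightarrow> real" where
  "total_const T = 8 * (108 * 2 powr Qdim T * C ^ 3 * growth_const T) / (1 - \<theta>)"

lemma total_const_nonneg: "0 \<le> total_const T"
  using C K_nonneg \<theta> by (simp add: total_const_def)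

text \<open>The single-parameter estimates are integrated by Minkowski's inequality: first the bounds, as functions
  of \<open>k\<close> in \<open>l\<^sup>p\<close>, then the functions themselves on each ball.\<close>

proposition commutator_herz_bound:
  fixes b f \<Phi> :: "'n heis \<Rightarrow> complex"
  assumes b: "loc_integrable b" and bm[measurable]: "b \<in> borel_measurable borel"
    and bd: "\<And>k. lp_bound q (Wavg k) (\<lambda>x. norm (b x - mean (dball k) b)) B"
    and fm[measurable]: "f \<in> borel_measurable borel"
    and f: "\<And>l. lp_bound q1 (Wshell l) (\<lambda>x. norm (f x)) (F l)"
    and H: "lp_bound p (count_space UNIV) (\<lambda>l. W l powr (\<alpha>1 / Qdim TYPE('n)) * F l) H"
    and \<Phi>[measurable]: "\<Phi> \<in> borel_measurable borel" and A[measurable]: "A \<in> borel_measurable borel"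
    and good: "AE y in lborel. \<Phi> y \<noteq> 0 \<longrightarrow> det (A y) \<noteq> 0 \<and> mat_hnorm (A y) < \<infinity>"
    and \<kappa>: "(\<integral>\<^sup>+y. ennreal (K_integrand e_lo e_hi q q1 \<Phi> A y) \<partial>lborel) \<le> ennreal \<kappa>" "0 \<le> \<kappa>"
  defines "h \<equiv> \<lambda>x. \<integral>\<^sup>+y. ennreal (norm (commutator_integrand \<Phi> A b f x y)) \<partial>lborel"
  obtains G where "\<And>k. 0 \<le> G k"
    "lp_bound p (count_space UNIV) G (total_const TYPE('n) * \<kappa> * B * H)"
    "\<And>k. AE x in lebesgue. x \<in> dball k \<longrightarrow> h x < \<infinity>"
    "\<And>k. lp_bound q2 (Wshell k) (\<lambda>x. enn2real (h x)) (W k powr (- \<alpha>2 / Qdim TYPE('n)) * G k)"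
proof -
  let ?Q = "Qdim TYPE('n)" and ?hk = "K_integrand e_lo e_hi q q1 \<Phi> A"
  let ?j = "\<lambda>y. dlevel (enn2real (mat_hnorm (A y)))"
  let ?c = "geom_tail \<theta> (\<lambda>l. W l powr (\<alpha>1 / ?Q) * F l)"
  define M where "M = 108 * 2 powr ?Q * C ^ 3 * growth_const TYPE('n) * B"
  have F: "0 \<le> F l" for l using f by (rule lp_bound_nonneg)
  have B: "0 \<le> B" using bd by (rule lp_bound_nonneg)
  have M: "0 \<le> M" using B C K_nonneg by (simp add: M_def)
  have H0: "0 \<le> H" using H by (rule lp_bound_nonneg)
  have hk0: "0 \<le> ?hk y" for y by (rule K_integrand_nonneg) (rule mat_hnorm_pos)
  have c0: "0 \<le> ?c k" for k by (rule geom_tail_nonneg[OF H _ p \<theta>]) (use F in simp)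
  have cb: "lp_bound p (count_space UNIV) ?c (2 * (H / (1 - \<theta>)))"
    by (rule lp_bound_geom_tail[OF H _ p \<theta>]) (use F in simp)
  let ?H = "2 * (H / (1 - \<theta>))"
  have H1: "0 \<le> ?H" using H0 \<theta> by simp
  have jm[measurable]: "?j \<in> borel \<rightarrow>\<^sub>M count_space UNIV"
    unfolding dlevel_def by measurable
  have cm: "(\<lambda>y. ?c (k + ?j y)) \<in> borel_measurable borel" for k
    by (rule measurable_compose[OF jm]) simp
  let ?E = "\<lambda>k. \<integral>\<^sup>+y. ennreal (?hk y * ?c (k + ?j y)) \<partial>lborel"
  have "(AE k in count_space UNIV. ?E k < \<infinity>) \<and> lp_bound p (count_space UNIV) (\<lambda>k. enn2real (?E k)) (2 * (\<kappa> * ?H))"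
  proof (rule lp_bound_Minkowski[OF sigma_finite_count_int sigma_finite_lborel _ _ _ _ p])
    show "(\<lambda>(k, y). ?hk y * ?c (k + ?j y)) \<in> borel_measurable (count_space UNIV \<Otimes>\<^sub>M lborel)"
      by (rule measurable_pair_measure_countable1) (use cm in auto)
    show "0 \<le> ?hk y * ?c (k + ?j y)" for k y using hk0 c0 by simp
    show "(\<lambda>y. ?hk y * ?H) \<in> borel_measurable lborel" by measurable
    show "AE y in lborel. lp_bound p (count_space UNIV) (\<lambda>k. ?hk y * ?c (k + ?j y)) (?hk y * ?H)"
    proof (rule AE_I2)
      fix y
      show "lp_bound p (count_space UNIV) (\<lambda>k. ?hk y * ?c (k + ?j y)) (?hk y * ?H)"
        using lp_bound_cmult[OF lp_bound_count_shift[OF cb, of "- ?j y"], of "?hk y"] hk0[of y] by simp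
    qed
    have "(\<integral>\<^sup>+y. ennreal (?hk y * ?H) \<partial>lborel) = (\<integral>\<^sup>+y. ennreal (?hk y) * ennreal ?H \<partial>lborel)"
      by (intro nn_integral_cong ennreal_mult hk0 H1)
    also have "\<dots> = (\<integral>\<^sup>+y. ennreal (?hk y) \<partial>lborel) * ennreal ?H" by (rule nn_integral_multc) measurable
    also have "\<dots> \<le> ennreal \<kappa> * ennreal ?H" using \<kappa>(1) by (intro mult_right_mono) auto
    also have "\<dots> = ennreal (\<kappa> * ?H)" by (rule ennreal_mult[symmetric, OF \<kappa>(2) H1])
    finally show "(\<integral>\<^sup>+y. ennreal (?hk y * ?H) \<partial>lborel) \<le> ennreal (\<kappa> * ?H)" .
    show "0 \<le> \<kappa> * ?H" by (rule mult_nonneg_nonneg[OF \<kappa>(2) H1])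
  qed
  then have Efin: "?E k < \<infinity>" and Eb: "lp_bound p (count_space UNIV) (\<lambda>k. enn2real (?E k)) (2 * (\<kappa> * ?H))" for k
    by (auto simp: AE_count_space)
  define G where "G k = 2 * M * enn2real (?E k)" for k
  have hb: "(AE x in Wavg k. h x < \<infinity>) \<and>
    lp_bound q2 (Wavg k) (\<lambda>x. enn2real (h x)) (2 * (W k powr (- weight_exp TYPE('n)) * (M * enn2real (?E k))))" for k
    unfolding h_def
  proof (rule lp_bound_Minkowski[OF sigma_finite_Wavg sigma_finite_lborel _ _ _ _ q(3)])
    \<comment> \<open>The bound is the integrand of \<open>?E k\<close> up to a factor, so its integral is known to be finite.\<close>
    let ?N = "\<lambda>y. W k powr (- weight_exp TYPE('n)) * (M * (?hk y * ?c (k + ?j y)))"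
    have "(\<lambda>p. norm (case p of (x, y) \<Rightarrow> commutator_integrand \<Phi> A b f x y)) \<in> borel_measurable (borel \<Otimes>\<^sub>M borel)"
      by (rule measurable_compose[OF measurable_commutator_integrand[OF bm fm \<Phi> A]]) measurable
    then have "(\<lambda>(x, y). norm (commutator_integrand \<Phi> A b f x y)) \<in> borel_measurable (borel \<Otimes>\<^sub>M borel)"
      by (simp add: case_prod_beta)
    then show "(\<lambda>(x, y). norm (commutator_integrand \<Phi> A b f x y)) \<in> borel_measurable (Wavg k \<Otimes>\<^sub>M lborel)"
      by (rule measurable_pair_refine) (simp_all add: measurable_Wavg borel_imp_lebesgue_measurable)
    show "?N \<in> borel_measurable lborel" using cm by simp
    show "AE y in lborel. lp_bound q2 (Wavg k) (\<lambda>x. norm (commutator_integrand \<Phi> A b f x y)) (?N y)"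
      using good
    proof eventually_elim
      fix y assume y: "\<Phi> y \<noteq> 0 \<longrightarrow> det (A y) \<noteq> 0 \<and> mat_hnorm (A y) < \<infinity>"
      show "lp_bound q2 (Wavg k) (\<lambda>x. norm (commutator_integrand \<Phi> A b f x y)) (?N y)"
      proof (cases "\<Phi> y = 0")
        case True
        then show ?thesis using M hk0[of y] c0 by (simp add: lp_bound_def norm_commutator_integrand)
      next
        case False
        with y show ?thesis unfolding M_def
          by (intro lp_bound_fibre[OF b bm bd fm f H]) auto
      qed
    qed
    have k0: "0 \<le> W k powr (- weight_exp TYPE('n)) * M" using M by simp
    have "(\<integral>\<^sup>+y. ennreal (?N y) \<partial>lborel)
        = (\<integral>\<^sup>+y. ennreal (W k powr (- weight_exp TYPE('n)) * M) * ennreal (?hk y * ?c (k + ?j y)) \<partial>lborel)"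
      using hk0 c0 k0 by (intro nn_integral_cong) (simp only: mult.assoc[symmetric] ennreal_mult mult_nonneg_nonneg)
    also have "\<dots> = ennreal (W k powr (- weight_exp TYPE('n)) * M) * ?E k"
      using cm by (intro nn_integral_cmult) simp
    also have "\<dots> = ennreal (W k powr (- weight_exp TYPE('n)) * M) * ennreal (enn2real (?E k))"
      using Efin[of k] by (simp add: less_top)
    also have "\<dots> = ennreal (W k powr (- weight_exp TYPE('n)) * (M * enn2real (?E k)))"
      using k0 by (simp add: ennreal_mult mult.assoc flip: ennreal_mult)
    finally show "(\<integral>\<^sup>+y. ennreal (?N y) \<partial>lborel) \<le> ennreal (W k powr (- weight_exp TYPE('n)) * (M * enn2real (?E k)))"
      by simp
    show "0 \<le> W k powr (- weight_exp TYPE('n)) * (M * enn2real (?E k))" using M by simp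
  qed simp
  show ?thesis
  proof (rule that[of G])
    show "0 \<le> G k" for k using M by (simp add: G_def)
    show "lp_bound p (count_space UNIV) G (total_const TYPE('n) * \<kappa> * B * H)"
    proof (rule lp_bound_mono[OF lp_bound_cmult[OF Eb, of "2 * M"]])
      have "\<bar>2 * M\<bar> * (2 * (\<kappa> * ?H)) = 8 * M * \<kappa> * H / (1 - \<theta>)" using M by simp
      also have "\<dots> = total_const TYPE('n) * \<kappa> * B * H" by (simp add: total_const_def M_def)
      finally show "\<bar>2 * M\<bar> * (2 * (\<kappa> * ?H)) \<le> total_const TYPE('n) * \<kappa> * B * H" by simp
    qed (auto simp: G_def)
    show "AE x in lebesgue. x \<in> dball k \<longrightarrow> h x < \<infinity>" for k
      using hb[of k] by (simp add: AE_Wavg)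
    show "lp_bound q2 (Wshell k) (\<lambda>x. enn2real (h x)) (W k powr (- \<alpha>2 / ?Q) * G k)" for k
    proof -
      have "W k powr recip q2 * W k powr (- weight_exp TYPE('n)) = W k powr (- \<alpha>2 / ?Q)"
        unfolding balance by (simp flip: powr_add)
      moreover have "b * (2 * (c * (M * d))) = (b * c) * (2 * M * d)" for b c d :: real
        by (simp add: mult_ac)
      ultimately have "W k powr recip q2 * (2 * (W k powr (- weight_exp TYPE('n)) * (M * enn2real (?E k)))) = W k powr (- \<alpha>2 / ?Q) * G k"
        unfolding G_def by presburger
      then show ?thesis using lp_bound_Wshell_of_Wavg[OF conjunct2[OF hb[of k]]] by simp
    qed
  qed
qed

end

section \<open>The two constants\<close>

text \<open>Coordinatewise from the scalar case.\<close>

lemma borel_version: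
  fixes f :: "'a::euclidean_space \<Rightarrow> 'b::euclidean_space"
  assumes "f \<in> borel_measurable lebesgue"
  obtains g where "g \<in> borel_measurable borel" "AE x in lborel. f x = g x"
proof -
  have "\<exists>g\<in>borel_measurable lborel. AE x in lborel. f x \<bullet> i = g x" for i
    by (intro completion_ex_borel_measurable_real borel_measurable_inner assms) simp
  then obtain g where g: "\<And>i. g i \<in> borel_measurable lborel" "\<And>i. AE x in lborel. f x \<bullet> i = g i x" by metis
  have [measurable]: "g i \<in> borel_measurable borel" for i using g(1)[of i] by simp
  show ?thesis
  proof (rule that)
    show "(\<lambda>x. \<Sum>i\<in>Basis. g i x *\<^sub>R i) \<in> borel_measurable borel" by measurable
    have "AE x in lborel. \<forall>i\<in>Basis. f x \<bullet> i = g i x" by (rule AE_finite_allI) (auto intro: g)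
    then show "AE x in lborel. f x = (\<Sum>i\<in>Basis. g i x *\<^sub>R i)"
      by eventually_elim (metis (no_types, lifting) euclidean_representation sum.cong)
  qed
qed

lemma lebesgue_measurable_AE:
  fixes f g :: "'a::euclidean_space \<Rightarrow> 'b::topological_space"
  assumes f: "f \<in> borel_measurable lebesgue" and eq: "AE x in lebesgue. f x = g x"
  shows "g \<in> borel_measurable lebesgue"
proof (rule measurableI)
  fix S :: "'b set" assume "S \<in> sets borel"
  then have A: "f -` S \<inter> space lebesgue \<in> sets lebesgue" by (rule measurable_sets[OF f])
  have ae: "AE x in lebesgue. x \<in> f -` S \<inter> space lebesgue \<longleftrightarrow> x \<in> g -` S \<inter> space lebesgue"
    using eq by eventually_elim simp
  show "g -` S \<inter> space lebesgue \<in> sets lebesgue"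
    by (rule completion.in_sets_AE[OF ae A]) blast
qed simp

lemma abs_det_matrix_inv:
  fixes A :: "real ^ 'n ^ 'n"
  assumes "det A \<noteq> 0"
  shows "\<bar>det (matrix_inv A)\<bar> = 1 / \<bar>det A\<bar>"
proof -
  have "\<exists>B. A ** B = mat 1 \<and> B ** A = mat 1"
    using assms by (simp add: invertible_det_nz[symmetric] invertible_def)
  then have "A ** matrix_inv A = mat 1"
    unfolding matrix_inv_def by (rule someI2_ex) blast
  then have "det A * det (matrix_inv A) = 1" by (metis det_I det_mul)
  then have "\<bar>det A\<bar> * \<bar>det (matrix_inv A)\<bar> = 1" by (metis abs_1 abs_mult)
  then show ?thesis using assms by (simp add: field_simps)
qed

text \<open>The common shape of the two constants, which differ by an exchange of the two exponents.\<close>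

definition Kconst ::
  "real \<Rightarrow> real \<Rightarrow> ennreal \<Rightarrow> ennreal \<Rightarrow> ('n::finite heis \<Rightarrow> complex)
    \<Rightarrow> ('n heis \<Rightarrow> real ^ ('n + 'n + unit) ^ ('n + 'n + unit)) \<Rightarrow> ennreal" where
  "Kconst e_lo e_hi q q1 \<Phi> A =
     (\<integral>\<^sup>+y\<in>{y. mat_hnorm (A y) < 1}. K_factor q q1 \<Phi> A y
         * epowr (mat_hnorm (A y)) e_lo * eln (2 / mat_hnorm (A y)) \<partial>lebesgue)
   + (\<integral>\<^sup>+y\<in>{y. 1 \<le> mat_hnorm (A y)}. K_factor q q1 \<Phi> A y
         * epowr (mat_hnorm (A y)) e_hi * eln (2 * mat_hnorm (A y)) \<partial>lebesgue)"

lemma K1_eq_Kconst: "K1 \<delta> \<alpha> q q1 \<Phi> A = Kconst (- \<alpha>) (K_exponent (hom_dim TYPE('n)) \<delta> \<alpha> q1) q q1 \<Phi> A"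
  for \<Phi> :: "'n::finite heis \<Rightarrow> complex"
  by (simp add: K1_def Kconst_def)

lemma K2_eq_Kconst: "K2 \<delta> \<alpha> q q1 \<Phi> A = Kconst (K_exponent (hom_dim TYPE('n)) \<delta> \<alpha> q1) (- \<alpha>) q q1 \<Phi> A"
  for \<Phi> :: "'n::finite heis \<Rightarrow> complex"
  by (simp add: K2_def Kconst_def add.commute)

lemma K_integrand_eq:
  fixes \<Phi> :: "'n::finite heis \<Rightarrow> complex"
  assumes det: "det (A y) \<noteq> 0" and a: "mat_hnorm (A y) = ennreal a" "0 < a"
  shows "a < 1 \<Longrightarrow> K_factor q q1 \<Phi> A y * epowr (mat_hnorm (A y)) e_lo * eln (2 / mat_hnorm (A y))
      = ennreal (K_integrand e_lo e_hi q q1 \<Phi> A y)"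
    and "1 \<le> a \<Longrightarrow> K_factor q q1 \<Phi> A y * epowr (mat_hnorm (A y)) e_hi * eln (2 * mat_hnorm (A y))
      = ennreal (K_integrand e_lo e_hi q q1 \<Phi> A y)"
proof -
  let ?d = "1 / \<bar>det (A y)\<bar>" and ?\<kappa> = "norm (\<Phi> y) / hnorm y ^ hom_dim TYPE('n)"
  let ?X = "?d powr recip q * a powr (Qdim TYPE('n) * recip q)"
  have "K_factor q q1 \<Phi> A y = ennreal ?\<kappa> * (1 + ennreal (?d powr recip q) * ennreal (a powr (Qdim TYPE('n) * recip q))) * ennreal (?d powr recip q1)"
    unfolding K_factor_def a(1) abs_det_matrix_inv[OF det] epowr_eq[OF a(2)] ..
  also have "1 + ennreal (?d powr recip q) * ennreal (a powr (Qdim TYPE('n) * recip q)) = ennreal (1 + ?X)"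
    by (subst ennreal_mult[symmetric], simp, simp, subst ennreal_1[symmetric], subst ennreal_plus[symmetric]) auto
  also have "ennreal ?\<kappa> * ennreal (1 + ?X) * ennreal (?d powr recip q1) = ennreal (?\<kappa> * (1 + ?X) * ?d powr recip q1)"
    by (subst ennreal_mult, simp, simp, subst ennreal_mult) (auto intro: add_nonneg_nonneg)
  finally have K: "K_factor q q1 \<Phi> A y = ennreal (?\<kappa> * (1 + ?X) * ?d powr recip q1)" .
  have X0: "0 \<le> ?\<kappa> * (1 + ?X) * ?d powr recip q1" by (auto intro!: mult_nonneg_nonneg add_nonneg_nonneg)
  {
    assume "a < 1"
    have "2 / ennreal a = ennreal (2 / a)" using a(2) divide_ennreal[of 2 a] by simp
    then have "eln (2 / mat_hnorm (A y)) = ennreal (ln (2 / a))" using a by (simp add: eln_def)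
    moreover have "0 \<le> ln (2 / a)" using a(2) \<open>a < 1\<close> by (intro ln_ge_zero) simp
    ultimately have "K_factor q q1 \<Phi> A y * epowr (mat_hnorm (A y)) e_lo * eln (2 / mat_hnorm (A y))
      = ennreal (?\<kappa> * (1 + ?X) * ?d powr recip q1 * a powr e_lo * ln (2 / a))"
      unfolding K a(1) epowr_eq[OF a(2)] using X0 by (subst ennreal_mult, simp, simp, subst ennreal_mult, simp, simp, simp)
    then show "K_factor q q1 \<Phi> A y * epowr (mat_hnorm (A y)) e_lo * eln (2 / mat_hnorm (A y))
      = ennreal (K_integrand e_lo e_hi q q1 \<Phi> A y)"
      using det a \<open>a < 1\<close> by (simp add: K_integrand_def mult.assoc)
  }
  {
    assume "1 \<le> a"
    have "2 * ennreal a = ennreal (2 * a)" using a(2) by (simp add: ennreal_mult)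
    then have "eln (2 * mat_hnorm (A y)) = ennreal (ln (2 * a))" using a by (simp add: eln_def)
    moreover have "0 \<le> ln (2 * a)" using \<open>1 \<le> a\<close> by (intro ln_ge_zero) simp
    ultimately have "K_factor q q1 \<Phi> A y * epowr (mat_hnorm (A y)) e_hi * eln (2 * mat_hnorm (A y))
      = ennreal (?\<kappa> * (1 + ?X) * ?d powr recip q1 * a powr e_hi * ln (2 * a))"
      unfolding K a(1) epowr_eq[OF a(2)] using X0 by (subst ennreal_mult, simp, simp, subst ennreal_mult, simp, simp, simp)
    then show "K_factor q q1 \<Phi> A y * epowr (mat_hnorm (A y)) e_hi * eln (2 * mat_hnorm (A y))
      = ennreal (K_integrand e_lo e_hi q q1 \<Phi> A y)"
      using det a \<open>1 \<le> a\<close> by (simp add: K_integrand_def mult.assoc)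
  }
qed

lemma K_integrand_infinite:
  fixes \<Phi> :: "'n::finite heis \<Rightarrow> complex"
  assumes "det (A y) \<noteq> 0" "mat_hnorm (A y) = \<infinity>" "\<Phi> y \<noteq> 0" "y \<noteq> 0" "0 < e_hi"
  shows "K_factor q q1 \<Phi> A y * epowr (mat_hnorm (A y)) e_hi * eln (2 * mat_hnorm (A y)) = \<infinity>"
proof -
  have "0 < hnorm y" using assms(4) hnorm_nonneg[of y] hnorm_eq_0_iff[of y] by linarith
  then have "0 < norm (\<Phi> y) / hnorm y ^ hom_dim TYPE('n)" using assms(3) by simp
  moreover have "0 < \<bar>det (matrix_inv (A y))\<bar> powr recip q1" using assms by (simp add: abs_det_matrix_inv)
  ultimately have "K_factor q q1 \<Phi> A y \<noteq> 0"
    unfolding K_factor_def by (simp add: ennreal_eq_0_iff)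
  then show ?thesis using assms by (simp add: epowr_def eln_def ennreal_mult_eq_top_iff ennreal_top_mult)
qed

text \<open>If the norm of the matrix were infinite on a set of positive measure inside the support, the second
  integral would be infinite, because \<open>e_hi > 0\<close>. Elsewhere the integrands agree.\<close>

lemma K_integrand_le_Kconst:
  fixes \<Phi> \<Phi>' :: "'n::finite heis \<Rightarrow> complex"
  assumes [measurable]: "\<Phi>' \<in> borel_measurable borel" "A' \<in> borel_measurable borel"
    and eq: "AE y in lborel. \<Phi> y = \<Phi>' y" "AE y in lborel. A y = A' y"
    and det: "AE y in lborel. \<Phi> y \<noteq> 0 \<longrightarrow> det (A y) \<noteq> 0"
    and fin: "Kconst e_lo e_hi q q1 \<Phi> A < \<infinity>" and e_hi: "0 < e_hi"
  shows "AE y in lborel. \<Phi>' y \<noteq> 0 \<longrightarrow> det (A' y) \<noteq> 0 \<and> mat_hnorm (A' y) < \<infinity>"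
    and "(\<integral>\<^sup>+y. ennreal (K_integrand e_lo e_hi q q1 \<Phi>' A' y) \<partial>lborel) \<le> Kconst e_lo e_hi q q1 \<Phi> A"
proof -
  let ?lo = "\<lambda>y. K_factor q q1 \<Phi> A y * epowr (mat_hnorm (A y)) e_lo * eln (2 / mat_hnorm (A y))"
  let ?hi = "\<lambda>y. K_factor q q1 \<Phi> A y * epowr (mat_hnorm (A y)) e_hi * eln (2 * mat_hnorm (A y))"
  let ?Lo = "{y. mat_hnorm (A y) < 1}" and ?Hi = "{y. 1 \<le> mat_hnorm (A y)}"
  have K: "Kconst e_lo e_hi q q1 \<Phi> A = (\<integral>\<^sup>+y. ?lo y * indicator ?Lo y \<partial>lborel) + (\<integral>\<^sup>+y. ?hi y * indicator ?Hi y \<partial>lborel)"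
    unfolding Kconst_def nn_integral_completion ..
  \<comment> \<open>The origin is left out because the kernel vanishes there, by \<open>x / 0 = 0\<close>.\<close>
  define Z where "Z = {y :: 'n heis. \<Phi>' y \<noteq> 0 \<and> det (A' y) \<noteq> 0 \<and> y \<noteq> 0 \<and> mat_hnorm (A' y) = \<infinity>}"
  have Z[measurable]: "Z \<in> sets borel" unfolding Z_def by measurable
  have y0: "AE y in lborel. y \<noteq> (0 :: 'n heis)" by (rule AE_lborel_singleton)
  have "\<infinity> * emeasure lborel Z = (\<integral>\<^sup>+y. \<infinity> * indicator Z y \<partial>lborel)"
    by (rule nn_integral_cmult_indicator[symmetric]) simp
  also have "\<dots> \<le> (\<integral>\<^sup>+y. ?hi y * indicator ?Hi y \<partial>lborel)"
  proof (rule nn_integral_mono_AE, use eq in eventually_elim)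
    fix y assume *: "\<Phi> y = \<Phi>' y" "A y = A' y"
    show "\<infinity> * indicator Z y \<le> ?hi y * indicator ?Hi y"
    proof (cases "y \<in> Z")
      case True
      then have "?hi y = \<infinity>" using * e_hi by (intro K_integrand_infinite) (auto simp: Z_def)
      then show ?thesis using True * by (simp add: Z_def)
    qed simp
  qed
  also have "\<dots> < \<infinity>" using fin unfolding K by (simp add: ennreal_add_less_top)
  finally have "emeasure lborel Z = 0" by (auto simp: ennreal_mult_less_top ennreal_top_mult split: if_splits)
  then have "AE y in lborel. y \<notin> Z" by (intro AE_not_in) (auto simp: null_sets_def)
  with eq det y0 show good: "AE y in lborel. \<Phi>' y \<noteq> 0 \<longrightarrow> det (A' y) \<noteq> 0 \<and> mat_hnorm (A' y) < \<infinity>"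
    by eventually_elim (auto simp: Z_def less_top)
  let ?h = "K_integrand e_lo e_hi q q1 \<Phi>' A'"
  let ?L = "{y. mat_hnorm (A' y) < 1}" and ?R = "{y. 1 \<le> mat_hnorm (A' y)}"
  have "(\<integral>\<^sup>+y. ennreal (?h y) \<partial>lborel) = (\<integral>\<^sup>+y. ennreal (?h y) * indicator ?L y + ennreal (?h y) * indicator ?R y \<partial>lborel)"
    by (intro nn_integral_cong) (auto simp: indicator_def not_less)
  also have "\<dots> = (\<integral>\<^sup>+y. ennreal (?h y) * indicator ?L y \<partial>lborel) + (\<integral>\<^sup>+y. ennreal (?h y) * indicator ?R y \<partial>lborel)"
    by (rule nn_integral_add) measurable
  also have "\<dots> \<le> Kconst e_lo e_hi q q1 \<Phi> A"
    unfolding K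
  proof (intro add_mono nn_integral_mono_AE)
    have h0: "?h y = 0" if "\<Phi>' y = 0" for y using that by (simp add: K_integrand_def)
    have ex: "\<exists>a>0. mat_hnorm (A' y) = ennreal a" if "det (A' y) \<noteq> 0" "mat_hnorm (A' y) < \<infinity>" for y
      using mat_hnorm_pos[OF that(1)] that(2) by (cases "mat_hnorm (A' y)") (auto simp: less_top)
    have hk: "K_integrand e_lo e_hi q q1 \<Phi> A y = ?h y" if "\<Phi> y = \<Phi>' y" "A y = A' y" for y
      using that by (simp add: K_integrand_def)
    show "AE y in lborel. ennreal (?h y) * indicator ?L y \<le> ?lo y * indicator ?Lo y"
      using eq good
    proof eventually_elim
      fix y assume *: "\<Phi> y = \<Phi>' y" "A y = A' y" "\<Phi>' y \<noteq> 0 \<longrightarrow> det (A' y) \<noteq> 0 \<and> mat_hnorm (A' y) < \<infinity>"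
      show "ennreal (?h y) * indicator ?L y \<le> ?lo y * indicator ?Lo y"
      proof (cases "\<Phi>' y = 0 \<or> y \<notin> ?L")
        case True
        then show ?thesis using h0 by auto
      next
        case False
        with *(3) ex obtain a where a: "0 < a" "mat_hnorm (A' y) = ennreal a" by blast
        with False have "a < 1" by simp
        then show ?thesis using K_integrand_eq(1)[of A y a q q1 \<Phi> e_lo e_hi] hk[OF *(1,2)] * a False by simp
      qed
    qed
    show "AE y in lborel. ennreal (?h y) * indicator ?R y \<le> ?hi y * indicator ?Hi y"
      using eq good
    proof eventually_elim
      fix y assume *: "\<Phi> y = \<Phi>' y" "A y = A' y" "\<Phi>' y \<noteq> 0 \<longrightarrow> det (A' y) \<noteq> 0 \<and> mat_hnorm (A' y) < \<infinity>"
      show "ennreal (?h y) * indicator ?R y \<le> ?hi y * indicator ?Hi y"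
      proof (cases "\<Phi>' y = 0 \<or> y \<notin> ?R")
        case True
        then show ?thesis using h0 by auto
      next
        case False
        with *(3) ex obtain a where a: "0 < a" "mat_hnorm (A' y) = ennreal a" by blast
        with False have "1 \<le> a" by simp
        then show ?thesis using K_integrand_eq(2)[of A y a q q1 \<Phi> e_hi e_lo] hk[OF *(1,2)] * a False by simp
      qed
    qed
  qed
  finally show "(\<integral>\<^sup>+y. ennreal (?h y) \<partial>lborel) \<le> Kconst e_lo e_hi q q1 \<Phi> A" .
qed

text \<open>The preimage of a null set under an invertible matrix is null; by Tonelli, for almost every \<open>x\<close> the points
  \<open>A(y) x\<close> avoid a given null set for almost every relevant \<open>y\<close>.\<close>

lemma AE_commutator_integrand_eq:
  fixes b f \<Phi> :: "'n::finite heis \<Rightarrow> complex"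
  assumes b: "AE x in lborel. b x = b' x" and f: "AE x in lborel. f x = f' x"
    and \<Phi>: "AE y in lborel. \<Phi> y = \<Phi>' y" and A: "AE y in lborel. A y = A' y"
    and [measurable]: "A' \<in> borel_measurable borel"
    and det: "AE y in lborel. \<Phi>' y \<noteq> 0 \<longrightarrow> det (A' y) \<noteq> 0"
  shows "AE x in lborel. AE y in lborel. commutator_integrand \<Phi> A b f x y = commutator_integrand \<Phi>' A' b' f' x y"
proof -
  have "AE x in lborel. b x = b' x \<and> f x = f' x" using b f by eventually_elim simp
  then obtain N where N: "{x \<in> space lborel. \<not> (b x = b' x \<and> f x = f' x)} \<subseteq> N" "emeasure lborel N = 0" "N \<in> sets lborel"
    by (rule AE_E)
  then have [measurable]: "N \<in> sets borel" by simp
  have eqN: "b x = b' x" "f x = f' x" if "x \<notin> N" for x using that N(1) by auto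
  have Nn: "AE x in lborel. x \<notin> N" using N by (intro AE_not_in) (auto simp: null_sets_def)
  have "AE y in lborel. AE x in lborel. det (A' y) \<noteq> 0 \<longrightarrow> A' y *v x \<notin> N"
  proof (rule AE_I2)
    fix y
    show "AE x in lborel. det (A' y) \<noteq> 0 \<longrightarrow> A' y *v x \<notin> N"
      using AE_matrix[OF Nn, of "A' y"] by (cases "det (A' y) = 0") auto
  qed
  then have "AE x in lborel. AE y in lborel. det (A' y) \<noteq> 0 \<longrightarrow> A' y *v x \<notin> N"
    by (subst lborel_pair.AE_commute) measurable
  with Nn show ?thesis
  proof eventually_elim
    fix x assume x: "x \<notin> N" "AE y in lborel. det (A' y) \<noteq> 0 \<longrightarrow> A' y *v x \<notin> N"
    show "AE y in lborel. commutator_integrand \<Phi> A b f x y = commutator_integrand \<Phi>' A' b' f' x y"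
      using x(2) \<Phi> A det
    proof eventually_elim
      fix y assume *: "det (A' y) \<noteq> 0 \<longrightarrow> A' y *v x \<notin> N" "\<Phi> y = \<Phi>' y" "A y = A' y" "\<Phi>' y \<noteq> 0 \<longrightarrow> det (A' y) \<noteq> 0"
      show "commutator_integrand \<Phi> A b f x y = commutator_integrand \<Phi>' A' b' f' x y"
        using * eqN[OF x(1)] eqN[of "A' y *v x"] by (cases "\<Phi>' y = 0") (auto simp: commutator_integrand_def)
    qed
  qed
qed

section \<open>The theorem\<close>

lemma compact_subset_shells:
  fixes S :: "'n::finite heis set"
  assumes S: "compact S" "S \<subseteq> - {0}"
  obtains m k where "S \<subseteq> (\<Union>l\<in>{m..k}. dshell l)"
proof (cases "S = {}")
  case True
  then show ?thesis using that by blast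
next
  case False
  obtain x0 where x0: "x0 \<in> S" "\<And>x. x \<in> S \<Longrightarrow> hnorm x0 \<le> hnorm x"
    using continuous_attains_inf[OF S(1) False continuous_on_hnorm] by auto
  obtain x1 where x1: "x1 \<in> S" "\<And>x. x \<in> S \<Longrightarrow> hnorm x \<le> hnorm x1"
    using continuous_attains_sup[OF S(1) False continuous_on_hnorm] by auto
  have pos: "0 < hnorm x" if "x \<in> S" for x
  proof -
    have "x \<noteq> 0" using that S(2) by auto
    then show ?thesis using hnorm_nonneg[of x] hnorm_eq_0_iff[of x] by linarith
  qed
  have mono: "dlevel a \<le> dlevel b" if "0 < a" "a \<le> b" for a b
    using that unfolding dlevel_def by (intro add_right_mono floor_mono) simp
  show ?thesis
  proof (rule that)
    show "S \<subseteq> (\<Union>l\<in>{dlevel (hnorm x0)..dlevel (hnorm x1)}. dshell l)"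
    proof
      fix x assume x: "x \<in> S"
      have "x \<in> dshell (dlevel (hnorm x))"
        using dlevel[OF pos[OF x]] by (simp add: dshell_def dball_def)
      then show "x \<in> (\<Union>l\<in>{dlevel (hnorm x0)..dlevel (hnorm x1)}. dshell l)"
        using mono[OF pos[OF x0(1)] x0(2)[OF x]] mono[OF pos[OF x] x1(2)[OF x]] by auto
    qed
  qed
qed

lemma (in dyadic_weight) Lq_loc_of_shells:
  fixes g :: "'n heis \<Rightarrow> complex"
  assumes [measurable]: "g \<in> borel_measurable lebesgue" and q: "1 \<le> q" "q \<noteq> \<infinity>"
    and fin: "\<And>l. Lq_norm q (dshell l) w g < \<infinity>"
  shows "g \<in> Lq_loc q (- {0}) w"
proof -
  define t where "t = enn2real q"
  have t: "1 \<le> t" using enn2real_exponent[OF q] by (simp add: t_def)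
  let ?g = "\<lambda>x. ennreal (norm (g x) powr t * w x)"
  have iff: "Lq_norm q E w g < \<infinity> \<longleftrightarrow> (\<integral>\<^sup>+x\<in>E. ?g x \<partial>lebesgue) < \<infinity>" for E
    unfolding Lq_norm_def using q(2) t by (auto simp: t_def[symmetric] epowr_def less_top)
  have "Lq_norm q S w g < \<infinity>" if S: "compact S" "S \<subseteq> - {0}" for S
  proof -
    obtain m k where mk: "S \<subseteq> (\<Union>l\<in>{m..k}. dshell l)" using compact_subset_shells[OF S] .
    have "(\<integral>\<^sup>+x\<in>S. ?g x \<partial>lebesgue) \<le> (\<integral>\<^sup>+x. (\<Sum>l\<in>{m..k}. ?g x * indicator (dshell l) x) \<partial>lebesgue)"
    proof (rule nn_integral_mono)
      fix x
      show "?g x * indicator S x \<le> (\<Sum>l\<in>{m..k}. ?g x * indicator (dshell l) x)"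
      proof (cases "x \<in> S")
        case True
        then obtain l where l: "l \<in> {m..k}" "x \<in> dshell l" using mk by blast
        have "?g x * indicator (dshell l) x \<le> (\<Sum>l\<in>{m..k}. ?g x * indicator (dshell l) x)"
          by (rule member_le_sum[OF l(1)]) auto
        then show ?thesis using True l by simp
      qed simp
    qed
    also have "\<dots> = (\<Sum>l\<in>{m..k}. \<integral>\<^sup>+x\<in>dshell l. ?g x \<partial>lebesgue)"
      by (rule nn_integral_sum) measurable
    also have "\<dots> < \<infinity>" using fin[unfolded iff] by (simp flip: less_top)
    finally show ?thesis unfolding iff .
  qed
  then show ?thesis by (auto simp: Lq_loc_def)
qed

lemma loc_integrable_cong_AE:
  fixes b b' :: "'n::finite heis \<Rightarrow> complex"
  assumes b: "loc_integrable b" and b': "b' \<in> borel_measurable borel" and eq: "AE x in lebesgue. b x = b' x"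
  shows "loc_integrable b'" and "mean (dball k) b' = mean (dball k) b"
proof -
  have [measurable]: "b \<in> borel_measurable lebesgue" "b' \<in> borel_measurable lebesgue"
    using loc_integrable_measurable[OF b] borel_imp_lebesgue_measurable[OF b'] by auto
  show "loc_integrable b'"
    unfolding loc_integrable_def set_integrable_def
  proof (intro allI impI)
    fix S :: "'n heis set" assume S: "compact S"
    then have [measurable]: "S \<in> sets lebesgue" by (intro sets_completionI_sets) (simp add: borel_compact)
    have "integrable lebesgue (\<lambda>x. indicator S x *\<^sub>R b x)"
      using b S by (simp add: loc_integrable_def set_integrable_def)
    moreover have "AE x in lebesgue. indicator S x *\<^sub>R b x = indicator S x *\<^sub>R b' x"
      using eq by eventually_elim simp
    ultimately show "integrable lebesgue (\<lambda>x. indicator S x *\<^sub>R b' x)"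
      by (subst (asm) integrable_cong_AE[of _ lebesgue "\<lambda>x. indicator S x *\<^sub>R b' x"]) auto
  qed
  have "(LINT x:dball k|lebesgue. b' x) = (LINT x:dball k|lebesgue. b x)"
    unfolding set_lebesgue_integral_def
  proof (rule integral_cong_AE)
    show "AE x in lebesgue. indicator (dball k) x *\<^sub>R b' x = indicator (dball k) x *\<^sub>R b x"
      using eq by eventually_elim simp
  qed measurable
  then show "mean (dball k) b' = mean (dball k) b" by (simp add: mean_def)
qed

context hausdorff_herz
begin

text \<open>The bound for Borel data, transferred along almost everywhere equality. Where the integral of the absolute
  value is finite, hence almost everywhere, the integral defining the commutator converges.\<close>

theorem commutator_in_herz:
  fixes b f \<Phi> :: "'n heis \<Rightarrow> complex"
  assumes adm: "admissible \<Phi> A" and fin: "Kconst e_lo e_hi q q1 \<Phi> A < \<infinity>" and e_hi: "0 < e_hi"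
    and b: "b \<in> cmo q w" and f: "f \<in> herz \<alpha>1 p q1 w"
  shows "AE x in lebesgue. integrable lebesgue (commutator_integrand \<Phi> A b f x)"
    and "commutator \<Phi> A b f \<in> herz \<alpha>2 p q2 w"
    and "herz_norm \<alpha>2 p q2 w (commutator \<Phi> A b f)
      \<le> ennreal (total_const TYPE('n)) * Kconst e_lo e_hi q q1 \<Phi> A * cmo_norm q w b * herz_norm \<alpha>1 p q1 w f"
proof -
  let ?Q = "Qdim TYPE('n)"
  have \<Phi>m: "\<Phi> \<in> borel_measurable lebesgue" and Am: "A \<in> borel_measurable lebesgue"
    and det: "AE y in lborel. \<Phi> y \<noteq> 0 \<longrightarrow> det (A y) \<noteq> 0"
    using adm loc_integrable_measurable[of \<Phi>] by (auto simp: admissible_def AE_completion_iff)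
  have bm[measurable]: "b \<in> borel_measurable lebesgue" and bl: "loc_integrable b" and bfin: "cmo_norm q w b < \<infinity>"
    using b by (auto simp: cmo_def Lq_loc_def)
  have fm[measurable]: "f \<in> borel_measurable lebesgue" and ffin: "herz_norm \<alpha>1 p q1 w f < \<infinity>"
    using f by (auto simp: herz_def Lq_loc_def)
  obtain b' where b': "b' \<in> borel_measurable borel" "AE x in lborel. b x = b' x" using borel_version[OF bm] .
  obtain f' where f': "f' \<in> borel_measurable borel" "AE x in lborel. f x = f' x" using borel_version[OF fm] .
  obtain \<Phi>' where \<Phi>': "\<Phi>' \<in> borel_measurable borel" "AE x in lborel. \<Phi> x = \<Phi>' x" using borel_version[OF \<Phi>m] .
  obtain A' where A': "A' \<in> borel_measurable borel" "AE x in lborel. A x = A' x" using borel_version[OF Am] .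
  have bL: "AE x in lebesgue. b x = b' x" and fL: "AE x in lebesgue. f x = f' x"
    using b'(2) f'(2) by (simp_all add: AE_completion_iff)
  note [measurable] = b'(1)[THEN borel_imp_lebesgue_measurable] f'(1)[THEN borel_imp_lebesgue_measurable]
  define B where "B = enn2real (cmo_norm q w b)"
  define \<kappa> where "\<kappa> = enn2real (Kconst e_lo e_hi q q1 \<Phi> A)"
  define H where "H = enn2real (herz_norm \<alpha>1 p q1 w f)"
  define F where "F l = enn2real (Lq_norm q1 (dshell l) w f)" for l
  have BK: "cmo_norm q w b = ennreal B" "Kconst e_lo e_hi q q1 \<Phi> A = ennreal \<kappa>" "herz_norm \<alpha>1 p q1 w f = ennreal H"
    using bfin fin ffin by (simp_all add: B_def \<kappa>_def H_def less_top)
  have nn: "0 \<le> B" "0 \<le> \<kappa>" "0 \<le> H" by (simp_all add: B_def \<kappa>_def H_def)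
  have bd: "lp_bound q (Wavg k) (\<lambda>x. norm (b' x - mean (dball k) b')) B" for k
  proof (rule lp_bound_mono[OF lp_bound_of_cmo[OF bm q(1) _ nn(1)]])
    show "cmo_norm q w b \<le> ennreal B" using BK by simp
    show "AE x in Wavg k. \<bar>norm (b' x - mean (dball k) b')\<bar> \<le> \<bar>norm (b x - mean (dball k) b)\<bar>"
      unfolding AE_Wavg loc_integrable_cong_AE(2)[OF bl b'(1) bL] using bL by eventually_elim simp
  qed (auto simp: measurable_Wavg)
  have fd: "lp_bound q1 (Wshell l) (\<lambda>x. norm (f' x)) (F l)" for l
  proof (rule lp_bound_mono)
    show "lp_bound q1 (Wshell l) (\<lambda>x. norm (f x)) (F l)"
      using herz_norm_lp_bound(1)[OF p ffin, of l]
      by (subst lp_bound_Wshell_iff[OF fm _ q(2)]) (auto simp: F_def less_top)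
    show "AE x in Wshell l. \<bar>norm (f' x)\<bar> \<le> \<bar>norm (f x)\<bar>"
      unfolding AE_Wshell using fL by eventually_elim simp
  qed (auto simp: measurable_cong_sets[OF sets_Wshell refl])
  have Hd: "lp_bound p (count_space UNIV) (\<lambda>l. W l powr (\<alpha>1 / ?Q) * F l) H"
    unfolding F_def H_def by (rule herz_norm_lp_bound(2)[OF p ffin])
  note Kh = K_integrand_le_Kconst[OF \<Phi>'(1) A'(1) \<Phi>'(2) A'(2) det fin e_hi]
  define h where "h x = (\<integral>\<^sup>+y. ennreal (norm (commutator_integrand \<Phi>' A' b' f' x y)) \<partial>lborel)" for x
  obtain G where G: "\<And>k. 0 \<le> G k"
    "lp_bound p (count_space UNIV) G (total_const TYPE('n) * \<kappa> * B * H)"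
    "\<And>k. AE x in lebesgue. x \<in> dball k \<longrightarrow> h x < \<infinity>"
    "\<And>k. lp_bound q2 (Wshell k) (\<lambda>x. enn2real (h x)) (W k powr (- \<alpha>2 / ?Q) * G k)"
    using commutator_herz_bound[OF loc_integrable_cong_AE(1)[OF bl b'(1) bL] b'(1) bd f'(1) fd Hd \<Phi>'(1) A'(1) Kh(1) _ nn(2)]
      Kh(2) unfolding BK(2) h_def by blast
  have det': "AE y in lborel. \<Phi>' y \<noteq> 0 \<longrightarrow> det (A' y) \<noteq> 0" using Kh(1) by eventually_elim simp
  have eq: "AE x in lborel. AE y in lborel. commutator_integrand \<Phi> A b f x y = commutator_integrand \<Phi>' A' b' f' x y"
    by (rule AE_commutator_integrand_eq[OF b'(2) f'(2) \<Phi>'(2) A'(2) A'(1) det'])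
  have "AE x in lebesgue. \<forall>k::nat. x \<in> dball (int k) \<longrightarrow> h x < \<infinity>"
    by (subst AE_all_countable) (intro allI G(3))
  then have hfin: "AE x in lborel. h x < \<infinity>"
    unfolding AE_completion_iff by eventually_elim (use ex_mem_dball in blast)
  define T where "T x = (LINT y|lborel. commutator_integrand \<Phi>' A' b' f' x y)" for x
  have jm: "(\<lambda>(x, y). commutator_integrand \<Phi>' A' b' f' x y) \<in> borel_measurable (borel \<Otimes>\<^sub>M borel)"
    by (rule measurable_commutator_integrand[OF b'(1) f'(1) \<Phi>'(1) A'(1)])
  then have "(\<lambda>(x, y). commutator_integrand \<Phi>' A' b' f' x y) \<in> borel_measurable (borel \<Otimes>\<^sub>M lborel)"
    by (simp add: measurable_cong_sets[OF sets_pair_measure_cong[OF refl sets_lborel] refl])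
  then have Tm: "T \<in> borel_measurable borel"
    unfolding T_def by (rule lborel.borel_measurable_lebesgue_integral)
  have sec: "commutator_integrand \<Phi>' A' b' f' x \<in> borel_measurable borel" for x
    using measurable_compose[OF measurable_Pair1' jm, of x] by simp
  have all: "AE x in lborel. integrable lebesgue (commutator_integrand \<Phi> A b f x)
      \<and> commutator \<Phi> A b f x = T x \<and> norm (T x) \<le> enn2real (h x)"
    using eq hfin
  proof eventually_elim
    fix x assume x: "AE y in lborel. commutator_integrand \<Phi> A b f x y = commutator_integrand \<Phi>' A' b' f' x y" "h x < \<infinity>"
    have int: "integrable lborel (commutator_integrand \<Phi>' A' b' f' x)"
      using x(2) sec[of x] by (simp add: integrable_iff_bounded h_def)
    have m': "commutator_integrand \<Phi>' A' b' f' x \<in> borel_measurable lebesgue"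
      by (rule borel_imp_lebesgue_measurable[OF sec])
    have ae: "AE y in lebesgue. commutator_integrand \<Phi>' A' b' f' x y = commutator_integrand \<Phi> A b f x y"
      unfolding AE_completion_iff using x(1) by eventually_elim simp
    have m: "commutator_integrand \<Phi> A b f x \<in> borel_measurable lebesgue"
      by (rule lebesgue_measurable_AE[OF m' ae])
    have int': "integrable lebesgue (commutator_integrand \<Phi>' A' b' f' x)"
      using int sec[of x] by (subst integrable_completion) auto
    have "integrable lebesgue (commutator_integrand \<Phi> A b f x)"
      using int' integrable_cong_AE[OF m' m ae] by simp
    moreover have "commutator \<Phi> A b f x = T x"
    proof -
      have "commutator \<Phi> A b f x = (LINT y|lebesgue. commutator_integrand \<Phi>' A' b' f' x y)"
        unfolding commutator_def by (rule integral_cong_AE[OF m' m ae, symmetric])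
      also have "\<dots> = T x" unfolding T_def using sec[of x] by (intro integral_completion) simp
      finally show ?thesis .
    qed
    moreover have "norm (T x) \<le> enn2real (h x)"
    proof -
      have "ennreal (norm (T x)) \<le> h x" unfolding T_def h_def by (rule integral_norm_bound_ennreal[OF int])
      also have "h x = ennreal (enn2real (h x))" using x(2) by (simp add: less_top)
      finally show ?thesis by simp
    qed
    ultimately show "integrable lebesgue (commutator_integrand \<Phi> A b f x)
      \<and> commutator \<Phi> A b f x = T x \<and> norm (T x) \<le> enn2real (h x)" by blast
  qed
  then show "AE x in lebesgue. integrable lebesgue (commutator_integrand \<Phi> A b f x)"
    unfolding AE_completion_iff by eventually_elim simp
  have commT: "AE x in lebesgue. T x = commutator \<Phi> A b f x"
    unfolding AE_completion_iff using all by eventually_elim simp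
  have cm: "commutator \<Phi> A b f \<in> borel_measurable lebesgue"
    by (rule lebesgue_measurable_AE[OF borel_imp_lebesgue_measurable[OF Tm] commT])
  have G': "0 \<le> W k powr (- \<alpha>2 / ?Q) * G k" for k using G(1) by simp
  have Lq: "Lq_norm q2 (dshell k) w (commutator \<Phi> A b f) \<le> ennreal (W k powr (- \<alpha>2 / ?Q) * G k)" for k
  proof -
    have "lp_bound q2 (Wshell k) (\<lambda>x. norm (commutator \<Phi> A b f x)) (W k powr (- \<alpha>2 / ?Q) * G k)"
    proof (rule lp_bound_mono[OF G(4) order_refl])
      show "(\<lambda>x. norm (commutator \<Phi> A b f x)) \<in> borel_measurable (Wshell k)"
        using cm by (simp add: measurable_cong_sets[OF sets_Wshell refl])
      show "AE x in Wshell k. \<bar>norm (commutator \<Phi> A b f x)\<bar> \<le> \<bar>enn2real (h x)\<bar>"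
        unfolding AE_Wshell AE_completion_iff using all by eventually_elim simp
    qed
    then show ?thesis by (simp only: lp_bound_Wshell_iff[OF cm G' q(3)])
  qed
  have "herz_norm \<alpha>2 p q2 w (commutator \<Phi> A b f) \<le> ennreal (total_const TYPE('n) * \<kappa> * B * H)"
  proof (rule herz_norm_le[OF p Lq G'])
    have "W k powr (\<alpha>2 / ?Q) * (W k powr (- \<alpha>2 / ?Q) * G k) = G k" for k
      using wvol_pos[of k] by (simp flip: mult.assoc powr_add)
    then show "lp_bound p (count_space UNIV) (\<lambda>k. W k powr (\<alpha>2 / ?Q) * (W k powr (- \<alpha>2 / ?Q) * G k)) (total_const TYPE('n) * \<kappa> * B * H)"
      using G(2) by (simp only:)
  qed
  also have "\<dots> = ennreal (total_const TYPE('n)) * Kconst e_lo e_hi q q1 \<Phi> A * cmo_norm q w b * herz_norm \<alpha>1 p q1 w f"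
    unfolding BK using nn total_const_nonneg by (simp add: ennreal_mult)
  finally show le: "herz_norm \<alpha>2 p q2 w (commutator \<Phi> A b f)
      \<le> ennreal (total_const TYPE('n)) * Kconst e_lo e_hi q q1 \<Phi> A * cmo_norm q w b * herz_norm \<alpha>1 p q1 w f" .
  have "Lq_norm q2 (dshell k) w (commutator \<Phi> A b f) < \<infinity>" for k
    using Lq[of k] by (simp add: order_le_less_trans)
  then have "commutator \<Phi> A b f \<in> Lq_loc q2 (- {0}) w"
    by (rule Lq_loc_of_shells[OF cm q(3,4)])
  moreover have "herz_norm \<alpha>2 p q2 w (commutator \<Phi> A b f) < \<infinity>"
    using le unfolding BK by (rule order_le_less_trans) (simp add: ennreal_mult_less_top)
  ultimately show "commutator \<Phi> A b f \<in> herz \<alpha>2 p q2 w" by (simp add: herz_def)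
qed

end

text \<open>With \<open>\<sigma> = 1/q + 1/q1 = 1/s\<close> the hypothesis reads \<open>q2 \<sigma> < 1 - 1/r\<^sub>w\<close>, where \<open>r\<^sub>w\<close> is the critical index. Every
  admissible \<open>r\<close> close enough to \<open>r\<^sub>w\<close> therefore satisfies \<open>q2 \<sigma> \<le> 1 - 1/r\<close> and \<open>r \<ge> \<delta>\<close>; since the critical index
  is a supremum, there is one.\<close>

lemma obtain_exponent:
  fixes w :: "'n::finite heis \<Rightarrow> real" and q q1 q2 s :: ennreal
  assumes q: "1 \<le> q" "1 \<le> q1" and s: "1 / s = 1 / q1 + 1 / q"
    and lt: "q2 * conj_exponent (critical_index w) < s"
    and \<delta>: "1 < \<delta>" "ennreal \<delta> < critical_index w"
  obtains r where "1 < r" "\<delta> \<le> r" "reverse_Hoelder r w" "q2 \<noteq> \<infinity>"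
    "enn2real q2 * recip q + enn2real q2 * recip q1 + 1 / r \<le> 1"
proof -
  let ?R = "critical_index w"
  define \<sigma> where "\<sigma> = recip q + recip q1"
  have "1 / q' = ennreal (recip q')" if "1 \<le> q'" for q' :: ennreal
  proof (cases "q' = \<infinity>")
    case False
    then show ?thesis using enn2real_exponent[OF that False] divide_ennreal[of 1 "enn2real q'"] by simp
  qed (simp add: recip_def)
  then have s\<sigma>: "1 / s = ennreal \<sigma>"
    using s q recip_nonneg[of q] recip_nonneg[of q1] by (simp add: \<sigma>_def add.commute)
  have \<sigma>0: "0 \<le> \<sigma>" using recip_nonneg[of q] recip_nonneg[of q1] by (simp add: \<sigma>_def)
  have s0: "0 < s" using lt by (rule le_less_trans[rotated]) simp
  have conj: "1 \<le> conj_exponent ?R \<and> q2 \<noteq> \<infinity> \<and> ennreal (1 / (1 - enn2real q2 * \<sigma>)) < ?R \<and> enn2real q2 * \<sigma> < 1"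
  proof (cases ?R)
    case top
    then have c: "conj_exponent ?R = 1" by (simp add: conj_exponent_def)
    then have "q2 < s" using lt by simp
    then have q2: "q2 \<noteq> \<infinity>" by auto
    have "enn2real q2 * \<sigma> < 1"
    proof (cases s)
      case (real S)
      then have S: "0 < S" using s0 by simp
      have "\<sigma> = 1 / S"
      proof -
        have "ennreal \<sigma> = ennreal (1 / S)" using s\<sigma> real S divide_ennreal[of 1 S] by simp
        then show ?thesis using \<sigma>0 S by simp
      qed
      moreover have "enn2real q2 < S" using \<open>q2 < s\<close> real q2 by (cases q2) (auto simp: ennreal_less_iff)
      ultimately show ?thesis using S by simp
    next
      case top
      then show ?thesis using s\<sigma> recip_nonneg[of q] recip_nonneg[of q1] by (simp add: \<sigma>_def ennreal_eq_0_iff)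
    qed
    then show ?thesis using c q2 top by simp
  next
    case (real \<rho>)
    then have \<rho>: "1 < \<rho>" using \<delta> by (simp add: ennreal_less_iff)
    have c: "conj_exponent ?R = ennreal (\<rho> / (\<rho> - 1))"
    proof -
      have "ennreal \<rho> - 1 = ennreal (\<rho> - 1)" using \<rho> by (simp add: ennreal_minus flip: ennreal_1)
      then show ?thesis using real \<rho> divide_ennreal[of \<rho> "\<rho> - 1"] by (simp add: conj_exponent_def)
    qed
    have c1: "1 < \<rho> / (\<rho> - 1)" using \<rho> by simp
    have q2: "q2 \<noteq> \<infinity>" using lt c1 \<rho> unfolding c by (auto simp: ennreal_top_mult)
    then have q2r: "q2 = ennreal (enn2real q2)" by (simp add: less_top)
    have t: "enn2real q2 * \<sigma> < 1 - 1 / \<rho>"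
    proof (cases s)
      case (real S)
      then have S: "0 < S" using s0 by simp
      have \<sigma>S: "\<sigma> = 1 / S"
      proof -
        have "ennreal \<sigma> = ennreal (1 / S)" using s\<sigma> real S divide_ennreal[of 1 S] by simp
        then show ?thesis using \<sigma>0 S by simp
      qed
      have "ennreal (enn2real q2 * (\<rho> / (\<rho> - 1))) < ennreal S"
        using lt \<rho> unfolding c real(2) by (subst (asm) q2r, subst ennreal_mult) auto
      then have "enn2real q2 * (\<rho> / (\<rho> - 1)) < S"
        using \<rho> by (subst (asm) ennreal_less_iff) auto
      then show ?thesis unfolding \<sigma>S using S \<rho> by (simp add: field_simps)
    next
      case top
      then have "\<sigma> = 0" using s\<sigma> recip_nonneg[of q] recip_nonneg[of q1] by (simp add: \<sigma>_def ennreal_eq_0_iff)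
      then show ?thesis using \<rho> by simp
    qed
    have "0 < 1 / \<rho>" using \<rho> by simp
    then have t1: "enn2real q2 * \<sigma> < 1" using t by linarith
    have "1 / (1 - enn2real q2 * \<sigma>) < \<rho>" using t t1 \<rho> by (simp add: field_simps)
    then have "ennreal (1 / (1 - enn2real q2 * \<sigma>)) < ?R" using t1 unfolding real(2) by (simp add: ennreal_less_iff)
    moreover have "1 \<le> conj_exponent ?R" unfolding c using c1 by (simp flip: ennreal_1)
    ultimately show ?thesis using q2 t1 by simp
  qed
  define m where "m = max \<delta> (1 / (1 - enn2real q2 * \<sigma>))"
  \<comment> \<open>Both \<open>\<delta>\<close> and the conjugate of \<open>1 / (q2 \<sigma>)\<close> lie strictly below the critical index.\<close>
  have "ennreal m < ?R" using conj \<delta> by (simp add: m_def max_def)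
  then obtain r where r: "1 < r" "reverse_Hoelder r w" "ennreal m < ennreal r"
    unfolding critical_index_def less_SUP_iff by auto
  then have mr: "m < r"
  proof -
    have "0 \<le> m" using \<delta>(1) by (simp add: m_def)
    then show ?thesis using r(3) by (subst (asm) ennreal_less_iff)
  qed
  have "1 / (1 - enn2real q2 * \<sigma>) \<le> r" using mr by (simp add: m_def)
  then have "1 / r \<le> 1 - enn2real q2 * \<sigma>" using conj r(1) by (simp add: field_simps)
  then have "enn2real q2 * recip q + enn2real q2 * recip q1 + 1 / r \<le> 1" by (simp add: \<sigma>_def distrib_left)
  moreover have "\<delta> \<le> r" using mr by (simp add: m_def)
  ultimately show ?thesis using that r conj by blast
qed

theorem theorem3p1:
  fixes w :: "'n::finite heis \<Rightarrow> real"
    and p q q1 q2 s :: ennreal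
    and \<alpha>1 \<alpha>2 :: real
  assumes "1 \<le> p" "1 \<le> q" "1 \<le> q1" "1 \<le> q2"
    and "\<alpha>1 < 0"
    and "1 / s = 1 / q1 + 1 / q"
    and "\<alpha>1 / real (hom_dim TYPE('n)) + recip q1 = \<alpha>2 / real (hom_dim TYPE('n)) + recip q2"
    and "A1_weight w"
    and "q2 * conj_exponent (critical_index w) < s"
  shows
 "(recip q1 + \<alpha>1 / real (hom_dim TYPE('n)) \<ge> 0 \<longrightarrow>
       (\<forall>\<delta>. 1 < \<delta> \<and> ennreal \<delta> < critical_index w \<longrightarrow>
          (\<exists>C>0. \<forall>\<Phi> A. admissible \<Phi> A \<and> K1 \<delta> \<alpha>1 q q1 \<Phi> A < \<infinity> \<longrightarrow>
             (\<forall>b\<in>cmo q w. \<forall>f\<in>herz \<alpha>1 p q1 w.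
                (AE x in lebesgue. integrable lebesgue (commutator_integrand \<Phi> A b f x)) \<and>
                commutator \<Phi> A b f \<in> herz \<alpha>2 p q2 w \<and>
                herz_norm \<alpha>2 p q2 w (commutator \<Phi> A b f)
                  \<le> ennreal C * K1 \<delta> \<alpha>1 q q1 \<Phi> A * cmo_norm q w b * herz_norm \<alpha>1 p q1 w f))))
  \<and>
   (recip q1 + \<alpha>1 / real (hom_dim TYPE('n)) < 0 \<longrightarrow>
       (\<forall>\<delta>. 1 < \<delta> \<and> ennreal \<delta> < critical_index w \<longrightarrow>
          (\<exists>C>0. \<forall>\<Phi> A. admissible \<Phi> A \<and> K2 \<delta> \<alpha>1 q q1 \<Phi> A < \<infinity> \<longrightarrow>
             (\<forall>b\<in>cmo q w. \<forall>f\<in>herz \<alpha>1 p q1 w.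
                (AE x in lebesgue. integrable lebesgue (commutator_integrand \<Phi> A b f x)) \<and>
                commutator \<Phi> A b f \<in> herz \<alpha>2 p q2 w \<and>
                herz_norm \<alpha>2 p q2 w (commutator \<Phi> A b f)
                  \<le> ennreal C * K2 \<delta> \<alpha>1 q q1 \<Phi> A * cmo_norm q w b * herz_norm \<alpha>1 p q1 w f))))"
proof -
  let ?Q = "Qdim TYPE('n)" and ?e = "\<lambda>\<delta>. K_exponent (hom_dim TYPE('n)) \<delta> \<alpha>1 q1"
  let ?bound = "\<lambda>C K. \<forall>\<Phi> A. admissible \<Phi> A \<and> K \<Phi> A < \<infinity> \<longrightarrow>
             (\<forall>b\<in>cmo q w. \<forall>f\<in>herz \<alpha>1 p q1 w.
                (AE x in lebesgue. integrable lebesgue (commutator_integrand \<Phi> A b f x)) \<and>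
                commutator \<Phi> A b f \<in> herz \<alpha>2 p q2 w \<and>
                herz_norm \<alpha>2 p q2 w (commutator \<Phi> A b f)
                  \<le> ennreal C * K \<Phi> A * cmo_norm q w b * herz_norm \<alpha>1 p q1 w f)"
  have bound: "\<exists>C>0. ?bound C (Kconst e_lo e_hi q q1)"
    if "hausdorff_herz w r C p q q1 q2 \<alpha>1 \<alpha>2 e_lo e_hi K" "0 < e_hi" for r C e_lo e_hi K
  proof -
    interpret hausdorff_herz w r C p q q1 q2 \<alpha>1 \<alpha>2 e_lo e_hi K by fact
    let ?C = "total_const TYPE('n)"
    show ?thesis
    proof (intro exI[of _ "?C + 1"] conjI allI impI ballI)
      show "0 < ?C + 1" using total_const_nonneg[of "TYPE('n)"] by simp
      fix \<Phi> :: "'n heis \<Rightarrow> complex" and A b f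
      assume *: "admissible \<Phi> A \<and> Kconst e_lo e_hi q q1 \<Phi> A < \<infinity>" "b \<in> cmo q w" "f \<in> herz \<alpha>1 p q1 w"
      note res = commutator_in_herz[OF conjunct1[OF *(1)] conjunct2[OF *(1)] that(2) *(2,3)]
      show "AE x in lebesgue. integrable lebesgue (commutator_integrand \<Phi> A b f x)"
        and "commutator \<Phi> A b f \<in> herz \<alpha>2 p q2 w" by (fact res)+
      have "ennreal ?C * (Kconst e_lo e_hi q q1 \<Phi> A * cmo_norm q w b * herz_norm \<alpha>1 p q1 w f)
         \<le> ennreal (?C + 1) * (Kconst e_lo e_hi q q1 \<Phi> A * cmo_norm q w b * herz_norm \<alpha>1 p q1 w f)"
        by (intro mult_right_mono ennreal_leI) auto
      with res(3) show "herz_norm \<alpha>2 p q2 w (commutator \<Phi> A b f)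
        \<le> ennreal (?C + 1) * Kconst e_lo e_hi q q1 \<Phi> A * cmo_norm q w b * herz_norm \<alpha>1 p q1 w f"
        by (simp add: mult.assoc)
    qed
  qed
  let ?\<beta> = "recip q1 + \<alpha>1 / ?Q"
  have parts: "(0 \<le> ?\<beta> \<longrightarrow> (\<exists>C>0. ?bound C (K1 \<delta> \<alpha>1 q q1))) \<and> (?\<beta> < 0 \<longrightarrow> (\<exists>C>0. ?bound C (K2 \<delta> \<alpha>1 q q1)))"
    if \<delta>: "1 < \<delta>" "ennreal \<delta> < critical_index w" for \<delta>
  proof -
    obtain r where rh: "1 < r" "\<delta> \<le> r" "reverse_Hoelder r w" "q2 \<noteq> \<infinity>"
      "enn2real q2 * recip q + enn2real q2 * recip q1 + 1 / r \<le> 1"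
      using obtain_exponent[OF assms(2,3,6,9) \<delta>] .
    obtain C where "dyadic_weight w r C" using A1_reverse_Hoelder_dyadic[OF assms(8) rh(1,3)] .
    then interpret dyadic_weight w r C .
    \<comment> \<open>The exponent \<open>-\<alpha>1\<close> belongs to norms below 1 if \<open>\<beta> \<ge> 0\<close>, and to norms above 1 if \<open>\<beta> < 0\<close>.\<close>
    let ?K = "(2 * C) powr \<bar>\<alpha>1 / ?Q + recip q1\<bar>"
    note growth = wvol_growth[OF \<delta>(1) rh(2), of _ \<alpha>1 "recip q1"]
    have "hausdorff_herz w r C p q q1 q2 \<alpha>1 \<alpha>2 (- \<alpha>1) (?e \<delta>) ?K" if "0 \<le> ?\<beta>"
      by unfold_locales (use assms rh that growth in \<open>auto simp: K_exponent_def mult_nonpos_nonneg add.commute\<close>)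
    moreover have "hausdorff_herz w r C p q q1 q2 \<alpha>1 \<alpha>2 (?e \<delta>) (- \<alpha>1) ?K" if "?\<beta> < 0"
      by unfold_locales (use assms rh that growth in \<open>auto simp: K_exponent_def mult_nonneg_nonpos mult_nonpos_nonpos add.commute\<close>)
    moreover have "0 < ?e \<delta>"
    proof -
      have "?e \<delta> = ?Q * recip q1 * (1 / \<delta>) + - \<alpha>1 * ((\<delta> - 1) / \<delta>)"
        unfolding K_exponent_def using \<delta>(1) by (simp add: field_simps)
      moreover have "0 \<le> ?Q * recip q1 * (1 / \<delta>)" using recip_nonneg[of q1] \<delta>(1) by simp
      moreover have "0 < - \<alpha>1 * ((\<delta> - 1) / \<delta>)" using assms(5) \<delta>(1) by (intro mult_pos_pos) auto
      ultimately show ?thesis by linarith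
    qed
    moreover have "0 < - \<alpha>1" using assms(5) by simp
    ultimately show ?thesis unfolding K1_eq_Kconst K2_eq_Kconst using bound by blast
  qed
  show ?thesis using parts by blast
qed

end
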